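(* Let $(a_n)_{n\ge1}$ be integers with $a_n\ge2$ and $\sum_{n=1}^\infty\frac1{a_n}<\infty$, let $\gamma(1)=1$ and $\gamma(n+1)=\prod_{k=1}^n a_k$ for $n\ge1$, and let $G_p$ ($1<p<\infty$) and $G_0$ be the associated Polish groups. Let $1<p<\infty$. Then: 1. $G_p$ is not locally quasi-convex and, hence, not reflexive. 2. $G_0$ is reflexive and, hence, locally quasi-convex. 3. $(G_p)^{\wedge}=(G_0)^{\wedge}=(\mathbb{Z},\boldsymbol{\gamma})$ (as topological groups) and, hence, this group is reflexive.
   Context: $\mathbb{T}=\{z\in\mathbb{C}:|z|=1\}$. For $1\le p<\infty$ and $z\in\mathbb{T}$ put $\|z\|_p=\left(\sum_{n=1}^\infty|1-z^{\gamma(n)}|^p\right)^{1/p}$ and $G_p=\{z\in\mathbb{T}:\|z\|_p<\infty\}$. For $p=0$ put $G_0=\{z\in\mathbb{T}:z^{\gamma(n)}\to1\}$ and $\|z\|_0=\sup_{k\ge1}|1-z^{\gamma(k)}|$. Each $G_p$ is a group under multiplication and is Polish with the translation-invariant metric $(z,w)\mapsto\|zw^{-1}\|_p$. $\boldsymbol{\gamma}=\{\gamma(n)\}$, and $(\mathbb{Z},\boldsymbol{\gamma})$ denotes the group $\mathbb{Z}$ equipped with the finest Hausdorff group topology in which $\gamma(n)$ converges to zero. In item 3, $m\in\mathbb{Z}$ is identified with the character $z\mapsto z^m$. Duality: for an abelian topological group $G$, $G^\wedge$ is the group of continuous homomorphisms (characters) $G\to\mathbb{T}$ with the compact-open topology;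 $(\chi,g)$ denotes the value of $\chi$ at $g$. $G$ is (Pontryagin) reflexive if the canonical homomorphism $\alpha_G:G\to G^{\wedge\wedge}$, $g\mapsto(\chi\mapsto(\chi,g))$, is a topological isomorphism. A subset $A\subset G$ is quasi-convex if for every $g\in G\setminus A$ there is $\chi\in A^{\triangleright}:=\{\chi\in G^\wedge:\ \mathrm{Re}(\chi,h)\ge 0\ \forall h\in A\}$ with $\mathrm{Re}(\chi,g)<0$. $G$ is locally quasi-convex if it has a neighborhood basis of the neutral element consisting of quasi-convex sets. *)

theory Defs
  imports "HOL-Analysis.Analysis" "HOL-Algebra.Elementary_Groups"
begin

section \<open>Abelian topological groups and Pontryagin duality\<close>

text \<open>A topological group is a pair of a HOL-Algebra group and a topology on its carrier.\<close>

definition abelian_topological_group :: "('a, 'b) monoid_scheme \<Rightarrow> 'a topology \<Rightarrow> bool" where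
  "abelian_topological_group G T \<longleftrightarrow>
     comm_group G \<and> topspace T = carrier G \<and>
     continuous_map (prod_topology T T) T (\<lambda>(x, y). x \<otimes>\<^bsub>G\<^esub> y) \<and>
     continuous_map T T (\<lambda>x. inv\<^bsub>G\<^esub> x)"

definition topological_group_iso ::
  "('a, 'c) monoid_scheme \<Rightarrow> 'a topology \<Rightarrow> ('b, 'd) monoid_scheme \<Rightarrow> 'b topology \<Rightarrow> ('a \<Rightarrow> 'b) \<Rightarrow> bool" where
  "topological_group_iso G T H S f \<longleftrightarrow> f \<in> iso G H \<and> homeomorphic_map T S f"

definition circle_group :: "complex monoid" where
  "circle_group = \<lparr>carrier = sphere 0 1, monoid.mult = (*), one = 1\<rparr>"

text \<open>Characters are taken to be \<^const>\<open>undefined\<close> outside the carrier, so that distinct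
  elements of the dual are distinct as functions on the group.\<close>

definition characters :: "('a, 'b) monoid_scheme \<Rightarrow> 'a topology \<Rightarrow> ('a \<Rightarrow> complex) set" where
  "characters G T =
     {\<phi> \<in> extensional (carrier G).
        \<phi> \<in> hom G circle_group \<and> continuous_map T (top_of_set (sphere 0 1)) \<phi>}"

definition dual_group :: "('a, 'b) monoid_scheme \<Rightarrow> 'a topology \<Rightarrow> ('a \<Rightarrow> complex) monoid" where
  "dual_group G T =
     \<lparr>carrier = characters G T,
      monoid.mult = (\<lambda>\<phi> \<psi>. \<lambda>x\<in>carrier G. \<phi> x * \<psi> x),
      one = (\<lambda>x\<in>carrier G. 1)\<rparr>"

text \<open>The compact-open topology. The choice \<open>K = {}\<close> puts the whole dual into the subbasis,
  so this is a topology on all of \<open>characters G T\<close>.\<close>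

definition dual_topology :: "('a, 'b) monoid_scheme \<Rightarrow> 'a topology \<Rightarrow> ('a \<Rightarrow> complex) topology" where
  "dual_topology G T =
     topology_generated_by
       {{\<phi> \<in> characters G T. \<phi> ` K \<subseteq> U} | K U. compactin T K \<and> openin (top_of_set (sphere 0 1)) U}"

definition canonical_map ::
  "('a, 'b) monoid_scheme \<Rightarrow> 'a topology \<Rightarrow> 'a \<Rightarrow> ('a \<Rightarrow> complex) \<Rightarrow> complex" where
  "canonical_map G T g = (\<lambda>\<phi>\<in>characters G T. \<phi> g)"

definition reflexive_group :: "('a, 'b) monoid_scheme \<Rightarrow> 'a topology \<Rightarrow> bool" where
  "reflexive_group G T \<longleftrightarrow>
     topological_group_iso G T
       (dual_group (dual_group G T) (dual_topology G T))
       (dual_topology (dual_group G T) (dual_topology G T))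
       (canonical_map G T)"

definition polar :: "('a, 'b) monoid_scheme \<Rightarrow> 'a topology \<Rightarrow> 'a set \<Rightarrow> ('a \<Rightarrow> complex) set" where
  "polar G T A = {\<phi> \<in> characters G T. \<forall>h\<in>A. Re (\<phi> h) \<ge> 0}"

definition quasi_convex :: "('a, 'b) monoid_scheme \<Rightarrow> 'a topology \<Rightarrow> 'a set \<Rightarrow> bool" where
  "quasi_convex G T A \<longleftrightarrow>
     A \<subseteq> carrier G \<and> (\<forall>g\<in>carrier G - A. \<exists>\<phi>\<in>polar G T A. Re (\<phi> g) < 0)"

text \<open>Quasi-convex neighbourhoods \<open>V\<close> of the neutral element need not be open.\<close>

definition locally_quasi_convex :: "('a, 'b) monoid_scheme \<Rightarrow> 'a topology \<Rightarrow> bool" where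
  "locally_quasi_convex G T \<longleftrightarrow>
     (\<forall>U. openin T U \<and> \<one>\<^bsub>G\<^esub> \<in> U \<longrightarrow>
        (\<exists>V W. openin T W \<and> \<one>\<^bsub>G\<^esub> \<in> W \<and> W \<subseteq> V \<and> V \<subseteq> U \<and> quasi_convex G T V))"


section \<open>The groups \<open>G\<^sub>p\<close> and \<open>G\<^sub>0\<close> of an integer sequence\<close>

text \<open>Sequences are indexed from \<open>1\<close>; the value \<open>\<gamma> 0\<close> is irrelevant.
  The condition \<open>\<parallel>z\<parallel>\<^sub>p < \<infinity>\<close> is summability of the defining series.\<close>

definition Gp_set :: "(nat \<Rightarrow> int) \<Rightarrow> real \<Rightarrow> complex set" where
  "Gp_set \<gamma> p = {z \<in> sphere 0 1. summable (\<lambda>n. norm (1 - z powi \<gamma> (Suc n)) powr p)}"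

definition Gp_norm :: "(nat \<Rightarrow> int) \<Rightarrow> real \<Rightarrow> complex \<Rightarrow> real" where
  "Gp_norm \<gamma> p z = (\<Sum>n. norm (1 - z powi \<gamma> (Suc n)) powr p) powr (1 / p)"

definition G0_set :: "(nat \<Rightarrow> int) \<Rightarrow> complex set" where
  "G0_set \<gamma> = {z \<in> sphere 0 1. (\<lambda>n. z powi \<gamma> (Suc n)) \<longlonglongrightarrow> 1}"

definition G0_norm :: "(nat \<Rightarrow> int) \<Rightarrow> complex \<Rightarrow> real" where
  "G0_norm \<gamma> z = (SUP n. norm (1 - z powi \<gamma> (Suc n)))"

text \<open>The locale \<^locale>\<open>Metric_space\<close> requires symmetry and nonnegativity of the distance
  on the whole type, hence the value \<open>0\<close> off the carrier.\<close>

definition invariant_dist :: "complex set \<Rightarrow> (complex \<Rightarrow> real) \<Rightarrow> complex \<Rightarrow> complex \<Rightarrow> real" where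
  "invariant_dist M N z w = (if z \<in> M \<and> w \<in> M then N (z * inverse w) else 0)"

definition Gp :: "(nat \<Rightarrow> int) \<Rightarrow> real \<Rightarrow> complex monoid" where
  "Gp \<gamma> p = circle_group\<lparr>carrier := Gp_set \<gamma> p\<rparr>"

definition Gp_topology :: "(nat \<Rightarrow> int) \<Rightarrow> real \<Rightarrow> complex topology" where
  "Gp_topology \<gamma> p =
     Metric_space.mtopology (Gp_set \<gamma> p) (invariant_dist (Gp_set \<gamma> p) (Gp_norm \<gamma> p))"

definition G0 :: "(nat \<Rightarrow> int) \<Rightarrow> complex monoid" where
  "G0 \<gamma> = circle_group\<lparr>carrier := G0_set \<gamma>\<rparr>"

definition G0_topology :: "(nat \<Rightarrow> int) \<Rightarrow> complex topology" where
  "G0_topology \<gamma> =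
     Metric_space.mtopology (G0_set \<gamma>) (invariant_dist (G0_set \<gamma>) (G0_norm \<gamma>))"


section \<open>The group of integers with the finest topology making a sequence null\<close>

definition null_group_topology :: "(nat \<Rightarrow> int) \<Rightarrow> int topology \<Rightarrow> bool" where
  "null_group_topology \<gamma> T \<longleftrightarrow>
     abelian_topological_group integer_group T \<and> Hausdorff_space T \<and> limitin T \<gamma> 0 sequentially"

definition finest_null_group_topology :: "(nat \<Rightarrow> int) \<Rightarrow> int topology \<Rightarrow> bool" where
  "finest_null_group_topology \<gamma> T \<longleftrightarrow>
     null_group_topology \<gamma> T \<and>
     (\<forall>S. null_group_topology \<gamma> S \<longrightarrow> (\<forall>U. openin S U \<longrightarrow> openin T U))"

lemma finest_null_group_topology_unique:
  "finest_null_group_topology \<gamma> S \<Longrightarrow> finest_null_group_topology \<gamma> T \<Longrightarrow> S = T"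
  unfolding finest_null_group_topology_def topology_eq by blast

definition power_character :: "complex set \<Rightarrow> int \<Rightarrow> complex \<Rightarrow> complex" where
  "power_character M m = (\<lambda>z\<in>M. z powi m)"

end

theory Submission
  imports Defs "HOL-Real_Asymp.Real_Asymp"
begin

text \<open>A continuous character of \<open>G\<^sub>p\<close> or \<open>G\<^sub>0\<close> is determined on the dense subgroup of the
  \<open>\<gamma>(n)\<close>-th roots of unity by a sequence of integer digits. Positivity of its real part on a
  \<open>p\<close>-ball bounds the \<open>l\<^sup>q\<close>-norm of the digits; as these are integers and \<open>q < \<infinity>\<close>, only boundedly
  many of them are nonzero. Hence the character is \<open>z \<mapsto> z\<^sup>m\<close> with \<open>m\<close> a sum of boundedly many terms
  \<open>\<plusminus>\<gamma>(n)\<close>. Sets of such sums are compact in every group topology in which \<open>\<gamma>(n) \<rightarrow> 0\<close>, so a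
  Banach--Dieudonne argument identifies the compact-open topology of the dual with the finest
  such topology; \<open>G\<^sub>0\<close> is then recovered as the dual of the integers. Moreover, the bipolar of a
  \<open>p\<close>-ball contains a ball of the sup norm, on which the \<open>p\<close>-norm is unbounded.\<close>

section \<open>The unit circle\<close>

text \<open>The dual exponent q of the digit bound never appears in the code. A character is tested
  on roots of unity with at most \<open>L\<close> nonzero digits of relative size
  \<open>2 / L\<close>. The p-th power of their norm is of order \<open>L powr (1 - p)\<close>,
  small because p > 1, whereas \<open>L\<close> nonzero digits of the character would add up to an
  angle of at least \<pi>, outside the right half plane. The convergence of the sum of 1/a_n enters
  as growth of a_n: from some position on, a test digit of relative size \<open>2 / L\<close> can be
  a positive integer.

  The compact sets of G_p and of G_0 are a priori unrelated, so the two duals might carry different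
  topologies on the integers. Each is shown to be the finest group topology in which \<gamma> is
  null, which is unique; its existence comes out of the same argument. Both groups are therefore
  treated at once, as subgroups of the circle whose norm dominates the sup norm and, on roots of
  unity, is controlled by an l^q-sum with some q > 1.\<close>

lemma norm_1_minus_cis: "norm (1 - cis s) = 2 * \<bar>sin (s / 2)\<bar>"
proof -
  have "(norm (1 - cis s))\<^sup>2 = (1 - cos s)\<^sup>2 + (sin s)\<^sup>2"
    by (simp add: cmod_power2)
  also have "\<dots> = 2 - 2 * cos s"
    using sin_cos_squared_add[of s] by (simp add: power2_eq_square algebra_simps)
  also have "\<dots> = (2 * \<bar>sin (s / 2)\<bar>)\<^sup>2"
    using cos_double_sin[of "s / 2"] by (simp add: power_mult_distrib)
  finally show ?thesis
    by (subst (asm) power2_eq_iff_nonneg) auto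
qed

lemma norm_1_minus_cis_le: "norm (1 - cis s) \<le> \<bar>s\<bar>"
  using abs_sin_x_le_abs_x[of "s / 2"] by (simp add: norm_1_minus_cis)

text \<open>Up to \<pi>/3 the derivative cos t - 1/2 is nonnegative. Beyond, sin is at least sqrt 3
  / 2 \<ge> 17/20, while x / 2 \<le> 4/5.\<close>

lemma sin_ge_half:
  fixes x :: real
  assumes "0 \<le> x" "x \<le> pi / 2"
  shows "x / 2 \<le> sin x"
proof (cases "x \<le> pi / 3")
  case True
  have "sin 0 - 0 / 2 \<le> sin x - x / 2"
  proof (rule DERIV_nonneg_imp_nondecreasing[OF assms(1)])
    fix t assume t: "0 \<le> t" "t \<le> x"
    then have "cos (pi / 3) \<le> cos t"
      using True pi_gt_zero by (intro cos_monotone_0_pi_le) auto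
    moreover have "((\<lambda>t. sin t - t / 2) has_real_derivative cos t - 1 / 2) (at t)"
      by (auto intro!: derivative_eq_intros)
    ultimately show "\<exists>y. ((\<lambda>t. sin t - t / 2) has_real_derivative y) (at t) \<and> 0 \<le> y"
      by (auto simp: cos_60)
  qed
  then show ?thesis by simp
next
  case False
  then have "sin (pi / 3) \<le> sin x"
    using assms by (intro sin_monotone_2pi_le) auto
  moreover have "17 / 10 \<le> sqrt (3::real)" by (rule real_le_rsqrt) (simp add: power2_eq_square)
  moreover have "x \<le> 8 / 5" using assms pi_approx by simp
  ultimately show ?thesis by (simp add: sin_60)
qed

lemma abs_le_norm_1_minus_cis:
  assumes "\<bar>s\<bar> \<le> pi"
  shows "\<bar>s\<bar> \<le> 2 * norm (1 - cis s)"
proof -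
  have "\<bar>s\<bar> / 4 \<le> sin (\<bar>s\<bar> / 2)" using sin_ge_half[of "\<bar>s\<bar> / 2"] assms by simp
  also have "\<dots> \<le> \<bar>sin (s / 2)\<bar>" by (cases "s \<ge> 0") auto
  finally show ?thesis by (simp add: norm_1_minus_cis)
qed

lemma le_pi_half_if_cos_nonneg:
  assumes "0 \<le> x" "x \<le> pi" "0 \<le> cos x"
  shows "x \<le> pi / 2"
  using cos_monotone_0_pi[of "pi / 2" x] assms by fastforce

text \<open>The multiples of s cannot jump over the arc where cos is negative: once J |s| \<le>
  \<pi>/2, the next multiple is at most \<pi>, and there a nonnegative cosine forces it back to at
  most \<pi>/2.\<close>

lemma mult_abs_le_pi_half:
  assumes "\<bar>s\<bar> \<le> pi" "\<And>j. 1 \<le> j \<Longrightarrow> j \<le> J \<Longrightarrow> 0 \<le> cos (real j * s)"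
  shows "real J * \<bar>s\<bar> \<le> pi / 2"
  using assms(2)
proof (induction J)
  case (Suc J)
  have c: "0 \<le> cos (real (Suc J) * \<bar>s\<bar>)"
    using Suc.prems[of "Suc J"] by (cases "s \<ge> 0") auto
  have J: "real J * \<bar>s\<bar> \<le> pi / 2" using Suc by auto
  have "real (Suc J) * \<bar>s\<bar> \<le> pi"
  proof (cases "J = 0")
    case False
    then have "\<bar>s\<bar> \<le> real J * \<bar>s\<bar>" by (simp add: mult_le_cancel_right1)
    with J have "\<bar>s\<bar> \<le> pi / 2" by simp
    then show ?thesis using J by (simp add: algebra_simps)
  qed (use assms in auto)
  then show ?case using le_pi_half_if_cos_nonneg c by (simp add: abs_mult)
qed auto

lemma circle_eq_cis_Arg: "norm z = 1 \<Longrightarrow> z = cis (Arg z)"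
  by (metis cis_Arg norm_zero sgn_eq zero_neq_one div_by_1 of_real_1)

lemma mult_Arg_le_pi_half:
  assumes "norm w = 1" "\<And>j. 1 \<le> j \<Longrightarrow> j \<le> J \<Longrightarrow> 0 \<le> Re (w ^ j)"
  shows "real J * \<bar>Arg w\<bar> \<le> pi / 2"
proof (rule mult_abs_le_pi_half)
  show "\<bar>Arg w\<bar> \<le> pi" using Arg_bounded[of w] by auto
  fix j :: nat assume "1 \<le> j" "j \<le> J"
  then have "0 \<le> Re (w ^ j)" using assms by auto
  moreover have "w ^ j = cis (real j * Arg w)"
    using Complex.DeMoivre[of "Arg w" j] circle_eq_cis_Arg[OF assms(1)] by simp
  ultimately show "0 \<le> cos (real j * Arg w)" by simp
qed

text \<open>A quantitative form of the fact that the closed right half plane contains no nontrivial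
  subgroup of the circle. It turns conditions Re \<ge> 0 on finitely many powers into closeness to
  1.\<close>

lemma norm_1_minus_le_if_Re_powers_nonneg:
  assumes "norm w = 1" "\<And>j. 1 \<le> j \<Longrightarrow> j \<le> J \<Longrightarrow> 0 \<le> Re (w ^ j)"
  shows "real J * norm (1 - w) \<le> 2"
proof -
  have "real J * norm (1 - w) \<le> real J * \<bar>Arg w\<bar>"
    using norm_1_minus_cis_le[of "Arg w"] circle_eq_cis_Arg[OF assms(1)]
    by (intro mult_left_mono) auto
  moreover have "real J * \<bar>Arg w\<bar> \<le> pi / 2" by (rule mult_Arg_le_pi_half[OF assms])
  ultimately show ?thesis using pi_less_4 by linarith
qed

lemma eq_1_if_Re_powers_nonneg:
  assumes "norm w = 1" "\<And>j. 0 \<le> Re (w ^ j)"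
  shows "w = 1"
proof (rule ccontr)
  assume "w \<noteq> 1"
  then have "norm (1 - w) > 0" by simp
  then obtain J where "2 < real J * norm (1 - w)"
    using reals_Archimedean3 by blast
  with norm_1_minus_le_if_Re_powers_nonneg[of w J] assms show False by force
qed

lemma Re_nonneg_if_norm_1_minus_le: "norm (1 - w) \<le> 1 \<Longrightarrow> 0 \<le> Re w"
  using complex_Re_le_cmod[of "1 - w"] by simp

lemma norm_1_minus_mult_le:
  fixes z w :: complex
  assumes "norm z = 1"
  shows "norm (1 - z * w) \<le> norm (1 - z) + norm (1 - w)"
proof -
  have eq: "1 - z * w = (1 - z) + z * (1 - w)" by (simp add: algebra_simps)
  show ?thesis unfolding eq using norm_triangle_ineq[of "1 - z" "z * (1 - w)"] assms
    by (simp add: norm_mult)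
qed

lemma norm_1_minus_divide:
  fixes z w :: complex
  assumes "norm w = 1"
  shows "norm (1 - z / w) = norm (z - w)"
proof -
  have "w \<noteq> 0" using assms by auto
  then have "1 - z / w = (w - z) / w" by (simp add: diff_divide_distrib)
  then show ?thesis using assms by (simp add: norm_divide norm_minus_commute)
qed

lemma norm_1_minus_inverse:
  fixes w :: complex
  assumes "norm w = 1"
  shows "norm (1 - inverse w) = norm (1 - w)"
  using norm_1_minus_divide[OF assms, of 1] by (simp add: divide_inverse)

lemma norm_1_minus_power_le:
  fixes z :: complex
  assumes "norm z = 1"
  shows "norm (1 - z ^ n) \<le> real n * norm (1 - z)"
proof (induction n)
  case (Suc n)
  then show ?case using norm_1_minus_mult_le[OF assms, of "z ^ n"] by (simp add: algebra_simps)
qed auto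

lemma norm_power_int_1: "norm z = 1 \<Longrightarrow> norm (z powi m) = 1" for z :: complex
  by (simp add: norm_power_int)

lemma norm_1_minus_power_int_le:
  fixes z :: complex
  assumes "norm z = 1"
  shows "norm (1 - z powi m) \<le> \<bar>of_int m\<bar> * norm (1 - z)"
proof (cases "m \<ge> 0")
  case True
  then show ?thesis using norm_1_minus_power_le[OF assms, of "nat m"]
    by (simp add: power_int_def)
next
  case False
  then have "z powi m = inverse (z ^ nat (- m))" by (simp add: power_int_def power_inverse)
  then show ?thesis
    using norm_1_minus_power_le[OF assms, of "nat (- m)"] False assms
    by (simp add: norm_1_minus_inverse norm_power)
qed

lemma norm_power_int_diff:
  fixes z :: complex
  assumes "norm z = 1"
  shows "norm (z powi m - z powi k) = norm (1 - z powi (m - k))"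
proof -
  have "z \<noteq> 0" using assms by auto
  then show ?thesis
    using norm_1_minus_divide[of "z powi k" "z powi m"] norm_power_int_1[OF assms]
    by (simp add: power_int_diff)
qed

section \<open>The compact-open topology and reflexivity\<close>

lemma hom_circle_groupI:
  assumes "\<And>x. x \<in> carrier G \<Longrightarrow> norm (\<phi> x) = 1"
    and "\<And>x y. x \<in> carrier G \<Longrightarrow> y \<in> carrier G \<Longrightarrow> \<phi> (x \<otimes>\<^bsub>G\<^esub> y) = \<phi> x * \<phi> y"
  shows "\<phi> \<in> hom G circle_group"
  using assms by (auto simp: hom_def circle_group_def)

lemma charactersD:
  assumes "\<phi> \<in> characters G T"
  shows "\<phi> \<in> extensional (carrier G)"
    and "\<And>x. x \<in> carrier G \<Longrightarrow> norm (\<phi> x) = 1"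
    and "\<And>x y. x \<in> carrier G \<Longrightarrow> y \<in> carrier G \<Longrightarrow> \<phi> (x \<otimes>\<^bsub>G\<^esub> y) = \<phi> x * \<phi> y"
    and "continuous_map T (top_of_set (sphere 0 1)) \<phi>"
  using assms by (auto simp: characters_def hom_def circle_group_def Pi_iff)

lemma character_one:
  assumes "\<phi> \<in> characters G T" "monoid G"
  shows "\<phi> \<one>\<^bsub>G\<^esub> = 1"
proof -
  interpret monoid G by fact
  have "\<phi> \<one>\<^bsub>G\<^esub> * \<phi> \<one>\<^bsub>G\<^esub> = \<phi> \<one>\<^bsub>G\<^esub> * 1" "norm (\<phi> \<one>\<^bsub>G\<^esub>) = 1"
    using charactersD(2,3)[OF assms(1)] by (metis one_closed l_one mult.right_neutral)+
  then show ?thesis by (metis mult_left_cancel norm_zero zero_neq_one)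
qed

lemma carrier_dual_group [simp]: "carrier (dual_group G T) = characters G T"
  and mult_dual_group: "\<phi> \<otimes>\<^bsub>dual_group G T\<^esub> \<psi> = (\<lambda>x\<in>carrier G. \<phi> x * \<psi> x)"
  by (simp_all add: dual_group_def)

lemma topspace_dual_topology [simp]: "topspace (dual_topology G T) = characters G T"
proof
  show "topspace (dual_topology G T) \<subseteq> characters G T"
    by (auto simp: dual_topology_def topology_generated_by_topspace)
  have "{\<phi> \<in> characters G T. \<phi> ` {} \<subseteq> {}} \<in> {{\<phi> \<in> characters G T. \<phi> ` K \<subseteq> U} | K U.
      compactin T K \<and> openin (top_of_set (sphere 0 1)) U}"
    by blast
  then show "characters G T \<subseteq> topspace (dual_topology G T)"
    unfolding dual_topology_def topology_generated_by_topspace by auto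
qed

text \<open>Metric description of neighbourhoods in the compact-open topology. Openness of these
  sets themselves is not claimed; they serve as neighbourhoods in
  \<open>openin_dual_topology_iff\<close>.\<close>

definition uniform_nbhd ::
  "('a, 'b) monoid_scheme \<Rightarrow> 'a topology \<Rightarrow> 'a set \<Rightarrow> real \<Rightarrow> ('a \<Rightarrow> complex) \<Rightarrow> ('a \<Rightarrow> complex) set" where
  "uniform_nbhd G T K e \<phi> = {\<psi> \<in> characters G T. \<forall>x\<in>K. norm (\<psi> x - \<phi> x) < e}"

lemma uniform_nbhd_Un:
  "uniform_nbhd G T (K \<union> K') (min e e') \<phi> \<subseteq> uniform_nbhd G T K e \<phi> \<inter> uniform_nbhd G T K' e' \<phi>"
  by (auto simp: uniform_nbhd_def)

lemma compact_character_image: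
  assumes "\<phi> \<in> characters G T" "compactin T K"
  shows "compact (\<phi> ` K)"
  using image_compactin[OF assms(2) charactersD(4)[OF assms(1)]]
  by (simp add: compactin_subtopology)

text \<open>The compact image of K has a positive distance from the complement of the open
  set.\<close>

lemma uniform_nbhd_subset_subbasic:
  assumes "\<phi> \<in> characters G T" "compactin T K" "openin (top_of_set (sphere 0 1)) U" "\<phi> ` K \<subseteq> U"
    and "topspace T = carrier G"
  shows "\<exists>e>0. uniform_nbhd G T K e \<phi> \<subseteq> {\<psi> \<in> characters G T. \<psi> ` K \<subseteq> U}"
proof -
  obtain V where V: "open V" "U = V \<inter> sphere 0 1"
    using assms(3) by (auto simp: openin_open)
  have K: "K \<subseteq> carrier G" using assms compactin_subset_topspace by blast
  have "compact (\<phi> ` K)" by (rule compact_character_image[OF assms(1,2)])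
  then obtain e where e: "e > 0" "(\<Union>x\<in>\<phi> ` K. ball x e) \<subseteq> V"
    using compact_subset_open_imp_ball_epsilon_subset[of "\<phi> ` K" V] V assms(4) by blast
  have "\<psi> x \<in> U" if "\<psi> \<in> characters G T" "x \<in> K" "norm (\<psi> x - \<phi> x) < e" for \<psi> x
  proof -
    have "\<psi> x \<in> ball (\<phi> x) e" using that by (simp add: dist_norm norm_minus_commute)
    then have "\<psi> x \<in> V" using e that by blast
    then show ?thesis using V that K charactersD(2)[OF that(1)] by auto
  qed
  then show ?thesis using e by (auto simp: uniform_nbhd_def)
qed

text \<open>Finitely many balls of radius e/4 cover the compact image of K and cut K into compact
  pieces \<open>P w\<close> on which \<phi> stays within e/4 of w. Prescribing the ball of radius
  e/2 on each piece is a finite set of subbasic conditions, and e/4 + e/2 < e.\<close>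

lemma uniform_nbhd_contains_open:
  assumes "\<phi> \<in> characters G T" "compactin T K" "e > 0"
  shows "\<exists>W. openin (dual_topology G T) W \<and> \<phi> \<in> W \<and> W \<subseteq> uniform_nbhd G T K e \<phi>"
proof -
  have cK: "compact (\<phi> ` K)" by (rule compact_character_image[OF assms(1,2)])
  have "\<phi> ` K \<subseteq> (\<Union>x\<in>\<phi> ` K. ball x (e / 4))" using assms(3) by auto
  then obtain F where F: "F \<subseteq> \<phi> ` K" "finite F" "\<phi> ` K \<subseteq> (\<Union>x\<in>F. ball x (e / 4))"
    using compactE_image[OF cK, of "\<phi> ` K" "\<lambda>x. ball x (e / 4)"] by auto
  define P where "P w = K \<inter> {x \<in> topspace T. \<phi> x \<in> cball w (e / 4) \<inter> sphere 0 1}" for w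
  define B where "B w = {\<psi> \<in> characters G T. \<psi> ` P w \<subseteq> ball w (e / 2) \<inter> sphere 0 1}" for w
  have oB: "openin (dual_topology G T) (B w)" for w
  proof -
    have "closedin (top_of_set (sphere 0 1)) (cball w (e / 4) \<inter> sphere 0 1)"
      using closedin_closed_Int[of "cball w (e / 4)" "sphere (0::complex) 1"]
      by (simp add: Int_commute)
    then have "closedin T {x \<in> topspace T. \<phi> x \<in> cball w (e / 4) \<inter> sphere 0 1}"
      using closedin_continuous_map_preimage[OF charactersD(4)[OF assms(1)]] by blast
    then have "compactin T (P w)"
      unfolding P_def using assms(2) by (metis closed_Int_compactin Int_commute)
    moreover have "openin (top_of_set (sphere 0 1)) (ball w (e / 2) \<inter> sphere 0 1)"
      using openin_open_Int[of "ball w (e / 2)" "sphere (0::complex) 1"] by (simp add: Int_commute)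
    ultimately show ?thesis
      unfolding dual_topology_def B_def
      by (intro topology_generated_by_Basis) blast
  qed
  have KT: "K \<subseteq> topspace T" using assms(2) compactin_subset_topspace by blast
  have sph: "\<phi> x \<in> sphere 0 1" if "x \<in> topspace T" for x
    using charactersD(4)[OF assms(1)] that by (auto simp: continuous_map_def)
  \<comment> \<open>The factor \<open>characters G T\<close> matters when K, and with it F, is
    empty: the bare intersection would be the whole type.\<close>
  define W where "W = characters G T \<inter> (\<Inter>w\<in>F. B w)"
  have top: "openin (dual_topology G T) (characters G T)"
    by (metis openin_topspace topspace_dual_topology)
  have "openin (dual_topology G T) W"
    unfolding W_def using F(2)
  proof induction
    case (insert w F)
    have "characters G T \<inter> \<Inter> (B ` insert w F) = (characters G T \<inter> \<Inter> (B ` F)) \<inter> B w" by auto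
    then show ?case using openin_Int[OF insert.IH oB] by simp
  qed (simp add: top)
  moreover have "\<phi> \<in> W"
    using assms sph by (auto simp: W_def B_def P_def)
  moreover have "W \<subseteq> uniform_nbhd G T K e \<phi>"
  proof
    fix \<psi> assume \<psi>: "\<psi> \<in> W"
    have "norm (\<psi> x - \<phi> x) < e" if x: "x \<in> K" for x
    proof -
      obtain w where w: "w \<in> F" "\<phi> x \<in> ball w (e / 4)" using F x by blast
      then have "x \<in> P w" using x KT sph by (auto simp: P_def)
      then have "\<psi> x \<in> ball w (e / 2)" using \<psi> w by (force simp: W_def B_def)
      then have "dist w (\<psi> x) < e / 2" by simp
      moreover have "dist w (\<phi> x) < e / 4" using w by simp
      ultimately have "dist (\<psi> x) (\<phi> x) < e" by (metric)
      then show ?thesis by (simp add: dist_norm)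
    qed
    then show "\<psi> \<in> uniform_nbhd G T K e \<phi>" using \<psi> by (auto simp: uniform_nbhd_def W_def)
  qed
  ultimately show ?thesis by blast
qed

lemma openin_dual_topology_iff:
  assumes "topspace T = carrier G"
  shows "openin (dual_topology G T) W \<longleftrightarrow>
    W \<subseteq> characters G T \<and> (\<forall>\<phi>\<in>W. \<exists>K e. compactin T K \<and> e > 0 \<and> uniform_nbhd G T K e \<phi> \<subseteq> W)"
    (is "?L \<longleftrightarrow> ?R")
proof
  assume R: ?R
  show ?L
  proof (subst openin_subopen, intro ballI)
    fix \<phi> assume "\<phi> \<in> W"
    with R obtain K e where "compactin T K" "e > 0" "uniform_nbhd G T K e \<phi> \<subseteq> W" "\<phi> \<in> characters G T"
      by blast
    then show "\<exists>V. openin (dual_topology G T) V \<and> \<phi> \<in> V \<and> V \<subseteq> W"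
      using uniform_nbhd_contains_open[of \<phi> G T K e] by blast
  qed
next
  assume L: ?L
  then have "generate_topology_on
     {{\<phi> \<in> characters G T. \<phi> ` K \<subseteq> U} | K U. compactin T K \<and> openin (top_of_set (sphere 0 1)) U} W"
    by (simp add: dual_topology_def openin_topology_generated_by_iff)
  then show ?R
  proof induction
    case Empty
    then show ?case by simp
  next
    case (Int V W)
    show ?case
    proof (intro conjI ballI)
      fix \<phi> assume "\<phi> \<in> V \<inter> W"
      then obtain K e K' e' where *: "compactin T K" "e > 0" "uniform_nbhd G T K e \<phi> \<subseteq> V"
          "compactin T K'" "e' > 0" "uniform_nbhd G T K' e' \<phi> \<subseteq> W"
        using Int.IH by (meson IntD1 IntD2)
      then have "compactin T (K \<union> K') \<and> min e e' > 0 \<and> uniform_nbhd G T (K \<union> K') (min e e') \<phi> \<subseteq> V \<inter> W"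
        using uniform_nbhd_Un[of G T K K' e e' \<phi>] by (simp add: compactin_Un) blast
      then show "\<exists>K e. compactin T K \<and> e > 0 \<and> uniform_nbhd G T K e \<phi> \<subseteq> V \<inter> W" by blast
    qed (use Int.IH in blast)
  next
    case (UN \<K>)
    show ?case
    proof (intro conjI ballI)
      fix \<phi> assume "\<phi> \<in> \<Union>\<K>"
      then obtain V where "V \<in> \<K>" "\<phi> \<in> V" by blast
      with UN.IH[of V] show "\<exists>K e. compactin T K \<and> e > 0 \<and> uniform_nbhd G T K e \<phi> \<subseteq> \<Union>\<K>"
        by (meson Union_upper subset_trans)
    qed (use UN.IH in blast)
  next
    case (Basis W)
    then obtain K U where W: "W = {\<phi> \<in> characters G T. \<phi> ` K \<subseteq> U}"
      and KU: "compactin T K" "openin (top_of_set (sphere 0 1)) U" by blast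
    show ?case
      unfolding W using uniform_nbhd_subset_subbasic[OF _ KU _ assms] KU by auto
  qed
qed

lemma topological_group_isoD:
  assumes "topological_group_iso G T H S f"
  shows "bij_betw f (carrier G) (carrier H)"
    and "\<And>x. x \<in> carrier G \<Longrightarrow> f x \<in> carrier H"
    and "\<And>x y. x \<in> carrier G \<Longrightarrow> y \<in> carrier G \<Longrightarrow> f (x \<otimes>\<^bsub>G\<^esub> y) = f x \<otimes>\<^bsub>H\<^esub> f y"
    and "homeomorphic_map T S f"
  using assms unfolding topological_group_iso_def iso_def hom_def by auto

lemma dual_map_in_characters:
  assumes "continuous_map T S f" "topspace T = carrier G" "topspace S = carrier H"
    and "\<And>x y. x \<in> carrier G \<Longrightarrow> y \<in> carrier G \<Longrightarrow> f (x \<otimes>\<^bsub>G\<^esub> y) = f x \<otimes>\<^bsub>H\<^esub> f y"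
    and "\<And>x y. x \<in> carrier G \<Longrightarrow> y \<in> carrier G \<Longrightarrow> x \<otimes>\<^bsub>G\<^esub> y \<in> carrier G"
    and "\<psi> \<in> characters H S"
  shows "(\<lambda>x\<in>carrier G. \<psi> (f x)) \<in> characters G T"
proof -
  have f: "f x \<in> carrier H" if "x \<in> carrier G" for x
    using assms(1-3) that by (auto simp: continuous_map_def)
  have "continuous_map T (top_of_set (sphere 0 1)) (\<psi> \<circ> f)"
    using assms(1) charactersD(4)[OF assms(6)] by (rule continuous_map_compose)
  then have "continuous_map T (top_of_set (sphere 0 1)) (\<lambda>x\<in>carrier G. \<psi> (f x))"
    by (rule continuous_map_eq) (simp add: assms(2))
  moreover have "(\<lambda>x\<in>carrier G. \<psi> (f x)) \<in> hom G circle_group"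
    using assms(4,5) f charactersD(2,3)[OF assms(6)] by (intro hom_circle_groupI) auto
  ultimately show ?thesis by (simp add: characters_def)
qed

text \<open>The transpose of f is continuous because f maps compact sets to compact sets: a
  condition on K pulls back to the same condition on the image of K.\<close>

lemma dual_map_continuous:
  assumes "continuous_map T S f" "topspace T = carrier G" "topspace S = carrier H"
    and "\<And>x y. x \<in> carrier G \<Longrightarrow> y \<in> carrier G \<Longrightarrow> f (x \<otimes>\<^bsub>G\<^esub> y) = f x \<otimes>\<^bsub>H\<^esub> f y"
    and "\<And>x y. x \<in> carrier G \<Longrightarrow> y \<in> carrier G \<Longrightarrow> x \<otimes>\<^bsub>G\<^esub> y \<in> carrier G"
  shows "continuous_map (dual_topology H S) (dual_topology G T) (\<lambda>\<psi>. \<lambda>x\<in>carrier G. \<psi> (f x))"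
  unfolding continuous_map_def topspace_dual_topology
proof (intro conjI allI impI)
  show "(\<lambda>\<psi>. \<lambda>x\<in>carrier G. \<psi> (f x)) \<in> characters H S \<rightarrow> characters G T"
    using dual_map_in_characters[OF assms] by auto
  fix W assume "openin (dual_topology G T) W"
  then have W: "W \<subseteq> characters G T"
    "\<And>\<phi>. \<phi> \<in> W \<Longrightarrow> \<exists>K e. compactin T K \<and> e > 0 \<and> uniform_nbhd G T K e \<phi> \<subseteq> W"
    using openin_dual_topology_iff[OF assms(2), of W] by blast+
  show "openin (dual_topology H S) {\<psi> \<in> characters H S. (\<lambda>x\<in>carrier G. \<psi> (f x)) \<in> W}"
    unfolding openin_dual_topology_iff[OF assms(3)]
  proof (intro conjI ballI)
    fix \<psi> assume \<psi>: "\<psi> \<in> {\<psi> \<in> characters H S. (\<lambda>x\<in>carrier G. \<psi> (f x)) \<in> W}"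
    then obtain K e where K: "compactin T K" "e > 0"
        "uniform_nbhd G T K e (\<lambda>x\<in>carrier G. \<psi> (f x)) \<subseteq> W"
      using W(2) by blast
    have KG: "K \<subseteq> carrier G" using K(1) assms(2) compactin_subset_topspace by blast
    have "compactin S (f ` K)" using image_compactin[OF K(1) assms(1)] .
    moreover have "uniform_nbhd H S (f ` K) e \<psi> \<subseteq> {\<psi> \<in> characters H S. (\<lambda>x\<in>carrier G. \<psi> (f x)) \<in> W}"
    proof
      fix \<phi> assume "\<phi> \<in> uniform_nbhd H S (f ` K) e \<psi>"
      then have "\<phi> \<in> characters H S" "\<And>x. x \<in> K \<Longrightarrow> norm (\<phi> (f x) - \<psi> (f x)) < e"
        by (auto simp: uniform_nbhd_def)
      then have "\<phi> \<in> characters H S"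
        "(\<lambda>x\<in>carrier G. \<phi> (f x)) \<in> uniform_nbhd G T K e (\<lambda>x\<in>carrier G. \<psi> (f x))"
        using dual_map_in_characters[OF assms, of \<phi>] KG by (auto simp: uniform_nbhd_def)
      then show "\<phi> \<in> {\<psi> \<in> characters H S. (\<lambda>x\<in>carrier G. \<psi> (f x)) \<in> W}" using K(3) by blast
    qed
    ultimately show "\<exists>K e. compactin S K \<and> e > 0 \<and>
        uniform_nbhd H S K e \<psi> \<subseteq> {\<psi> \<in> characters H S. (\<lambda>x\<in>carrier G. \<psi> (f x)) \<in> W}"
      using K(2) by blast
  qed blast
qed

text \<open>The canonical map of \<open>G\<close> factors as \<open>f\<close> followed by the transpose of the inverse of \<open>k\<close>.\<close>

lemma reflexive_group_if_dual_pair: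
  assumes G: "group G" "topspace T = carrier G" and H: "group H" "topspace S = carrier H"
    and f: "topological_group_iso G T (dual_group H S) (dual_topology H S) f"
    and k: "topological_group_iso H S (dual_group G T) (dual_topology G T) k"
    and fk: "\<And>x y. x \<in> carrier G \<Longrightarrow> y \<in> carrier H \<Longrightarrow> f x y = k y x"
  shows "reflexive_group G T"
proof -
  interpret G: group G by fact
  interpret H: group H by fact
  let ?G' = "dual_group G T" and ?T' = "dual_topology G T"
  note fD = topological_group_isoD[OF f] and kD = topological_group_isoD[OF k]
  obtain l where l: "homeomorphic_maps S ?T' k l"
    using kD(4) homeomorphic_map_maps by blast
  have cl: "continuous_map ?T' S l" "continuous_map S ?T' k"
    and lk: "\<And>y. y \<in> carrier H \<Longrightarrow> l (k y) = y"
    and kl: "\<And>\<phi>. \<phi> \<in> carrier ?G' \<Longrightarrow> k (l \<phi>) = \<phi>"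
    using l H(2) by (auto simp: homeomorphic_maps_def)
  have lH: "l \<phi> \<in> carrier H" if "\<phi> \<in> carrier ?G'" for \<phi>
    using cl(1) that H(2) by (auto simp: continuous_map_def)
  have mult: "\<phi> \<otimes>\<^bsub>?G'\<^esub> \<psi> = k (l \<phi> \<otimes>\<^bsub>H\<^esub> l \<psi>)" if "\<phi> \<in> carrier ?G'" "\<psi> \<in> carrier ?G'" for \<phi> \<psi>
    using that kD(3) lH kl by presburger
  have clos: "\<phi> \<otimes>\<^bsub>?G'\<^esub> \<psi> \<in> carrier ?G'" if "\<phi> \<in> carrier ?G'" "\<psi> \<in> carrier ?G'" for \<phi> \<psi>
    using mult[OF that] kD(2) lH that by simp
  have lhom: "l (\<phi> \<otimes>\<^bsub>?G'\<^esub> \<psi>) = l \<phi> \<otimes>\<^bsub>H\<^esub> l \<psi>" if "\<phi> \<in> carrier ?G'" "\<psi> \<in> carrier ?G'" for \<phi> \<psi>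
    using mult[OF that] lk lH that by simp
  let ?l' = "\<lambda>\<psi>. \<lambda>\<phi>\<in>carrier ?G'. \<psi> (l \<phi>)" and ?k' = "\<lambda>\<Psi>. \<lambda>y\<in>carrier H. \<Psi> (k y)"
  let ?G'' = "dual_group ?G' ?T'" and ?T'' = "dual_topology ?G' ?T'"
  have l'k': "homeomorphic_maps (dual_topology H S) ?T'' ?l' ?k'"
    unfolding homeomorphic_maps_def
  proof (intro conjI ballI)
    show "continuous_map (dual_topology H S) ?T'' ?l'"
      using dual_map_continuous[OF cl(1) _ H(2) lhom clos] by simp
    show "continuous_map ?T'' (dual_topology H S) ?k'"
      using dual_map_continuous[OF cl(2) H(2) _ kD(3)] by simp
    show "?k' (?l' \<psi>) = \<psi>" if "\<psi> \<in> topspace (dual_topology H S)" for \<psi>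
      using that charactersD(1)[of \<psi> H S] lk kD(2)
      by (intro extensionalityI[where A = "carrier H"]) auto
    show "?l' (?k' \<Psi>) = \<Psi>" if "\<Psi> \<in> topspace ?T''" for \<Psi>
      using that charactersD(1)[of \<Psi> ?G' ?T'] kl lH
      by (intro extensionalityI[where A = "carrier ?G'"]) auto
  qed
  then have "homeomorphic_map (dual_topology H S) ?T'' ?l'"
    using homeomorphic_maps_map by blast
  then have "homeomorphic_map T ?T'' (?l' \<circ> f)"
    using homeomorphic_map_compose[OF fD(4)] by blast
  \<comment> \<open>\<open>f x (l \<phi>) = k (l \<phi>) x = \<phi> x\<close>, by \<open>fk\<close>
    and because l inverts k.\<close>
  moreover have eq: "(?l' \<circ> f) x = canonical_map G T x" if "x \<in> topspace T" for x
    using that G(2) fk lH kl by (auto simp: canonical_map_def fun_eq_iff restrict_def)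
  ultimately have hm: "homeomorphic_map T ?T'' (canonical_map G T)"
    using homeomorphic_map_eq by blast
  then have "bij_betw (canonical_map G T) (carrier G) (characters ?G' ?T')"
    using homeomorphic_imp_injective_map homeomorphic_imp_surjective_map G(2)
    by (metis bij_betw_def topspace_dual_topology)
  moreover have "canonical_map G T (x \<otimes>\<^bsub>G\<^esub> y) =
      canonical_map G T x \<otimes>\<^bsub>?G''\<^esub> canonical_map G T y" if "x \<in> carrier G" "y \<in> carrier G" for x y
    using charactersD(3) that by (auto simp: canonical_map_def mult_dual_group fun_eq_iff)
  ultimately show ?thesis
    using hm unfolding reflexive_group_def topological_group_iso_def iso_def hom_def
    by (auto simp: bij_betw_def)
qed

lemma character_power:
  assumes "\<phi> \<in> characters G T" "topspace T = carrier G"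
    and "\<And>x y. x \<in> carrier G \<Longrightarrow> y \<in> carrier G \<Longrightarrow> x \<otimes>\<^bsub>G\<^esub> y \<in> carrier G"
  shows "(\<lambda>x\<in>carrier G. \<phi> x ^ j) \<in> characters G T"
proof -
  have "continuous_map (top_of_set (sphere 0 1)) (top_of_set (sphere 0 1)) (\<lambda>w::complex. w ^ j)"
    by (auto simp: continuous_map_in_subtopology norm_power intro!: continuous_intros)
  then have "continuous_map T (top_of_set (sphere 0 1)) ((\<lambda>w. w ^ j) \<circ> \<phi>)"
    using charactersD(4)[OF assms(1)] continuous_map_compose by blast
  then have "continuous_map T (top_of_set (sphere 0 1)) (\<lambda>x\<in>carrier G. \<phi> x ^ j)"
    by (rule continuous_map_eq) (simp add: assms(2))
  moreover have "(\<lambda>x\<in>carrier G. \<phi> x ^ j) \<in> hom G circle_group"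
    using charactersD(2,3)[OF assms(1)] assms(3)
    by (intro hom_circle_groupI) (auto simp: norm_power power_mult_distrib)
  ultimately show ?thesis by (simp add: characters_def)
qed

text \<open>A basic neighbourhood of the second dual contains the bipolar of the powers, up to a
  fixed exponent, of the characters in a compact set.\<close>

lemma reflexive_imp_locally_quasi_convex:
  assumes "group G" "topspace T = carrier G" "reflexive_group G T"
  shows "locally_quasi_convex G T"
  unfolding locally_quasi_convex_def
proof (intro allI impI)
  interpret group G by fact
  let ?G' = "dual_group G T" and ?T' = "dual_topology G T" and ?c = "canonical_map G T"
  let ?T'' = "dual_topology ?G' ?T'"
  have hm: "homeomorphic_map T ?T'' ?c" and c_in: "\<And>x. x \<in> carrier G \<Longrightarrow> ?c x \<in> characters ?G' ?T'"
    using topological_group_isoD[of G T "dual_group ?G' ?T'" ?T'' ?c] assms(3)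
    unfolding reflexive_group_def by auto
  fix U assume U: "openin T U \<and> \<one>\<^bsub>G\<^esub> \<in> U"
  then have "openin ?T'' (?c ` U)" using hm homeomorphic_imp_open_map open_map_def by blast
  moreover have "?c \<one>\<^bsub>G\<^esub> \<in> ?c ` U" using U by blast
  ultimately obtain K e where K: "compactin ?T' K" "e > 0"
      "uniform_nbhd ?G' ?T' K e (?c \<one>\<^bsub>G\<^esub>) \<subseteq> ?c ` U"
    using openin_dual_topology_iff[of ?T' ?G' "?c ` U"] by auto
  have KC: "K \<subseteq> characters G T" using compactin_subset_topspace[OF K(1)] by simp
  \<comment> \<open>The 2 is the constant of \<open>norm_1_minus_le_if_Re_powers_nonneg\<close>. The
    first J powers then detect a distance e from 1, which puts V into U, while a distance below 1/J
    keeps all of them in the right half plane, which puts W into V.\<close>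
  obtain J :: nat where J: "real J * e > 2" using reals_Archimedean3[OF K(2)] by blast
  then have J0: "J > 0" by (cases "J = 0") auto
  define V where "V = {g \<in> carrier G. \<forall>\<phi>\<in>K. \<forall>j. 1 \<le> j \<and> j \<le> J \<longrightarrow> 0 \<le> Re (\<phi> g ^ j)}"
  define W where "W = {g \<in> topspace T. ?c g \<in> {\<Psi> \<in> characters ?G' ?T'. \<Psi> ` K \<subseteq> ball 1 (1 / J) \<inter> sphere 0 1}}"
  have "openin (top_of_set (sphere 0 1)) (ball 1 (1 / J) \<inter> sphere (0::complex) 1)"
    using openin_open_Int[of "ball 1 (1 / J)" "sphere (0::complex) 1"] by (simp add: Int_commute)
  then have "openin ?T'' {\<Psi> \<in> characters ?G' ?T'. \<Psi> ` K \<subseteq> ball 1 (1 / J) \<inter> sphere 0 1}"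
    unfolding dual_topology_def[of ?G'] using K(1) by (intro topology_generated_by_Basis) blast
  then have W: "openin T W"
    unfolding W_def using openin_continuous_map_preimage homeomorphic_imp_continuous_map[OF hm] by blast
  have cK: "?c g \<phi> = \<phi> g" if "\<phi> \<in> K" for g \<phi>
    using that KC by (auto simp: canonical_map_def)
  have nK: "norm (\<phi> g) = 1" if "\<phi> \<in> K" "g \<in> carrier G" for g \<phi>
    using that KC charactersD(2)[of \<phi> G T g] by auto
  have oneK: "\<phi> \<one>\<^bsub>G\<^esub> = 1" if "\<phi> \<in> K" for \<phi>
    using that KC character_one[of \<phi> G T] is_monoid by auto
  have "\<phi> \<one>\<^bsub>G\<^esub> \<in> ball 1 (1 / J) \<inter> sphere 0 1" if "\<phi> \<in> K" for \<phi>
    using J0 oneK[OF that] by simp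
  then have "\<one>\<^bsub>G\<^esub> \<in> W"
    using assms(2) c_in cK by (auto simp: W_def)
  moreover have "W \<subseteq> V"
  proof
    fix g assume "g \<in> W"
    then have g: "g \<in> carrier G" and *: "\<And>\<phi>. \<phi> \<in> K \<Longrightarrow> norm (1 - \<phi> g) < 1 / J"
      using assms(2) cK by (auto simp: W_def dist_norm)
    have "0 \<le> Re (\<phi> g ^ j)" if "\<phi> \<in> K" "1 \<le> j" "j \<le> J" for \<phi> j
    proof (rule Re_nonneg_if_norm_1_minus_le)
      have "norm (1 - \<phi> g ^ j) \<le> real j * norm (1 - \<phi> g)"
        using norm_1_minus_power_le nK g that by blast
      also have "\<dots> \<le> real J * (1 / J)"
        using that *[OF that(1)] by (intro mult_mono) auto
      finally show "norm (1 - \<phi> g ^ j) \<le> 1" using J0 by simp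
    qed
    then show "g \<in> V" using g by (auto simp: V_def)
  qed
  moreover have "V \<subseteq> U"
  proof
    fix g assume g: "g \<in> V"
    then have gG: "g \<in> carrier G" by (simp add: V_def)
    have "norm (?c g \<phi> - ?c \<one>\<^bsub>G\<^esub> \<phi>) < e" if "\<phi> \<in> K" for \<phi>
    proof -
      have "real J * norm (1 - \<phi> g) \<le> 2"
        using g that nK gG by (intro norm_1_minus_le_if_Re_powers_nonneg) (auto simp: V_def)
      also have "\<dots> < real J * e" by (rule J)
      finally have "norm (1 - \<phi> g) < e" using J0 by simp
      then show ?thesis using cK oneK that by (metis norm_minus_commute)
    qed
    then have "?c g \<in> uniform_nbhd ?G' ?T' K e (?c \<one>\<^bsub>G\<^esub>)"
      using c_in gG by (auto simp: uniform_nbhd_def)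
    then have "?c g \<in> ?c ` U" using K(3) by blast
    moreover have "inj_on ?c (carrier G)"
      using hm homeomorphic_imp_injective_map assms(2) by metis
    moreover have "U \<subseteq> carrier G" using U openin_subset assms(2) by metis
    ultimately show "g \<in> U" using gG by (metis inj_on_image_mem_iff)
  qed
  moreover have "quasi_convex G T V"
    unfolding quasi_convex_def
  proof (intro conjI ballI)
    show "V \<subseteq> carrier G" by (auto simp: V_def)
    fix g assume g: "g \<in> carrier G - V"
    then obtain \<phi> j where j: "\<phi> \<in> K" "1 \<le> j" "j \<le> J" "Re (\<phi> g ^ j) < 0"
      by (auto simp: V_def not_le)
    have "(\<lambda>x\<in>carrier G. \<phi> x ^ j) \<in> characters G T"
      using character_power[OF _ assms(2)] j(1) KC by blast
    then have "(\<lambda>x\<in>carrier G. \<phi> x ^ j) \<in> polar G T V"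
      using j by (auto simp: polar_def V_def)
    moreover have "Re ((\<lambda>x\<in>carrier G. \<phi> x ^ j) g) < 0" using g j by simp
    ultimately show "\<exists>\<phi>\<in>polar G T V. Re (\<phi> g) < 0" by blast
  qed
  ultimately show "\<exists>V W. openin T W \<and> \<one>\<^bsub>G\<^esub> \<in> W \<and> W \<subseteq> V \<and> V \<subseteq> U \<and> quasi_convex G T V"
    using W by blast
qed

section \<open>Sums of boundedly many terms of the sequence\<close>

lemma cis_sum: "cis (\<Sum>k\<in>F. f k) = (\<Prod>k\<in>F. cis (f k))"
  by (induction F rule: infinite_finite_induct) (auto simp: cis_mult[symmetric])

lemma cis_eq_1_if_int_multiple: "x = 2 * pi * of_int i \<Longrightarrow> cis x = 1"
  by (simp add: cis_multiple_2pi)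

lemma cis_eq_imp: "cis x = cis y \<Longrightarrow> \<exists>n::int. x = y + 2 * pi * n"
  using sin_cos_eq_iff by (metis cis.sel)

text \<open>The coefficient 0 makes the sets increase with N. Indices may repeat, so a multiple of
  one term by i costs |i| summands.\<close>

primrec bounded_sums :: "(nat \<Rightarrow> int) \<Rightarrow> nat \<Rightarrow> int set" where
  "bounded_sums \<gamma> 0 = {0}"
| "bounded_sums \<gamma> (Suc N) = {m + s * \<gamma> (Suc j) | m s j. m \<in> bounded_sums \<gamma> N \<and> s \<in> {-1, 0, 1}}"

lemma bounded_sums_SucI:
  "m \<in> bounded_sums \<gamma> N \<Longrightarrow> s \<in> {-1, 0, 1} \<Longrightarrow> m + s * \<gamma> (Suc j) \<in> bounded_sums \<gamma> (Suc N)"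
  by auto

lemma bounded_sums_mono: "N \<le> N' \<Longrightarrow> bounded_sums \<gamma> N \<subseteq> bounded_sums \<gamma> N'"
proof (induction rule: dec_induct)
  case (step N')
  then show ?case using bounded_sums_SucI[of _ \<gamma> N' 0 0] by auto
qed auto

lemma bounded_sums_add_mult:
  assumes "m \<in> bounded_sums \<gamma> N"
  shows "m + i * \<gamma> (Suc j) \<in> bounded_sums \<gamma> (N + nat \<bar>i\<bar>)"
proof -
  have "m + s * int k * \<gamma> (Suc j) \<in> bounded_sums \<gamma> (N + k)" if "s \<in> {-1, 1}" for s k
  proof (induction k)
    case (Suc k)
    then have "m + s * int k * \<gamma> (Suc j) + s * \<gamma> (Suc j) \<in> bounded_sums \<gamma> (Suc (N + k))"
      using that by (intro bounded_sums_SucI) auto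
    then show ?case by (simp add: algebra_simps)
  qed (use assms in auto)
  from this[of 1 "nat i"] this[of "-1" "nat (- i)"] show ?thesis
    by (cases "i \<ge> 0") auto
qed

lemma sum_mem_bounded_sums:
  "finite F \<Longrightarrow> (\<Sum>j\<in>F. i j * \<gamma> (Suc j)) \<in> bounded_sums \<gamma> (\<Sum>j\<in>F. nat \<bar>i j\<bar>)"
proof (induction rule: finite_induct)
  case (insert x F)
  then show ?case using bounded_sums_add_mult[OF insert.IH, of "i x" x] by (simp add: add.commute)
qed auto

text \<open>By the triangle inequality on the circle, the powers with exponent in
  \<open>bounded_sums\<close> are uniformly controlled by the sup norm. This is what puts a ball of
  the sup norm into a bipolar.\<close>

lemma norm_1_minus_bounded_sum_le:
  fixes w :: complex
  assumes "norm w = 1" "\<And>j. norm (1 - w powi \<gamma> (Suc j)) \<le> \<eta>" "m \<in> bounded_sums \<gamma> N"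
  shows "norm (1 - w powi m) \<le> real N * \<eta>"
  using assms(3)
proof (induction N arbitrary: m)
  case (Suc N)
  then obtain k s j where m: "m = k + s * \<gamma> (Suc j)" "k \<in> bounded_sums \<gamma> N" "s \<in> {-1, 0, 1}"
    by auto
  have w0: "w \<noteq> 0" using assms(1) by auto
  have "0 \<le> \<eta>" using assms(2)[of 0] norm_ge_zero order_trans by blast
  then have "norm (1 - w powi (s * \<gamma> (Suc j))) \<le> \<eta>"
    using m(3) assms(2)[of j] norm_1_minus_inverse[OF norm_power_int_1[OF assms(1)]]
    by (auto simp: power_int_minus)
  then show ?case
    using norm_1_minus_mult_le[OF norm_power_int_1[OF assms(1)], of k "w powi (s * \<gamma> (Suc j))"]
      Suc.IH[OF m(2)] w0
    by (simp add: m(1) power_int_add algebra_simps)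
qed auto

section \<open>Divisibility chains and their roots of unity\<close>

locale divisibility_chain =
  fixes \<gamma> b :: "nat \<Rightarrow> int"
  assumes b_ge_2: "\<And>n. 2 \<le> b n"
    and gamma_1: "\<gamma> (Suc 0) = 1"
    and gamma_Suc: "\<And>n. \<gamma> (Suc (Suc n)) = \<gamma> (Suc n) * b n"
    and b_summable: "summable (\<lambda>n. 1 / real_of_int (b n))"
begin

abbreviation g :: "nat \<Rightarrow> int" where "g n \<equiv> \<gamma> (Suc n)"

lemma g_pos: "0 < g n"
proof (induction n)
  case (Suc n)
  then show ?case using b_ge_2[of n] by (simp add: gamma_Suc)
qed (simp add: gamma_1)

lemma g_neq_0 [simp]: "g n \<noteq> 0"
  using g_pos[of n] by simp

lemma g_dvd: "n \<le> k \<Longrightarrow> g n dvd g k"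
  by (induction rule: dec_induct) (auto simp: gamma_Suc)

lemma g_growth: "n \<le> k \<Longrightarrow> g n * 2 ^ (k - n) \<le> g k"
proof (induction rule: dec_induct)
  case (step k)
  have "g n * 2 ^ (Suc k - n) = (g n * 2 ^ (k - n)) * 2" using step by (simp add: Suc_diff_le)
  also have "\<dots> \<le> g k * b k"
    using step b_ge_2[of k] g_pos[of n] g_pos[of k] by (intro mult_mono) auto
  finally show ?case by (simp add: gamma_Suc)
qed auto

lemma g_ge_2_power: "2 ^ n \<le> g n"
  using g_growth[of 0 n] by (simp add: gamma_1)

lemma g_quotient_le: "n \<le> k \<Longrightarrow> real_of_int (g n) / g k \<le> (1 / 2) ^ (k - n)"
proof -
  assume "n \<le> k"
  then have "real_of_int (g n * 2 ^ (k - n)) \<le> real_of_int (g k)"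
    using g_growth of_int_le_iff by blast
  then show ?thesis using g_pos[of k] by (simp add: field_simps power_divide)
qed

text \<open>The terms of a convergent series tend to 0, so the ratios b tend to infinity. Using
  \<open>max C 1\<close> keeps the reciprocal meaningful for C \<le> 0.\<close>

lemma b_ge_eventually: "\<exists>k0. \<forall>k\<ge>k0. C \<le> real_of_int (b k)"
proof -
  have "(\<lambda>n. 1 / real_of_int (b n)) \<longlonglongrightarrow> 0" by (rule summable_LIMSEQ_zero[OF b_summable])
  then have "eventually (\<lambda>n. 1 / real_of_int (b n) < 1 / max C 1) sequentially"
    by (rule order_tendstoD) (simp add: max_def)
  then obtain k0 where k0: "\<And>k. k \<ge> k0 \<Longrightarrow> 1 / real_of_int (b k) < 1 / max C 1"
    by (auto simp: eventually_sequentially)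
  have "C \<le> real_of_int (b k)" if "k \<ge> k0" for k
    using k0[OF that] b_ge_2[of k] by (simp add: field_simps max_def split: if_splits)
  then show ?thesis by blast
qed

definition e :: "nat \<Rightarrow> complex" where "e k = cis (2 * pi / g k)"

text \<open>An increasing union of cyclic groups of order g k. It is countable, and
  \<open>z powi g n\<close> is eventually 1 on it, so it lies in every G_p and in G_0.\<close>

definition Q :: "complex set" where "Q = range (\<lambda>(k, i::int). e k powi i)"

lemma countable_Q: "countable Q"
  by (simp add: Q_def)

lemma e_powi: "e k powi i = cis (2 * pi * i / g k)"
  by (simp add: e_def cis_power_int mult_ac)

lemma e_Suc: "e (Suc k) powi b k = e k"
proof -
  have "b k \<noteq> 0" using b_ge_2[of k] by auto
  then show ?thesis by (simp add: e_powi) (simp add: e_def gamma_Suc)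
qed

lemma e_0: "e 0 = 1"
  by (simp add: e_def gamma_1)

lemma e_powi_in_Q [simp]: "e k powi i \<in> Q"
  by (auto simp: Q_def)

lemma e_powi_eq: "k \<le> l \<Longrightarrow> e k powi i = e l powi (i * (g l div g k))"
proof -
  assume "k \<le> l"
  then have "g l = g k * (g l div g k)" using g_dvd by simp
  then have "real_of_int (g l) = real_of_int (g k) * real_of_int (g l div g k)"
    by (metis of_int_mult)
  moreover have "g l div g k \<noteq> 0" using \<open>g l = g k * (g l div g k)\<close> g_neq_0 by (metis mult_zero_right)
  ultimately show ?thesis by (simp add: e_powi mult.assoc)
qed

lemma Q_cases:
  assumes "z \<in> Q" "w \<in> Q"
  obtains k i j where "z = e k powi i" "w = e k powi j"
proof -
  obtain k i l j where "z = e k powi i" "w = e l powi j" using assms by (auto simp: Q_def)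
  then show ?thesis
    using e_powi_eq[of k "max k l" i] e_powi_eq[of l "max k l" j] that by auto
qed

lemma norm_Q: "z \<in> Q \<Longrightarrow> norm z = 1"
  by (auto simp: Q_def e_def cis_power_int)

lemma Q_mult: "z \<in> Q \<Longrightarrow> w \<in> Q \<Longrightarrow> z * w \<in> Q"
proof -
  assume "z \<in> Q" "w \<in> Q"
  then obtain k i j where "z = e k powi i" "w = e k powi j" by (rule Q_cases)
  then have "z * w = e k powi (i + j)" by (simp add: power_int_add e_def)
  then show ?thesis by simp
qed

lemma Q_powi: "z \<in> Q \<Longrightarrow> z powi i \<in> Q"
  by (auto simp: Q_def power_int_mult[symmetric] intro!: image_eqI[of _ _ "(_, _ * i)"])

lemma Q_one: "1 \<in> Q"
  using e_powi_in_Q[of 0 0] by simp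

lemma Q_powi_g_eventually: 
  assumes "z \<in> Q" shows "\<exists>K. \<forall>n\<ge>K. z powi g n = 1"
proof -
  obtain k i where z: "z = e k powi i" using assms by (auto simp: Q_def)
  have "z powi g n = 1" if le: "n \<ge> k" for n
  proof -
    obtain q where q: "g n = g k * q" using g_dvd[OF le] by auto
    have "z powi g n = e k powi (i * g n)" by (simp add: z power_int_mult)
    also have "\<dots> = cis (2 * pi * of_int (i * q))" by (simp add: e_powi q mult.assoc)
    also have "\<dots> = 1" by (rule cis_eq_1_if_int_multiple[of _ "i * q"]) simp
    finally show ?thesis .
  qed
  then show ?thesis by blast
qed

text \<open>Agreement at \<open>e n\<close> means that g n divides m - k. For n = |m - k| this
  forces m = k, since g n \<ge> 2^n > n.\<close>

lemma powi_inj_on_Q: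
  assumes "\<And>z. z \<in> Q \<Longrightarrow> z powi m = z powi k"
  shows "m = k"
proof (rule ccontr)
  assume "m \<noteq> k"
  define n where "n = nat \<bar>m - k\<bar>"
  have "e n powi m = e n powi k" using assms e_powi_in_Q[of n 1] by simp
  then obtain i :: int where "2 * pi * m / g n = 2 * pi * k / g n + 2 * pi * i"
    using cis_eq_imp by (metis e_powi)
  then have "2 * pi * real_of_int m = 2 * pi * real_of_int (k + i * g n)"
    using g_pos[of n] by (simp add: field_simps)
  then have "real_of_int m = real_of_int (k + i * g n)" by (simp only: mult_cancel_left) simp
  then have mk: "m - k = i * g n" by linarith
  then have "i \<noteq> 0" using \<open>m \<noteq> k\<close> by auto
  then have "g n \<le> \<bar>m - k\<bar>" using mk g_pos[of n] by (simp add: abs_mult mult_le_cancel_right1)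
  moreover have "int n < 2 ^ n" by (metis of_nat_less_two_power)
  ultimately show False using g_ge_2_power[of n] by (simp add: n_def)
qed

section \<open>Finite digit expansions as test elements\<close>

definition psum :: "real \<Rightarrow> complex \<Rightarrow> real" where
  "psum p z = (\<Sum>n. norm (1 - z powi g n) powr p)"

lemma summable_Q: "z \<in> Q \<Longrightarrow> summable (\<lambda>n. norm (1 - z powi g n) powr p)"
proof -
  assume "z \<in> Q"
  then obtain K where "\<And>n. n \<ge> K \<Longrightarrow> z powi g n = 1" using Q_powi_g_eventually by blast
  then show ?thesis by (intro summable_finite[of "{..<K}"]) (auto simp: not_less)
qed

text \<open>The point whose argument is 2 \<pi> times the finite mixed-radix fraction given by the
  sum of \<epsilon> k / g (Suc k). Taking the g n-th power removes the digits below n.\<close>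

definition test_element :: "nat set \<Rightarrow> (nat \<Rightarrow> int) \<Rightarrow> complex" where
  "test_element F \<epsilon> = (\<Prod>k\<in>F. e (Suc k) powi \<epsilon> k)"

lemma test_element_in_Q: "test_element F \<epsilon> \<in> Q"
  unfolding test_element_def
  by (induction F rule: infinite_finite_induct) (auto simp: Q_one Q_mult)

definition tail_angle :: "nat set \<Rightarrow> (nat \<Rightarrow> int) \<Rightarrow> nat \<Rightarrow> real" where
  "tail_angle F \<epsilon> n = (\<Sum>k\<in>{k\<in>F. n \<le> k}. 2 * pi * \<epsilon> k * g n / g (Suc k))"

text \<open>For k < n the number g (Suc k) divides g n, so these factors become 1 and only the
  digits from n on contribute to the angle.\<close>

lemma test_element_powi_g:
  assumes "finite F"
  shows "test_element F \<epsilon> powi g n = cis (tail_angle F \<epsilon> n)"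
proof -
  have "test_element F \<epsilon> powi g n = (\<Prod>k\<in>F. (e (Suc k) powi \<epsilon> k) powi g n)"
    using assms unfolding test_element_def
    by (induction F rule: finite_induct) (auto simp: power_int_mult_distrib)
  also have "\<dots> = (\<Prod>k\<in>F. cis (2 * pi * \<epsilon> k * g n / g (Suc k)))"
    by (simp add: e_powi cis_power_int mult_ac)
  also have "\<dots> = (\<Prod>k\<in>{k\<in>F. n \<le> k}. cis (2 * pi * \<epsilon> k * g n / g (Suc k)))"
  proof (rule prod.mono_neutral_right[OF assms])
    show "\<forall>k\<in>F - {k \<in> F. n \<le> k}. cis (2 * pi * \<epsilon> k * g n / g (Suc k)) = 1"
    proof
      fix k assume "k \<in> F - {k \<in> F. n \<le> k}"
      then have "g (Suc k) dvd g n" using g_dvd[of "Suc k" n] by auto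
      then obtain q where q: "g n = g (Suc k) * q" by (rule dvdE)
      show "cis (2 * pi * \<epsilon> k * g n / g (Suc k)) = 1"
        by (rule cis_eq_1_if_int_multiple[of _ "\<epsilon> k * q"]) (simp only: q of_int_mult, simp)
    qed
  qed auto
  also have "\<dots> = cis (tail_angle F \<epsilon> n)" by (simp add: tail_angle_def cis_sum)
  finally show ?thesis .
qed

text \<open>Geometric majorant of the tail angle, coming from \<open>g_quotient_le\<close>. It is at
  most 2 for each n, which bounds the sup norm, and its sum over n is at most 2 card F, which bounds
  the p-norm.\<close>

definition tail_weight :: "nat set \<Rightarrow> nat \<Rightarrow> real" where
  "tail_weight F n = (\<Sum>k\<in>{k\<in>F. n \<le> k}. (1 / 2) ^ (k - n))"

lemma tail_weight_nonneg: "0 \<le> tail_weight F n"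
  unfolding tail_weight_def by (intro sum_nonneg) auto

lemma sum_half_power_le: 
  assumes "finite A" shows "(\<Sum>k\<in>A. (1 / 2 :: real) ^ k) \<le> 2"
  using sum_le_suminf[of "\<lambda>k. (1 / 2 :: real) ^ k" A] assms suminf_geometric[of "1 / 2 :: real"]
  by (simp add: summable_geometric)

lemma tail_weight_le:
  assumes "finite F" shows "tail_weight F n \<le> 2"
proof -
  have "tail_weight F n = (\<Sum>k\<in>(\<lambda>k. k - n) ` {k\<in>F. n \<le> k}. (1 / 2) ^ k)"
    unfolding tail_weight_def by (subst sum.reindex) (auto simp: inj_on_def)
  also have "\<dots> \<le> 2" using assms by (intro sum_half_power_le) auto
  finally show ?thesis .
qed

lemma sum_tail_weight_le:
  assumes "finite F" shows "(\<Sum>n\<in>A. tail_weight F n) \<le> 2 * card F"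
proof (cases "finite A")
  case True
  have "(\<Sum>n\<in>A. tail_weight F n) = (\<Sum>n\<in>A. \<Sum>k\<in>F. if n \<le> k then (1 / 2) ^ (k - n) else 0)"
    unfolding tail_weight_def using assms by (simp add: sum.inter_filter)
  also have "\<dots> = (\<Sum>k\<in>F. \<Sum>n\<in>A. if n \<le> k then (1 / 2) ^ (k - n) else 0)"
    by (rule sum.swap)
  also have "\<dots> \<le> (\<Sum>k\<in>F. 2)"
  proof (rule sum_mono)
    fix k
    have "(\<Sum>n\<in>A. if n \<le> k then (1 / 2 :: real) ^ (k - n) else 0) = (\<Sum>n\<in>{n\<in>A. n \<le> k}. (1 / 2) ^ (k - n))"
      using True by (simp add: sum.inter_filter)
    also have "\<dots> = (\<Sum>n\<in>(\<lambda>n. k - n) ` {n\<in>A. n \<le> k}. (1 / 2) ^ n)"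
      by (subst sum.reindex) (auto simp: inj_on_def)
    also have "\<dots> \<le> 2" using True by (intro sum_half_power_le) auto
    finally show "(\<Sum>n\<in>A. if n \<le> k then (1 / 2 :: real) ^ (k - n) else 0) \<le> 2" .
  qed
  finally show ?thesis by simp
qed auto

lemma tail_angle_le:
  fixes c :: real
  assumes "finite F" "\<And>k. k \<in> F \<Longrightarrow> \<bar>real_of_int (\<epsilon> k)\<bar> \<le> c * b k" "0 \<le> c"
  shows "\<bar>tail_angle F \<epsilon> n\<bar> \<le> 2 * pi * c * tail_weight F n"
proof -
  have "\<bar>tail_angle F \<epsilon> n\<bar> \<le> (\<Sum>k\<in>{k\<in>F. n \<le> k}. \<bar>2 * pi * \<epsilon> k * g n / g (Suc k)\<bar>)"
    unfolding tail_angle_def by (rule sum_abs)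
  also have "\<dots> \<le> (\<Sum>k\<in>{k\<in>F. n \<le> k}. 2 * pi * c * (1 / 2) ^ (k - n))"
  proof (rule sum_mono)
    fix k assume k: "k \<in> {k \<in> F. n \<le> k}"
    have b0: "0 < b k" using b_ge_2[of k] by auto
    have "\<bar>2 * pi * \<epsilon> k * g n / g (Suc k)\<bar> = 2 * pi * (\<bar>real_of_int (\<epsilon> k)\<bar> / b k) * (g n / g k)"
      using b0 g_pos[of n] g_pos[of k] by (simp add: gamma_Suc abs_mult)
    also have "\<dots> \<le> 2 * pi * c * (1 / 2) ^ (k - n)"
      using k assms(2)[of k] b0 g_quotient_le[of n k] g_pos[of n] g_pos[of k] assms(3)
      by (intro mult_mono) (auto simp: pos_divide_le_eq)
    finally show "\<bar>2 * pi * \<epsilon> k * g n / g (Suc k)\<bar> \<le> 2 * pi * c * (1 / 2) ^ (k - n)" .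
  qed
  also have "\<dots> = 2 * pi * c * tail_weight F n" by (simp add: tail_weight_def sum_distrib_left)
  finally show ?thesis .
qed

lemma norm_test_element_le:
  fixes c :: real
  assumes "finite F" "\<And>k. k \<in> F \<Longrightarrow> \<bar>real_of_int (\<epsilon> k)\<bar> \<le> c * b k" "0 \<le> c"
  shows "norm (1 - test_element F \<epsilon> powi g n) \<le> 4 * pi * c"
proof -
  have "norm (1 - test_element F \<epsilon> powi g n) \<le> 2 * pi * c * tail_weight F n"
    using norm_1_minus_cis_le tail_angle_le[OF assms] test_element_powi_g[OF assms(1)]
    by (metis order_trans)
  also have "\<dots> \<le> 2 * pi * c * 2"
    using tail_weight_le[OF assms(1)] assms(3) by (intro mult_left_mono) auto
  finally show ?thesis by simp
qed

text \<open>Half a tail weight lies in [0, 1], where x^p \<le> x for p \<ge> 1. Hence the p-th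
  powers are dominated by the weights themselves, and the total is linear in card F.\<close>

lemma psum_test_element_le:
  fixes c :: real
  assumes "finite F" "\<And>k. k \<in> F \<Longrightarrow> \<bar>real_of_int (\<epsilon> k)\<bar> \<le> c * b k" "0 \<le> c" "1 \<le> p"
  shows "psum p (test_element F \<epsilon>) \<le> 2 * (4 * pi * c) powr p * card F"
  unfolding psum_def
proof (rule suminf_le_const[OF summable_Q[OF test_element_in_Q]])
  fix N
  have "(\<Sum>n<N. norm (1 - test_element F \<epsilon> powi g n) powr p) \<le> (\<Sum>n<N. (4 * pi * c) powr p * tail_weight F n)"
  proof (rule sum_mono)
    fix n
    let ?t = "tail_weight F n"
    have "norm (1 - test_element F \<epsilon> powi g n) \<le> 2 * pi * c * ?t"
      using norm_1_minus_cis_le tail_angle_le[OF assms(1-3)] test_element_powi_g[OF assms(1)]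
      by (metis order_trans)
    also have "\<dots> = (4 * pi * c) * (?t / 2)" by simp
    finally have "norm (1 - test_element F \<epsilon> powi g n) powr p \<le> ((4 * pi * c) * (?t / 2)) powr p"
      using assms by (intro powr_mono2) auto
    also have "\<dots> = (4 * pi * c) powr p * (?t / 2) powr p"
      by (rule powr_mult)
    also have "(?t / 2) powr p \<le> (?t / 2) powr 1"
      using tail_weight_nonneg[of F n] tail_weight_le[OF assms(1), of n] assms(4)
      by (intro powr_mono') auto
    also have "(?t / 2) powr 1 \<le> ?t" using tail_weight_nonneg[of F n] by simp
    finally show "norm (1 - test_element F \<epsilon> powi g n) powr p \<le> (4 * pi * c) powr p * ?t"
      by (simp add: mult_left_mono)
  qed
  also have "\<dots> \<le> (4 * pi * c) powr p * (2 * card F)"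
    unfolding sum_distrib_left[symmetric]
    by (intro mult_left_mono sum_tail_weight_le assms(1)) auto
  finally show "(\<Sum>n<N. norm (1 - test_element F \<epsilon> powi g n) powr p) \<le> 2 * (4 * pi * c) powr p * card F"
    by simp
qed

text \<open>The expression is a constant times L^(1 - p), which is where p > 1 enters. The number 8
  \<pi> / L is 4 \<pi> c for the relative digit size c = 2 / L used below.\<close>

lemma exists_small_test_size:
  assumes "1 < p" "0 < \<delta>"
  shows "\<exists>L::nat. (1::nat) \<le> L \<and> 2 * (8 * pi / L) powr p * L < \<delta>"
proof -
  have "((\<lambda>L. 2 * (8 * pi / real L) powr p * real L) \<longlongrightarrow> 0) sequentially"
    using assms(1) by real_asymp
  then have "eventually (\<lambda>L. 2 * (8 * pi / real L) powr p * real L < \<delta>) sequentially"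
    using assms(2) by (rule order_tendstoD(2))
  then have "eventually (\<lambda>L. 1 \<le> L \<and> 2 * (8 * pi / real L) powr p * real L < \<delta>) sequentially"
    using eventually_ge_at_top[of 1] by eventually_elim auto
  then show ?thesis using eventually_happens by fastforce
qed

end

section \<open>Characters of the group of roots of unity and their digits\<close>

locale Q_character = divisibility_chain +
  fixes h :: "complex \<Rightarrow> complex"
  assumes norm_chi: "\<And>z. z \<in> Q \<Longrightarrow> norm (h z) = 1"
    and chi_mult: "\<And>z w. z \<in> Q \<Longrightarrow> w \<in> Q \<Longrightarrow> h (z * w) = h z * h w"
begin

lemma chi_1: "h 1 = 1"
proof -
  have "h 1 * h 1 = h 1" "h 1 \<noteq> 0"
    using chi_mult[OF Q_one Q_one] norm_chi[OF Q_one] by auto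
  then show ?thesis by simp
qed

lemma chi_power: "z \<in> Q \<Longrightarrow> h (z ^ n) = h z ^ n"
proof (induction n)
  case (Suc n)
  then show ?case using chi_mult[of z "z ^ n"] Q_powi[of z "int n"] by simp
qed (simp add: chi_1)

lemma chi_powi: "z \<in> Q \<Longrightarrow> h (z powi i) = h z powi i"
proof -
  assume z: "z \<in> Q"
  show ?thesis
  proof (cases "i \<ge> 0")
    case True
    then show ?thesis using chi_power[OF z] by (simp add: power_int_def)
  next
    case False
    have "z \<noteq> 0" using norm_Q[OF z] by auto
    then have "h (z powi i) * h (z ^ nat (- i)) = 1"
      using chi_mult[OF Q_powi[OF z, of i] Q_powi[OF z, of "- i"]] chi_1 False
      by (simp add: power_int_def power_inverse)
    then have "h (z powi i) = inverse (h z ^ nat (- i))"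
      using chi_power[OF z] by (metis inverse_unique mult.commute inverse_inverse_eq)
    then show ?thesis using False by (simp add: power_int_def power_inverse)
  qed
qed

definition \<theta> :: "nat \<Rightarrow> real" where "\<theta> k = Arg (h (e k))"

lemma e_in_Q: "e k \<in> Q"
  using e_powi_in_Q[of k 1] by simp

lemma chi_e: "h (e k) = cis (\<theta> k)"
  unfolding \<theta>_def by (rule circle_eq_cis_Arg[OF norm_chi[OF e_in_Q]])

lemma abs_theta_le: "\<bar>\<theta> k\<bar> \<le> pi"
  unfolding \<theta>_def using Arg_bounded[of "h (e k)"] by auto

lemma theta_0: "\<theta> 0 = 0"
  by (simp add: \<theta>_def e_0 chi_1)

text \<open>As \<open>e (Suc k) powi b k = e k\<close>, both b k * \<theta> (Suc k) and \<theta> k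
  are arguments of h (e k), so they differ by an integer multiple of 2 \<pi>. Formally, h is the
  power whose exponent is the infinite series of digit k * g k.\<close>

definition digit :: "nat \<Rightarrow> int" where
  "digit k = (SOME n. b k * \<theta> (Suc k) = \<theta> k + 2 * pi * n)"

lemma digit: "b k * \<theta> (Suc k) = \<theta> k + 2 * pi * digit k"
proof -
  have "cis (b k * \<theta> (Suc k)) = h (e (Suc k) powi b k)"
    by (simp add: chi_powi e_in_Q chi_e cis_power_int)
  also have "\<dots> = cis (\<theta> k)" by (simp add: e_Suc chi_e)
  finally show ?thesis unfolding digit_def by (rule someI_ex[OF cis_eq_imp])
qed

lemma theta_eq: "\<theta> j = (\<Sum>k<j. 2 * pi * digit k * g k / g j)"
proof (induction j)
  case (Suc j)
  have b0: "real_of_int (b j) \<noteq> 0" "real_of_int (g j) \<noteq> 0" using b_ge_2[of j] by auto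
  have "\<theta> (Suc j) = (\<theta> j + 2 * pi * digit j) / b j" using digit[of j] b0 by (simp add: field_simps)
  also have "\<dots> = (\<Sum>k<j. 2 * pi * digit k * g k / g j) / b j + 2 * pi * digit j * g j / g (Suc j)"
    using Suc b0 by (simp add: add_divide_distrib gamma_Suc)
  also have "(\<Sum>k<j. 2 * pi * digit k * g k / g j) / b j = (\<Sum>k<j. 2 * pi * digit k * g k / g (Suc j))"
    by (simp add: sum_divide_distrib gamma_Suc)
  finally show ?case by simp
qed (simp add: theta_0)

text \<open>On e j only the digits below j are visible, because g j divides g k for k \<ge> j. Once
  finitely many digits are nonzero, the formal series for the exponent is an integer that works for
  all j at once.\<close>

lemma chi_eq_powi_if_finite:
  assumes "finite F" "\<And>k. k \<notin> F \<Longrightarrow> digit k = 0" "z \<in> Q"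
  shows "h z = z powi (\<Sum>k\<in>F. digit k * g k)"
proof -
  let ?m = "\<Sum>k\<in>F. digit k * g k"
  have e: "e j powi ?m = h (e j)" for j
  proof -
    let ?f = "\<lambda>k. 2 * pi * digit k * g k / g j"
    have "2 * pi * ?m / g j = (\<Sum>k\<in>F. ?f k)"
      by (simp add: sum_distrib_left sum_divide_distrib mult_ac)
    then have "e j powi ?m = (\<Prod>k\<in>F. cis (?f k))"
      by (simp only: e_powi cis_sum)
    also have "\<dots> = (\<Prod>k\<in>F \<union> {..<j}. cis (?f k))"
      using assms by (intro prod.mono_neutral_left) auto
    also have "\<dots> = (\<Prod>k<j. cis (?f k))"
    proof (rule prod.mono_neutral_right)
      show "\<forall>k\<in>F \<union> {..<j} - {..<j}. cis (?f k) = 1"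
      proof
        fix k assume "k \<in> F \<union> {..<j} - {..<j}"
        then have "g j dvd g k" using g_dvd[of j k] by auto
        then obtain q where q: "g k = g j * q" by (rule dvdE)
        show "cis (?f k) = 1"
          by (rule cis_eq_1_if_int_multiple[of _ "digit k * q"]) (simp only: q of_int_mult, simp)
      qed
    qed (use assms in auto)
    also have "\<dots> = h (e j)" unfolding chi_e theta_eq[of j] cis_sum ..
    finally show ?thesis .
  qed
  obtain j i where z: "z = e j powi i" using assms(3) by (auto simp: Q_def)
  have "h z = (e j powi ?m) powi i" by (simp add: z chi_powi e_in_Q e)
  also have "\<dots> = z powi ?m" by (simp add: z power_int_mult[symmetric] mult.commute)
  finally show ?thesis .
qed

lemma chi_test_element:
  assumes "finite F"
  shows "h (test_element F \<epsilon>) = cis (\<Sum>k\<in>F. \<epsilon> k * \<theta> (Suc k))"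
  using assms
proof (induction F rule: finite_induct)
  case (insert k F)
  then have "h (test_element (insert k F) \<epsilon>) = h (e (Suc k) powi \<epsilon> k) * h (test_element F \<epsilon>)"
    using chi_mult[OF e_powi_in_Q test_element_in_Q] by (simp add: test_element_def)
  also have "h (e (Suc k) powi \<epsilon> k) = cis (\<epsilon> k * \<theta> (Suc k))"
    by (simp add: chi_powi e_in_Q chi_e cis_power_int)
  finally show ?case using insert by (simp add: cis_mult)
qed (simp add: test_element_def chi_1)

context
  fixes p \<delta> :: real and L k0 :: nat
  assumes p: "1 < p" and L: "1 \<le> L" "2 * (8 * pi / L) powr p * L < \<delta>"
    and k0: "\<And>k. k0 \<le> k \<Longrightarrow> real L / 2 \<le> b k"
    and pos: "\<And>z. z \<in> Q \<Longrightarrow> psum p z < \<delta> \<Longrightarrow> 0 \<le> Re (h z)"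
begin

text \<open>With this relative digit size, at most L digits cost no more than 2 (4 \<pi> c)^p L <
  \<delta>, so \<open>pos\<close>, which stands in for continuity of h, applies. Beyond k0 one has c
  * b k \<ge> 1, so the digit 1 is admissible there.\<close>

abbreviation c :: real where "c \<equiv> 2 / L"

lemma c_pos: "0 < c"
  using L by simp

lemma Re_chi_test_element_nonneg:
  assumes "finite F" "card F \<le> L" "\<And>k. k \<in> F \<Longrightarrow> \<bar>real_of_int (\<epsilon> k)\<bar> \<le> c * b k"
  shows "0 \<le> Re (h (test_element F \<epsilon>))"
proof (rule pos[OF test_element_in_Q])
  have "psum p (test_element F \<epsilon>) \<le> 2 * (4 * pi * c) powr p * card F"
    using psum_test_element_le[OF assms(1,3)] c_pos p by auto
  also have "\<dots> \<le> 2 * (4 * pi * c) powr p * L"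
    using assms(2) by (intro mult_left_mono) auto
  also have "\<dots> < \<delta>" using L(2) by simp
  finally show "psum p (test_element F \<epsilon>) < \<delta>" .
qed

text \<open>The largest digit that a test element may carry at position k.\<close>

definition J :: "nat \<Rightarrow> nat" where "J k = nat \<lfloor>c * b k\<rfloor>"

lemma J_le: "J k \<le> c * b k" and J_gt: "c * b k < J k + 1"
proof -
  have "0 \<le> c * b k" using c_pos b_ge_2[of k] by (intro mult_nonneg_nonneg) auto
  then show "J k \<le> c * b k" "c * b k < J k + 1" unfolding J_def by linarith+
qed

text \<open>The test elements with the single digit j = 1, ..., J k are mapped to cis (j * \<theta>
  (Suc k)), and all these values lie in the right half plane.\<close>

lemma J_mult_theta_le: "J k * \<bar>\<theta> (Suc k)\<bar> \<le> pi / 2"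
proof (rule mult_abs_le_pi_half[OF abs_theta_le])
  fix j assume "1 \<le> j" "j \<le> J k"
  then have "0 \<le> Re (h (test_element {k} (\<lambda>_. int j)))"
    using J_le[of k] L(1) by (intro Re_chi_test_element_nonneg) auto
  then show "0 \<le> cos (real j * \<theta> (Suc k))" by (simp add: chi_test_element)
qed

text \<open>Rounding c * b k down to J k costs at most a factor 2 when J k \<ge> 1. When J k = 0, b
  k is at most 1 / c and the trivial bound \<pi> on the angle suffices.\<close>

lemma b_mult_theta_le: "b k * \<bar>\<theta> (Suc k)\<bar> \<le> pi / c"
proof (cases "J k = 0")
  case True
  then have "c * b k \<le> 1" using J_gt[of k] by simp
  then have "real_of_int (b k) \<le> 1 / c" using c_pos by (simp add: field_simps)
  then have "b k * \<bar>\<theta> (Suc k)\<bar> \<le> (1 / c) * pi"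
    using abs_theta_le c_pos by (intro mult_mono) auto
  then show ?thesis by (simp add: mult.commute)
next
  case False
  then have "c * b k \<le> 2 * J k" using J_gt[of k] by linarith
  then have "c * b k * \<bar>\<theta> (Suc k)\<bar> \<le> 2 * J k * \<bar>\<theta> (Suc k)\<bar>" by (intro mult_right_mono) auto
  also have "\<dots> \<le> pi" using J_mult_theta_le[of k] by simp
  finally show ?thesis by (subst pos_le_divide_eq[OF c_pos]) (simp only: mult_ac)
qed

text \<open>The digit equation gives 2 \<pi> |digit k| \<le> \<pi> / c + \<pi>, that is |digit k|
  \<le> L / 4 + 1 / 2, and this is at most L as L \<ge> 1.\<close>

lemma digit_le: "\<bar>real_of_int (digit k)\<bar> \<le> L"
proof -
  have "b k * \<bar>\<theta> (Suc k)\<bar> = \<bar>b k * \<theta> (Suc k)\<bar>" using b_ge_2[of k] by (simp add: abs_mult)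
  then have "2 * pi * \<bar>real_of_int (digit k)\<bar> \<le> pi / c + pi"
    using b_mult_theta_le[of k] abs_theta_le[of k] digit[of k] by (simp add: abs_if split: if_splits)
  then have "2 * pi * \<bar>real_of_int (digit k)\<bar> \<le> 2 * pi * (L / 4 + 1 / 2)"
    using L(1) by (simp add: algebra_simps)
  then have "\<bar>real_of_int (digit k)\<bar> \<le> L / 4 + 1 / 2" 
    using mult_le_cancel_left_pos[of "2 * pi"] by simp
  then show ?thesis using L(1) by simp
qed

text \<open>A nonzero digit puts b k * \<theta> (Suc k) at distance at least 2 \<pi> from \<theta>
  k, so its modulus is at least \<pi>. Multiplying by c and losing a factor 2 in the rounding leaves
  c \<pi> / 2 = \<pi> / L.\<close>

lemma J_mult_theta_ge:
  assumes "k0 \<le> k" "digit k \<noteq> 0"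
  shows "pi / L \<le> J k * \<bar>\<theta> (Suc k)\<bar>"
proof -
  have b0: "0 < b k" using b_ge_2[of k] by simp
  have "1 \<le> \<bar>real_of_int (digit k)\<bar>" using assms(2) by linarith
  then have "2 * pi * 1 \<le> 2 * pi * \<bar>real_of_int (digit k)\<bar>" by (intro mult_left_mono) auto
  then have "2 * pi \<le> \<bar>2 * pi * real_of_int (digit k)\<bar>" by (simp add: abs_mult)
  then have "pi \<le> \<bar>b k * \<theta> (Suc k)\<bar>" using digit[of k] abs_theta_le[of k] by linarith
  then have *: "pi \<le> b k * \<bar>\<theta> (Suc k)\<bar>" using b0 by (simp add: abs_mult)
  have "1 \<le> c * b k" using k0[OF assms(1)] L(1) by (simp add: field_simps)
  then have "c * b k \<le> 2 * J k" using J_gt[of k] J_le[of k] by (cases "J k") auto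
  then have "c * b k * \<bar>\<theta> (Suc k)\<bar> \<le> 2 * J k * \<bar>\<theta> (Suc k)\<bar>" by (intro mult_right_mono) auto
  moreover have "c * pi \<le> c * (b k * \<bar>\<theta> (Suc k)\<bar>)" using * c_pos by (intro mult_left_mono) auto
  ultimately show ?thesis by (simp add: mult.assoc)
qed

text \<open>The angle of \<open>h\<close> on test elements grows in steps of at most \<open>\<pi>/2\<close>, so it cannot leave
  the right half plane without violating positivity at some stage.\<close>

lemma sum_J_mult_theta_le:
  assumes "finite F" "card F \<le> L"
  shows "(\<Sum>k\<in>F. J k * \<bar>\<theta> (Suc k)\<bar>) \<le> pi / 2"
  using assms
proof (induction F rule: finite_induct)
  case (insert k F)
  let ?\<epsilon> = "\<lambda>k. (if \<theta> (Suc k) < 0 then -1 else 1) * int (J k)"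
  have "0 \<le> Re (h (test_element (insert k F) ?\<epsilon>))"
    using insert J_le by (intro Re_chi_test_element_nonneg) auto
  moreover have "real_of_int (?\<epsilon> k) * \<theta> (Suc k) = J k * \<bar>\<theta> (Suc k)\<bar>" for k by auto
  ultimately have "0 \<le> cos (\<Sum>k\<in>insert k F. J k * \<bar>\<theta> (Suc k)\<bar>)"
    using insert by (simp only: chi_test_element finite_insert cis.sel)
  moreover have "(\<Sum>k\<in>F. J k * \<bar>\<theta> (Suc k)\<bar>) \<le> pi / 2" using insert by simp
  then have "(\<Sum>k\<in>insert k F. J k * \<bar>\<theta> (Suc k)\<bar>) \<le> pi" using J_mult_theta_le[of k] insert by simp
  ultimately show ?case by (intro le_pi_half_if_cos_nonneg sum_nonneg) auto
qed simp

text \<open>L nonzero digits beyond k0 would produce a total angle of at least L * (\<pi> / L) =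
  \<pi>, whereas any L positions allow at most \<pi> / 2.\<close>

lemma nonzero_digits_card:
  "finite {k. k0 \<le> k \<and> digit k \<noteq> 0} \<and> card {k. k0 \<le> k \<and> digit k \<noteq> 0} \<le> L" (is "finite ?Z \<and> _")
proof (rule ccontr)
  assume "\<not> (finite ?Z \<and> card ?Z \<le> L)"
  then have "\<exists>F\<subseteq>?Z. finite F \<and> card F = L"
  proof (cases "finite ?Z")
    case True
    with \<open>\<not> (finite ?Z \<and> card ?Z \<le> L)\<close> have "L \<le> card ?Z" by simp
    then show ?thesis by (rule obtain_subset_with_card_n) blast
  next
    case False
    then obtain F where "finite F" "card F = L" "F \<subseteq> ?Z"
      using infinite_arbitrarily_large by blast
    then show ?thesis by blast
  qed
  then obtain F where F: "F \<subseteq> ?Z" "finite F" "card F = L" by blast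
  have "pi = (\<Sum>k\<in>F. pi / L)" using F L(1) by simp
  also have "\<dots> \<le> (\<Sum>k\<in>F. J k * \<bar>\<theta> (Suc k)\<bar>)"
    using F J_mult_theta_ge by (intro sum_mono) auto
  also have "\<dots> \<le> pi / 2" using F by (intro sum_J_mult_theta_le) auto
  finally show False by simp
qed

text \<open>Below k0 the digits are only bounded in size, so all k0 positions are counted; beyond,
  at most L are nonzero. Each digit costs at most L summands.\<close>

lemma chi_eq_bounded_sum:
  "\<exists>m\<in>bounded_sums \<gamma> ((k0 + L) * L). \<forall>z\<in>Q. h z = z powi m"
proof -
  let ?Z = "{k. k0 \<le> k \<and> digit k \<noteq> 0}"
  define F where "F = {..<k0} \<union> ?Z"
  have F: "finite F" "card F \<le> k0 + L"
    using nonzero_digits_card card_Un_le[of "{..<k0}" ?Z] by (auto simp: F_def)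
  have "(\<Sum>k\<in>F. nat \<bar>digit k\<bar>) \<le> (\<Sum>k\<in>F. L)"
  proof (rule sum_mono)
    fix k
    show "nat \<bar>digit k\<bar> \<le> L" using digit_le[of k] by linarith
  qed
  also have "\<dots> \<le> (k0 + L) * L" using F by simp
  finally have "(\<Sum>k\<in>F. digit k * g k) \<in> bounded_sums \<gamma> ((k0 + L) * L)"
    using sum_mem_bounded_sums[OF F(1), of digit \<gamma>] bounded_sums_mono by blast
  moreover have "h z = z powi (\<Sum>k\<in>F. digit k * g k)" if "z \<in> Q" for z
    using that by (intro chi_eq_powi_if_finite F(1)) (auto simp: F_def not_less)
  ultimately show ?thesis by blast
qed

end

end

context divisibility_chain
begin

text \<open>N is the same for all h, since L and k0 are chosen before h. This uniformity is what
  makes polars of balls compact.\<close>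

theorem character_bound:
  assumes "1 < p" "0 < \<delta>"
  shows "\<exists>N. \<forall>h. (\<forall>z\<in>Q. norm (h z) = 1) \<longrightarrow> (\<forall>z\<in>Q. \<forall>w\<in>Q. h (z * w) = h z * h w) \<longrightarrow>
     (\<forall>z\<in>Q. psum p z < \<delta> \<longrightarrow> 0 \<le> Re (h z)) \<longrightarrow>
     (\<exists>m\<in>bounded_sums \<gamma> N. \<forall>z\<in>Q. h z = z powi m)"
proof -
  obtain L :: nat where L: "1 \<le> L" "2 * (8 * pi / L) powr p * L < \<delta>"
    using exists_small_test_size[OF assms] by blast
  obtain k0 where k0: "\<And>k. k0 \<le> k \<Longrightarrow> real L / 2 \<le> b k"
    using b_ge_eventually[of "real L / 2"] by blast
  show ?thesis
  proof (intro exI allI impI)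
    fix h :: "complex \<Rightarrow> complex"
    assume *: "\<forall>z\<in>Q. norm (h z) = 1" "\<forall>z\<in>Q. \<forall>w\<in>Q. h (z * w) = h z * h w"
      "\<forall>z\<in>Q. psum p z < \<delta> \<longrightarrow> 0 \<le> Re (h z)"
    interpret Q_character \<gamma> b h using * by unfold_locales auto
    show "\<exists>m\<in>bounded_sums \<gamma> ((k0 + L) * L). \<forall>z\<in>Q. h z = z powi m"
      using chi_eq_bounded_sum[OF assms(1) L k0] * by blast
  qed
qed

lemma polar_bound:
  assumes "1 < p" "0 < \<delta>"
  shows "\<exists>N. \<forall>m. (\<forall>z\<in>Q. psum p z < \<delta> \<longrightarrow> 0 \<le> Re (z powi m)) \<longrightarrow> m \<in> bounded_sums \<gamma> N"
proof -
  obtain N where N: "\<And>h. (\<forall>z\<in>Q. norm (h z) = 1) \<Longrightarrow> (\<forall>z\<in>Q. \<forall>w\<in>Q. h (z * w) = h z * h w) \<Longrightarrow>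
     (\<forall>z\<in>Q. psum p z < \<delta> \<longrightarrow> 0 \<le> Re (h z)) \<Longrightarrow>
     (\<exists>m\<in>bounded_sums \<gamma> N. \<forall>z\<in>Q. h z = z powi m)"
    using character_bound[OF assms] by blast
  have "m \<in> bounded_sums \<gamma> N" if "\<forall>z\<in>Q. psum p z < \<delta> \<longrightarrow> 0 \<le> Re (z powi m)" for m
  proof -
    have "\<exists>k\<in>bounded_sums \<gamma> N. \<forall>z\<in>Q. z powi m = z powi k"
      using that by (intro N) (auto simp: power_int_mult_distrib norm_Q norm_power_int_1)
    then obtain k where "k \<in> bounded_sums \<gamma> N" "\<forall>z\<in>Q. z powi m = z powi k" by blast
    then show ?thesis using powi_inj_on_Q[of m k] by auto
  qed
  then show ?thesis by blast
qed

end

section \<open>Convergence in all group topologies making the sequence null\<close>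

text \<open>Convergence to one limit in all these group topologies at once, so that a subsequence
  can be extracted independently of the topology. The second clause, convergence at the points of
  G_0, lets conditions Re \<ge> 0 pass to the limit.\<close>

definition universal_limit :: "(nat \<Rightarrow> int) \<Rightarrow> (nat \<Rightarrow> int) \<Rightarrow> int \<Rightarrow> bool" where
  "universal_limit \<gamma> x l \<longleftrightarrow>
     (\<forall>S. abelian_topological_group integer_group S \<and> limitin S \<gamma> 0 sequentially \<longrightarrow>
        limitin S x l sequentially) \<and>
     (\<forall>z :: complex. norm z = 1 \<and> (\<lambda>n. z powi \<gamma> (Suc n)) \<longlonglongrightarrow> 1 \<longrightarrow> (\<lambda>i. z powi x i) \<longlonglongrightarrow> z powi l)"

lemma topspace_integer_topological_group:
  "abelian_topological_group integer_group S \<Longrightarrow> topspace S = UNIV"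
  by (simp add: abelian_topological_group_def)

lemma continuous_map_add_integer_topological_group:
  assumes "abelian_topological_group integer_group S" "continuous_map X S f" "continuous_map X S h"
  shows "continuous_map X S (\<lambda>x. f x + h x)"
proof -
  have "continuous_map (prod_topology S S) S (\<lambda>(x, y). x + y)"
    using assms(1) by (simp add: abelian_topological_group_def)
  from continuous_map_compose[OF continuous_map_pairedI[OF assms(2,3)] this]
  show ?thesis by (simp add: o_def)
qed

lemma limitin_add_integer_topological_group:
  assumes "abelian_topological_group integer_group S" "limitin S x l F" "limitin S y m F"
  shows "limitin S (\<lambda>i. x i + y i) (l + m) F"
proof -
  have "continuous_map (prod_topology S S) S (\<lambda>(x, y). x + y)"
    using assms(1) by (simp add: abelian_topological_group_def)
  moreover have "limitin (prod_topology S S) (\<lambda>i. (x i, y i)) (l, m) F"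
    using assms(2,3) by (simp add: limitin_pairwise o_def)
  ultimately show ?thesis using continuous_map_limit by (fastforce simp: o_def)
qed

lemma limitin_minus_integer_topological_group:
  assumes "abelian_topological_group integer_group S" "limitin S x l F"
  shows "limitin S (\<lambda>i. - x i) (- l) F"
proof -
  have "continuous_map S S (\<lambda>x. - x)"
    using assms(1) by (simp add: abelian_topological_group_def)
  from continuous_map_limit[OF this assms(2)] show ?thesis by (simp add: o_def)
qed

lemma universal_limit_const: "universal_limit \<gamma> (\<lambda>_. l) l"
  by (auto simp: universal_limit_def topspace_integer_topological_group intro: limitin_const_iff[THEN iffD2])

lemma universal_limit_add:
  assumes "universal_limit \<gamma> x l" "universal_limit \<gamma> y m"
  shows "universal_limit \<gamma> (\<lambda>i. x i + y i) (l + m)"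
  unfolding universal_limit_def
proof (intro conjI allI impI)
  fix z :: complex assume z: "norm z = 1 \<and> (\<lambda>n. z powi \<gamma> (Suc n)) \<longlonglongrightarrow> 1"
  then have "z \<noteq> 0" by auto
  then show "(\<lambda>i. z powi (x i + y i)) \<longlonglongrightarrow> z powi (l + m)"
    using assms z by (auto simp: universal_limit_def power_int_add intro!: tendsto_mult)
qed (rule limitin_add_integer_topological_group, use assms in \<open>auto simp: universal_limit_def\<close>)

lemma universal_limit_minus:
  assumes "universal_limit \<gamma> x l"
  shows "universal_limit \<gamma> (\<lambda>i. - x i) (- l)"
  unfolding universal_limit_def
proof (intro conjI allI impI)
  fix z :: complex assume z: "norm z = 1 \<and> (\<lambda>n. z powi \<gamma> (Suc n)) \<longlonglongrightarrow> 1"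
  then have "z \<noteq> 0" by auto
  then show "(\<lambda>i. z powi (- x i)) \<longlonglongrightarrow> z powi (- l)"
    using assms z by (auto simp: universal_limit_def power_int_minus intro!: tendsto_inverse)
qed (rule limitin_minus_integer_topological_group, use assms in \<open>auto simp: universal_limit_def\<close>)

lemma universal_limit_subseq:
  assumes "universal_limit \<gamma> x l" "strict_mono r"
  shows "universal_limit \<gamma> (x \<circ> r) l"
  unfolding universal_limit_def
proof (intro conjI allI impI)
  fix S assume "abelian_topological_group integer_group S \<and> limitin S \<gamma> 0 sequentially"
  then have "limitin S x l sequentially" using assms(1) by (simp add: universal_limit_def)
  then show "limitin S (x \<circ> r) l sequentially" by (rule limitin_subsequence[OF assms(2)])
next
  fix z :: complex assume "norm z = 1 \<and> (\<lambda>n. z powi \<gamma> (Suc n)) \<longlonglongrightarrow> 1"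
  then have "(\<lambda>i. z powi x i) \<longlonglongrightarrow> z powi l" using assms(1) by (simp add: universal_limit_def)
  from LIMSEQ_subseq_LIMSEQ[OF this assms(2)]
  show "(\<lambda>i. z powi (x \<circ> r) i) \<longlonglongrightarrow> z powi l" by (simp add: o_def)
qed

lemma universal_limit_gamma:
  assumes "filterlim j at_top sequentially"
  shows "universal_limit \<gamma> (\<lambda>i. \<gamma> (Suc (j i))) 0"
  unfolding universal_limit_def
proof (intro conjI allI impI)
  fix S assume S: "abelian_topological_group integer_group S \<and> limitin S \<gamma> 0 sequentially"
  show "limitin S (\<lambda>i. \<gamma> (Suc (j i))) 0 sequentially"
    unfolding limitin_def
  proof (intro conjI allI impI)
    fix U assume "openin S U \<and> 0 \<in> U"
    then obtain n0 where n0: "\<And>n. n \<ge> n0 \<Longrightarrow> \<gamma> n \<in> U"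
      using S by (auto simp: limitin_def eventually_sequentially)
    have "eventually (\<lambda>i. n0 \<le> j i) sequentially"
      using assms by (simp add: filterlim_at_top)
    then show "eventually (\<lambda>i. \<gamma> (Suc (j i)) \<in> U) sequentially"
      by eventually_elim (simp add: n0)
  qed (use S topspace_integer_topological_group in auto)
next
  fix z :: complex assume "norm z = 1 \<and> (\<lambda>n. z powi \<gamma> (Suc n)) \<longlonglongrightarrow> 1"
  then show "(\<lambda>i. z powi \<gamma> (Suc (j i))) \<longlonglongrightarrow> z powi 0"
    using filterlim_compose[OF _ assms, of "\<lambda>n. z powi \<gamma> (Suc n)" "nhds 1"] by simp
qed

lemma const_subseq:
  fixes s :: "nat \<Rightarrow> 'a"
  assumes "finite A" "\<And>i. s i \<in> A"
  shows "\<exists>v\<in>A. \<exists>r :: nat \<Rightarrow> nat. strict_mono r \<and> (\<forall>i. s (r i) = v)"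
proof -
  have "\<exists>v\<in>A. infinite {i. s i = v}"
  proof (rule ccontr)
    assume "\<not> ?thesis"
    then have "finite (\<Union>v\<in>A. {i. s i = v})" using assms(1) by blast
    moreover have "(\<Union>v\<in>A. {i. s i = v}) = UNIV" using assms(2) by auto
    ultimately show False by simp
  qed
  then obtain v where v: "v \<in> A" "infinite {i. s i = v}" by blast
  then obtain r :: "nat \<Rightarrow> nat" where "strict_mono r" "\<And>i. r i \<in> {i. s i = v}"
    using infinite_enumerate[of "{i. s i = v}"] by blast
  then show ?thesis using v by auto
qed

text \<open>If every value is taken only finitely often, the sequence j itself tends to
  infinity.\<close>

lemma const_or_filterlim_subseq:
  fixes j :: "nat \<Rightarrow> nat"
  obtains (const) r :: "nat \<Rightarrow> nat" and c where "strict_mono r" "\<And>i. j (r i) = c"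
    | (lim) "filterlim j at_top sequentially"
proof (cases "\<exists>c. infinite {i. j i = c}")
  case True
  then obtain c where "infinite {i. j i = c}" by blast
  then obtain r :: "nat \<Rightarrow> nat" where "strict_mono r" "\<And>i. r i \<in> {i. j i = c}"
    using infinite_enumerate[of "{i. j i = c}"] by blast
  then show ?thesis using const[of r c] by simp
next
  case False
  have "eventually (\<lambda>i. Z \<le> j i) sequentially" for Z
  proof -
    have "finite (\<Union>c<Z. {i. j i = c})" using False by blast
    moreover have "(\<Union>c<Z. {i. j i = c}) = {i. \<not> Z \<le> j i}" by auto
    ultimately show ?thesis by (simp add: eventually_cofinite[symmetric] cofinite_eq_sequentially)
  qed
  then show ?thesis using lim by (simp add: filterlim_at_top)
qed

text \<open>One summand is treated at a time: along a subsequence its sign is constant and its index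
  is either constant or tends to infinity, and in the latter case the summand is null in every
  topology considered.\<close>

lemma bounded_sums_subseq:
  assumes "\<And>i. x i \<in> bounded_sums \<gamma> N"
  shows "\<exists>r l. strict_mono (r :: nat \<Rightarrow> nat) \<and> universal_limit \<gamma> (x \<circ> r) l"
  using assms
proof (induction N arbitrary: x)
  case 0
  then have "x \<circ> id = (\<lambda>_. 0)" by auto
  then show ?case using universal_limit_const strict_mono_id by metis
next
  case (Suc N)
  have "\<forall>i. \<exists>y s j. x i = y + s * \<gamma> (Suc j) \<and> y \<in> bounded_sums \<gamma> N \<and> s \<in> {-1, 0, 1}"
    using Suc.prems by simp
  then obtain y s j where x: "\<And>i. x i = y i + s i * \<gamma> (Suc (j i))"
    and y: "\<And>i. y i \<in> bounded_sums \<gamma> N" and s: "\<And>i. s i \<in> {-1, 0, 1 :: int}"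
    by metis
  obtain r1 l1 where r1: "strict_mono r1" "universal_limit \<gamma> (y \<circ> r1) l1"
    using Suc.IH[of y] y by blast
  have "\<exists>v\<in>{-1, 0, 1}. \<exists>r :: nat \<Rightarrow> nat. strict_mono r \<and> (\<forall>i. s (r1 (r i)) = v)"
    by (rule const_subseq[of "{-1, 0, 1}" "\<lambda>i. s (r1 i)", OF _ s]) simp
  then obtain v and r2 :: "nat \<Rightarrow> nat"
    where r2: "v \<in> {-1, 0, 1}" "strict_mono r2" "\<And>i. s (r1 (r2 i)) = v"
    by blast
  have "\<exists>(r3 :: nat \<Rightarrow> nat) l. strict_mono r3 \<and> universal_limit \<gamma> (\<lambda>i. \<gamma> (Suc (j (r1 (r2 (r3 i)))))) l"
  proof (cases "\<lambda>i. j (r1 (r2 i))" rule: const_or_filterlim_subseq)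
    case (const r c)
    then show ?thesis
      by (intro exI[of _ r] exI[of _ "\<gamma> (Suc c)"]) (simp add: universal_limit_const)
  next
    case lim
    show ?thesis
      by (rule exI[of _ id], rule exI[of _ 0]) (use universal_limit_gamma[OF lim] strict_mono_id in simp)
  qed
  then obtain r3 :: "nat \<Rightarrow> nat" and l where r3: "strict_mono r3"
    "universal_limit \<gamma> (\<lambda>i. \<gamma> (Suc (j (r1 (r2 (r3 i)))))) l" by blast
  have "\<exists>l'. universal_limit \<gamma> (\<lambda>i. v * \<gamma> (Suc (j (r1 (r2 (r3 i)))))) l'"
    using r2(1) universal_limit_const[of \<gamma> 0] r3(2) universal_limit_minus[OF r3(2)] by auto
  then obtain l' where "universal_limit \<gamma> (\<lambda>i. v * \<gamma> (Suc (j (r1 (r2 (r3 i)))))) l'" by blast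
  moreover have "universal_limit \<gamma> ((y \<circ> r1) \<circ> (r2 \<circ> r3)) l1"
    using universal_limit_subseq[OF r1(2)] strict_mono_o[OF r2(2) r3(1)] by blast
  ultimately have "universal_limit \<gamma> (x \<circ> (r1 \<circ> r2 \<circ> r3)) (l1 + l')"
    using universal_limit_add by (fastforce simp: o_def x r2(3))
  moreover have "strict_mono (r1 \<circ> r2 \<circ> r3)"
    using r1(1) r2(2) r3(1) by (intro strict_mono_o)
  ultimately show ?case by blast
qed

section \<open>Groups between the roots of unity and \<open>G\<^sub>0\<close>\<close>

text \<open>Common frame for G_p, with q = p, and G_0, with q = 2. The norm dominates the sup norm,
  and \<open>N_small\<close> makes it continuous at 1 on Q for the q-norm. That only 1 has norm 0
  follows from \<open>norm_le_N\<close> at n = 0, where g n = 1.\<close>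

locale circle_norm_group = divisibility_chain +
  fixes M :: "complex set" and N :: "complex \<Rightarrow> real" and q :: real
  assumes M_norm: "\<And>z. z \<in> M \<Longrightarrow> norm z = 1"
    and M_mult: "\<And>z w. z \<in> M \<Longrightarrow> w \<in> M \<Longrightarrow> z * w \<in> M"
    and M_inverse: "\<And>z. z \<in> M \<Longrightarrow> inverse z \<in> M"
    and Q_subset: "Q \<subseteq> M"
    and N_one: "N 1 = 0"
    and N_inverse: "\<And>z. z \<in> M \<Longrightarrow> N (inverse z) = N z"
    and N_mult_le: "\<And>z w. z \<in> M \<Longrightarrow> w \<in> M \<Longrightarrow> N (z * w) \<le> N z + N w"
    and norm_le_N: "\<And>z n. z \<in> M \<Longrightarrow> norm (1 - z powi g n) \<le> N z"
    and M_limit: "\<And>z. z \<in> M \<Longrightarrow> (\<lambda>n. z powi g n) \<longlonglongrightarrow> 1"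
    and q: "1 < q"
    and N_small: "\<And>\<eta>. 0 < \<eta> \<Longrightarrow> \<exists>\<delta>>0. \<forall>z\<in>Q. psum q z < \<delta> \<longrightarrow> N z < \<eta>"
    and Q_dense: "\<And>z \<eta>. z \<in> M \<Longrightarrow> 0 < \<eta> \<Longrightarrow> \<exists>w\<in>Q. N (z * inverse w) < \<eta>"
begin

lemma one_in_M: "1 \<in> M"
  using Q_one Q_subset by blast

lemma M_nonzero: "z \<in> M \<Longrightarrow> z \<noteq> 0"
  using M_norm by fastforce

lemma norm_1_minus_le_N: "z \<in> M \<Longrightarrow> norm (1 - z) \<le> N z"
  using norm_le_N[of z 0] by (simp add: gamma_1)

lemma N_nonneg: "z \<in> M \<Longrightarrow> 0 \<le> N z"
  using norm_1_minus_le_N norm_ge_zero order_trans by blast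

sublocale met: Metric_space M "invariant_dist M N"
proof
  show "0 \<le> invariant_dist M N z w" for z w
    by (simp add: invariant_dist_def N_nonneg M_mult M_inverse)
  show "invariant_dist M N z w = invariant_dist M N w z" for z w
  proof (cases "z \<in> M \<and> w \<in> M")
    case True
    then show ?thesis
      using N_inverse[OF M_mult[OF _ M_inverse], of z w]
      by (simp add: invariant_dist_def inverse_mult_distrib mult.commute)
  qed (auto simp: invariant_dist_def)
  show "invariant_dist M N z w = 0 \<longleftrightarrow> z = w" if "z \<in> M" "w \<in> M" for z w
  proof
    assume "invariant_dist M N z w = 0"
    then have "norm (1 - z * inverse w) \<le> 0"
      using norm_1_minus_le_N[OF M_mult[OF that(1) M_inverse[OF that(2)]]] that
      by (simp add: invariant_dist_def)
    then show "z = w" using M_nonzero[OF that(2)] by (simp add: field_simps)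
  qed (use that in \<open>simp add: invariant_dist_def M_nonzero N_one\<close>)
  show "invariant_dist M N x z \<le> invariant_dist M N x y + invariant_dist M N y z"
    if "x \<in> M" "y \<in> M" "z \<in> M" for x y z
  proof -
    have "(x * inverse y) * (y * inverse z) = x * inverse z"
      using M_nonzero[OF that(2)] by (simp add: field_simps)
    then show ?thesis
      using N_mult_le[of "x * inverse y" "y * inverse z"] that
      by (simp only: invariant_dist_def M_mult M_inverse if_True simp_thms)
  qed
qed

abbreviation X :: "complex topology" where "X \<equiv> met.mtopology"

abbreviation G :: "complex monoid" where "G \<equiv> circle_group\<lparr>carrier := M\<rparr>"

lemma carrier_G: "carrier G = M" and mult_G: "x \<otimes>\<^bsub>G\<^esub> y = x * y" and one_G: "\<one>\<^bsub>G\<^esub> = 1"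
  by (simp_all add: circle_group_def)

lemma group_G: "group G"
proof (rule groupI)
  show "\<exists>y\<in>carrier G. y \<otimes>\<^bsub>G\<^esub> x = \<one>\<^bsub>G\<^esub>" if "x \<in> carrier G" for x
    using that M_inverse M_nonzero by (auto simp: circle_group_def intro!: bexI[of _ "inverse x"])
qed (auto simp: circle_group_def M_mult one_in_M)

lemma norm_powi_diff_le:
  assumes "z \<in> M" "w \<in> M"
  shows "norm (z powi m - w powi m) \<le> \<bar>of_int m\<bar> * invariant_dist M N z w"
proof -
  have zw: "z * inverse w \<in> M" using assms by (simp add: M_mult M_inverse)
  have "norm (z powi m - w powi m) = norm (1 - z powi m / w powi m)"
    using norm_1_minus_divide[OF norm_power_int_1[OF M_norm[OF assms(2)]]] by simp
  also have "z powi m / w powi m = (z * inverse w) powi m"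
    by (simp add: power_int_divide_distrib divide_inverse[symmetric])
  also have "norm (1 - (z * inverse w) powi m) \<le> \<bar>of_int m\<bar> * norm (1 - z * inverse w)"
    by (rule norm_1_minus_power_int_le[OF M_norm[OF zw]])
  also have "\<dots> \<le> \<bar>of_int m\<bar> * invariant_dist M N z w"
    using norm_1_minus_le_N[OF zw] assms by (intro mult_left_mono) (auto simp: invariant_dist_def)
  finally show ?thesis .
qed

lemma norm_powi_g_diff_le:
  assumes "z \<in> M" "w \<in> M"
  shows "norm (z powi g n - w powi g n) \<le> invariant_dist M N z w"
proof -
  have zw: "z * inverse w \<in> M" using assms by (simp add: M_mult M_inverse)
  have "norm (z powi g n - w powi g n) = norm (1 - z powi g n / w powi g n)"
    using norm_1_minus_divide[OF norm_power_int_1[OF M_norm[OF assms(2)]]] by simp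
  also have "z powi g n / w powi g n = (z * inverse w) powi g n"
    by (simp add: power_int_divide_distrib divide_inverse[symmetric])
  finally show ?thesis using norm_le_N[OF zw] assms by (simp add: invariant_dist_def)
qed

lemma continuous_map_into_circle:
  assumes "f ` M \<subseteq> sphere 0 1"
  shows "continuous_map X (top_of_set (sphere 0 1)) f \<longleftrightarrow>
    (\<forall>z\<in>M. \<forall>\<epsilon>>0. \<exists>\<delta>>0. \<forall>w. w \<in> M \<and> invariant_dist M N z w < \<delta> \<longrightarrow> dist (f z) (f w) < \<epsilon>)"
proof -
  have "continuous_map X (top_of_set (sphere 0 1)) f \<longleftrightarrow> continuous_map X euclidean f"
    using assms by (auto simp: continuous_map_in_subtopology)
  also have "\<dots> \<longleftrightarrow> continuous_map X Met_TC.mtopology f" by simp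
  also have "\<dots> \<longleftrightarrow>
    (\<forall>z\<in>M. \<forall>\<epsilon>>0. \<exists>\<delta>>0. \<forall>w. w \<in> M \<and> invariant_dist M N z w < \<delta> \<longrightarrow> dist (f z) (f w) < \<epsilon>)"
    using met.metric_continuous_map[OF Met_TC.Metric_space_axioms] by simp
  finally show ?thesis .
qed

lemma power_character_in_characters: "power_character M m \<in> characters G X"
proof -
  have sph: "power_character M m ` M \<subseteq> sphere 0 1"
    by (auto simp: power_character_def norm_power_int_1 M_norm)
  have "continuous_map X (top_of_set (sphere 0 1)) (power_character M m)"
    unfolding continuous_map_into_circle[OF sph]
  proof (intro ballI allI impI)
    fix z and \<epsilon> :: real assume z: "z \<in> M" and \<epsilon>: "0 < \<epsilon>"
    let ?c = "\<bar>of_int m\<bar> + 1 :: real"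
    have "dist (power_character M m z) (power_character M m w) < \<epsilon>"
      if "w \<in> M \<and> invariant_dist M N z w < \<epsilon> / ?c" for w
    proof -
      have "norm (z powi m - w powi m) \<le> \<bar>of_int m\<bar> * invariant_dist M N z w"
        using norm_powi_diff_le z that by blast
      also have "\<dots> \<le> ?c * invariant_dist M N z w" by (intro mult_right_mono) auto
      also have "\<dots> < \<epsilon>" using that by (simp add: pos_less_divide_eq mult.commute)
      finally show ?thesis using z that by (simp add: power_character_def dist_norm)
    qed
    then show "\<exists>\<delta>>0. \<forall>w. w \<in> M \<and> invariant_dist M N z w < \<delta> \<longrightarrow>
        dist (power_character M m z) (power_character M m w) < \<epsilon>"
      using \<epsilon> by (intro exI[of _ "\<epsilon> / ?c"]) auto
  qed
  moreover have "power_character M m \<in> hom G circle_group"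
  proof (rule hom_circle_groupI, unfold carrier_G mult_G)
    show "power_character M m (x * y) = power_character M m x * power_character M m y"
      if "x \<in> M" "y \<in> M" for x y
      using that by (simp add: power_character_def M_mult power_int_mult_distrib)
  qed (simp add: power_character_def M_norm norm_power_int_1)
  ultimately show ?thesis
    by (simp add: characters_def carrier_G power_character_def)
qed

lemma power_character_inj: "power_character M m = power_character M k \<Longrightarrow> m = k"
  by (rule powi_inj_on_Q) (metis Q_subset power_character_def restrict_apply' subsetD)

text \<open>Continuity at 1 gives a ball on which |1 - \<phi>| < 1, so Re \<phi> \<ge> 0 on a q-ball
  of Q. The digit bound makes \<phi> a power on Q, and density of Q extends the equality to
  M.\<close>

lemma characters_G: "characters G X = range (power_character M)"
proof
  show "range (power_character M) \<subseteq> characters G X" using power_character_in_characters by blast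
  show "characters G X \<subseteq> range (power_character M)"
  proof
    fix \<phi> assume \<phi>: "\<phi> \<in> characters G X"
    note \<phi>D = charactersD[OF \<phi>, unfolded carrier_G mult_G]
    have sph: "\<phi> ` M \<subseteq> sphere 0 1" using \<phi>D(2) by auto
    note cont = \<phi>D(4)[unfolded continuous_map_into_circle[OF sph], rule_format]
    have phi_1: "\<phi> 1 = 1" using character_one[OF \<phi>] group_G by (simp add: one_G group.is_monoid)
    obtain \<eta> where \<eta>: "\<eta> > 0" "\<And>w. w \<in> M \<Longrightarrow> invariant_dist M N 1 w < \<eta> \<Longrightarrow> dist (\<phi> 1) (\<phi> w) < 1"
      using cont[OF one_in_M, of 1] by auto
    obtain \<delta> where \<delta>: "\<delta> > 0" "\<forall>z\<in>Q. psum q z < \<delta> \<longrightarrow> N z < \<eta>" using N_small[OF \<eta>(1)] by blast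
    have pos: "0 \<le> Re (\<phi> z)" if "z \<in> Q" "psum q z < \<delta>" for z
    proof -
      have z: "z \<in> M" using that Q_subset by blast
      have "invariant_dist M N 1 z = N z"
        using z one_in_M N_inverse by (simp add: invariant_dist_def)
      then have "norm (1 - \<phi> z) < 1" using \<eta>(2)[OF z] \<delta>(2) that phi_1 by (simp add: dist_norm)
      then show ?thesis by (intro Re_nonneg_if_norm_1_minus_le) simp
    qed
    obtain B where B: "\<And>h. \<forall>z\<in>Q. norm (h z) = 1 \<Longrightarrow> \<forall>z\<in>Q. \<forall>w\<in>Q. h (z * w) = h z * h w \<Longrightarrow>
        \<forall>z\<in>Q. psum q z < \<delta> \<longrightarrow> 0 \<le> Re (h z) \<Longrightarrow> \<exists>m\<in>bounded_sums \<gamma> B. \<forall>z\<in>Q. h z = z powi m"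
      using character_bound[OF q \<delta>(1)] by blast
    have "\<exists>m\<in>bounded_sums \<gamma> B. \<forall>z\<in>Q. \<phi> z = z powi m"
      using \<phi>D(2,3) pos by (intro B) (auto dest!: subsetD[OF Q_subset])
    then obtain m where m: "\<And>z. z \<in> Q \<Longrightarrow> \<phi> z = z powi m" by blast
    have "\<phi> z = z powi m" if z: "z \<in> M" for z
    proof (rule ccontr)
      assume neq: "\<phi> z \<noteq> z powi m"
      define \<epsilon> where "\<epsilon> = dist (\<phi> z) (z powi m) / 2"
      have \<epsilon>: "\<epsilon> > 0" using neq by (simp add: \<epsilon>_def)
      have sph': "power_character M m ` M \<subseteq> sphere 0 1"
        by (auto simp: power_character_def norm_power_int_1 M_norm)
      obtain d where d: "d > 0" "\<And>w. w \<in> M \<Longrightarrow> invariant_dist M N z w < d \<Longrightarrow> dist (\<phi> z) (\<phi> w) < \<epsilon>"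
        using cont[OF z \<epsilon>] by blast
      obtain d' where d': "d' > 0" "\<And>w. w \<in> M \<Longrightarrow> invariant_dist M N z w < d' \<Longrightarrow>
          dist (power_character M m z) (power_character M m w) < \<epsilon>"
        using charactersD(4)[OF power_character_in_characters[of m],
            unfolded continuous_map_into_circle[OF sph'], rule_format, OF z \<epsilon>] by blast
      obtain w where w: "w \<in> Q" "N (z * inverse w) < min d d'"
        using Q_dense[OF z, of "min d d'"] d(1) d'(1) by auto
      have wM: "w \<in> M" using w Q_subset by blast
      have "dist (\<phi> z) (\<phi> w) < \<epsilon>" "dist (power_character M m z) (power_character M m w) < \<epsilon>"
        using d(2)[OF wM] d'(2)[OF wM] w z wM by (auto simp: invariant_dist_def)
      then have "dist (\<phi> z) (w powi m) < \<epsilon>" "dist (z powi m) (w powi m) < \<epsilon>"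
        using m[OF w(1)] z wM by (auto simp: power_character_def)
      then have "dist (\<phi> z) (z powi m) < \<epsilon> + \<epsilon>" by metric
      then show False by (simp add: \<epsilon>_def)
    qed
    then have "\<phi> = power_character M m"
      using \<phi>D(1) by (intro extensionalityI[where A = M]) (auto simp: power_character_def)
    then show "\<phi> \<in> range (power_character M)" by blast
  qed
qed

section \<open>The dual topology on the integers\<close>

lemma powi_g_uniform_limit:
  assumes "compactin X K" "0 < \<epsilon>"
  shows "eventually (\<lambda>n. \<forall>z\<in>K. norm (1 - z powi g n) < \<epsilon>) sequentially"
proof -
  \<comment> \<open>The maps \<open>z powi g n\<close> are 1-Lipschitz uniformly in n, so pointwise
    convergence on a finite net of the totally bounded set K is uniform on K.\<close>
  obtain F where F: "finite F" "F \<subseteq> K" "K \<subseteq> (\<Union>w\<in>F. met.mball w (\<epsilon> / 2))"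
    using met.compactin_imp_mtotally_bounded[OF assms(1)] assms(2)
    unfolding met.mtotally_bounded_def by (meson half_gt_zero)
  have KM: "K \<subseteq> M" using compactin_subset_topspace[OF assms(1)] by simp
  have "eventually (\<lambda>n. norm (1 - w powi g n) < \<epsilon> / 2) sequentially" if "w \<in> F" for w
  proof -
    have "(\<lambda>n. norm (1 - w powi g n)) \<longlonglongrightarrow> norm (1 - 1 :: complex)"
      using that F KM by (intro tendsto_intros M_limit) auto
    then show ?thesis using assms(2) by (intro order_tendstoD) auto
  qed
  then have "eventually (\<lambda>n. \<forall>w\<in>F. norm (1 - w powi g n) < \<epsilon> / 2) sequentially"
    using F(1) by (simp add: eventually_ball_finite)
  then show ?thesis
  proof eventually_elim
    case (elim n)
    show ?case
    proof
      fix z assume z: "z \<in> K"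
      then obtain w where w: "w \<in> F" "z \<in> met.mball w (\<epsilon> / 2)" using F by blast
      then have "norm (w powi g n - z powi g n) < \<epsilon> / 2"
        using norm_powi_g_diff_le[of w z n] by (auto simp: met.in_mball)
      moreover have "norm (1 - w powi g n) < \<epsilon> / 2" using elim w by blast
      ultimately show "norm (1 - z powi g n) < \<epsilon>"
        using norm_triangle_ineq[of "1 - w powi g n" "w powi g n - z powi g n"] by simp
    qed
  qed
qed

text \<open>The compact-open topology of the dual, carried over to \<open>\<int>\<close>.\<close>

definition Z_nbhd :: "complex set \<Rightarrow> real \<Rightarrow> int \<Rightarrow> int set" where
  "Z_nbhd K \<epsilon> m = {k. \<forall>z\<in>K. norm (z powi k - z powi m) < \<epsilon>}"

definition Z_top :: "int topology" where
  "Z_top = topology (\<lambda>U. \<forall>m\<in>U. \<exists>K \<epsilon>. compactin X K \<and> 0 < \<epsilon> \<and> Z_nbhd K \<epsilon> m \<subseteq> U)"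

lemma openin_Z_top:
  "openin Z_top U \<longleftrightarrow> (\<forall>m\<in>U. \<exists>K \<epsilon>. compactin X K \<and> 0 < \<epsilon> \<and> Z_nbhd K \<epsilon> m \<subseteq> U)"
proof -
  let ?P = "\<lambda>U. \<forall>m\<in>U. \<exists>K \<epsilon>. compactin X K \<and> 0 < \<epsilon> \<and> Z_nbhd K \<epsilon> m \<subseteq> U"
  have "istopology ?P"
    unfolding istopology_def
  proof (intro conjI allI impI)
    fix U V assume U: "?P U" and V: "?P V"
    show "?P (U \<inter> V)"
    proof
      fix m assume "m \<in> U \<inter> V"
      then obtain K \<epsilon> K' \<epsilon>' where *: "compactin X K" "0 < \<epsilon>" "Z_nbhd K \<epsilon> m \<subseteq> U"
          "compactin X K'" "0 < \<epsilon>'" "Z_nbhd K' \<epsilon>' m \<subseteq> V"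
        using U V by (meson IntD1 IntD2)
      have "Z_nbhd (K \<union> K') (min \<epsilon> \<epsilon>') m \<subseteq> U \<inter> V"
        using *(3,6) by (auto simp: Z_nbhd_def)
      then show "\<exists>K \<epsilon>. compactin X K \<and> 0 < \<epsilon> \<and> Z_nbhd K \<epsilon> m \<subseteq> U \<inter> V"
        using * by (intro exI[of _ "K \<union> K'"] exI[of _ "min \<epsilon> \<epsilon>'"]) (auto simp: compactin_Un)
    qed
  next
    fix \<K> assume *: "\<forall>U\<in>\<K>. ?P U"
    show "?P (\<Union>\<K>)"
    proof
      fix m assume "m \<in> \<Union>\<K>"
      then obtain U where "U \<in> \<K>" "m \<in> U" by blast
      with * show "\<exists>K \<epsilon>. compactin X K \<and> 0 < \<epsilon> \<and> Z_nbhd K \<epsilon> m \<subseteq> \<Union>\<K>"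
        by (meson Union_upper subset_trans)
    qed
  qed
  then show ?thesis by (simp add: Z_top_def)
qed

lemma compactin_norm: "compactin X K \<Longrightarrow> z \<in> K \<Longrightarrow> norm z = 1"
  using compactin_subset_topspace M_norm by fastforce

lemma Z_nbhd_contains_open:
  assumes "compactin X K" "0 < \<epsilon>"
  shows "\<exists>W. openin Z_top W \<and> m \<in> W \<and> W \<subseteq> Z_nbhd K \<epsilon> m"
proof -
  \<comment> \<open>The uniform bound d leaves a slack \<epsilon> - d, which makes W open directly
    from the triangle inequality.\<close>
  define W where "W = {k. \<exists>d<\<epsilon>. \<forall>z\<in>K. norm (z powi k - z powi m) \<le> d}"
  have "openin Z_top W"
    unfolding openin_Z_top
  proof
    fix k assume "k \<in> W"
    then obtain d where d: "d < \<epsilon>" "\<And>z. z \<in> K \<Longrightarrow> norm (z powi k - z powi m) \<le> d"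
      by (auto simp: W_def)
    have "Z_nbhd K ((\<epsilon> - d) / 2) k \<subseteq> W"
    proof
      fix l assume l: "l \<in> Z_nbhd K ((\<epsilon> - d) / 2) k"
      have "norm (z powi l - z powi m) \<le> (\<epsilon> - d) / 2 + d" if "z \<in> K" for z
      proof -
        have "norm (z powi l - z powi m) \<le> norm (z powi l - z powi k) + norm (z powi k - z powi m)"
          using norm_triangle_ineq[of "z powi l - z powi k" "z powi k - z powi m"] by simp
        moreover have "norm (z powi l - z powi k) < (\<epsilon> - d) / 2" using l that by (simp add: Z_nbhd_def)
        ultimately show ?thesis using d(2)[OF that] by linarith
      qed
      moreover have "(\<epsilon> - d) / 2 + d < \<epsilon>" using d(1) by (simp add: field_simps)
      ultimately show "l \<in> W" unfolding W_def by blast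
    qed
    then show "\<exists>K \<epsilon>. compactin X K \<and> 0 < \<epsilon> \<and> Z_nbhd K \<epsilon> k \<subseteq> W"
      using assms(1) d(1) by (intro exI[of _ K] exI[of _ "(\<epsilon> - d) / 2"]) auto
  qed
  moreover have "m \<in> W" using assms(2) by (auto simp: W_def intro!: exI[of _ 0])
  moreover have "W \<subseteq> Z_nbhd K \<epsilon> m" by (force simp: W_def Z_nbhd_def)
  ultimately show ?thesis by blast
qed

lemma topspace_Z_top: "topspace Z_top = UNIV"
proof -
  have "openin Z_top UNIV" unfolding openin_Z_top using compactin_empty by (metis UNIV_I subset_UNIV zero_less_one)
  then show ?thesis using openin_subset by blast
qed

lemma Z_top_group: "abelian_topological_group integer_group Z_top"
  unfolding abelian_topological_group_def
proof (intro conjI)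
  show "comm_group integer_group" by (rule abelian_integer_group)
  show "topspace Z_top = carrier integer_group" by (simp add: topspace_Z_top)
  have "continuous_map (prod_topology Z_top Z_top) Z_top (\<lambda>(x, y). x + y)"
    unfolding continuous_map_def
  proof (intro conjI allI impI)
    fix U assume U: "openin Z_top U"
    show "openin (prod_topology Z_top Z_top)
        {x \<in> topspace (prod_topology Z_top Z_top). (case x of (x, y) \<Rightarrow> x + y) \<in> U}"
      unfolding openin_prod_topology_alt
    proof (intro allI impI)
      fix x y assume "(x, y) \<in> {x \<in> topspace (prod_topology Z_top Z_top). (case x of (x, y) \<Rightarrow> x + y) \<in> U}"
      then obtain K \<epsilon> where K: "compactin X K" "0 < \<epsilon>" "Z_nbhd K \<epsilon> (x + y) \<subseteq> U"
        using U unfolding openin_Z_top by auto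
      obtain V where V: "openin Z_top V" "x \<in> V" "V \<subseteq> Z_nbhd K (\<epsilon> / 2) x"
        using Z_nbhd_contains_open[OF K(1), of "\<epsilon> / 2" x] K(2) by auto
      obtain W where W: "openin Z_top W" "y \<in> W" "W \<subseteq> Z_nbhd K (\<epsilon> / 2) y"
        using Z_nbhd_contains_open[OF K(1), of "\<epsilon> / 2" y] K(2) by auto
      have "v + w \<in> U" if vw: "v \<in> V" "w \<in> W" for v w
      proof -
        have "norm (z powi (v + w) - z powi (x + y)) < \<epsilon>" if "z \<in> K" for z
        proof -
          have z: "norm z = 1" using compactin_norm K(1) that by blast
          then have "z \<noteq> 0" by auto
          then have "z powi (v + w) - z powi (x + y) =
              z powi w * (z powi v - z powi x) + z powi x * (z powi w - z powi y)"
            by (simp add: power_int_add algebra_simps)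
          then have "norm (z powi (v + w) - z powi (x + y)) \<le>
              norm (z powi v - z powi x) + norm (z powi w - z powi y)"
            using norm_triangle_ineq[of "z powi w * (z powi v - z powi x)" "z powi x * (z powi w - z powi y)"]
            by (simp add: norm_mult norm_power_int_1[OF z])
          also have "\<dots> < \<epsilon> / 2 + \<epsilon> / 2"
            using V(3) W(3) vw that by (intro add_strict_mono) (auto simp: Z_nbhd_def)
          finally show ?thesis by simp
        qed
        then show ?thesis using K(3) by (auto simp: Z_nbhd_def)
      qed
      then show "\<exists>V W. openin Z_top V \<and> openin Z_top W \<and> x \<in> V \<and> y \<in> W \<and>
          V \<times> W \<subseteq> {x \<in> topspace (prod_topology Z_top Z_top). (case x of (x, y) \<Rightarrow> x + y) \<in> U}"
        using V(1,2) W(1,2) by (intro exI[of _ V] exI[of _ W]) (auto simp: topspace_Z_top)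
    qed
  qed (simp add: topspace_Z_top)
  then show "continuous_map (prod_topology Z_top Z_top) Z_top (\<lambda>(x, y). x \<otimes>\<^bsub>integer_group\<^esub> y)"
    by simp
  have "continuous_map Z_top Z_top (\<lambda>x. - x)"
    unfolding continuous_map_def
  proof (intro conjI allI impI)
    fix U assume U: "openin Z_top U"
    show "openin Z_top {x \<in> topspace Z_top. - x \<in> U}"
      unfolding openin_Z_top
    proof
      fix x assume "x \<in> {x \<in> topspace Z_top. - x \<in> U}"
      then obtain K \<epsilon> where K: "compactin X K" "0 < \<epsilon>" "Z_nbhd K \<epsilon> (- x) \<subseteq> U"
        using U unfolding openin_Z_top by auto
      have "- v \<in> Z_nbhd K \<epsilon> (- x)" if "v \<in> Z_nbhd K \<epsilon> x" for v
      proof -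
        have "norm (z powi (- v) - z powi (- x)) = norm (z powi v - z powi x)" if "z \<in> K" for z
        proof -
          have "norm z = 1" using compactin_norm K(1) that by blast
          then show ?thesis
            using norm_power_int_diff[of z "- v" "- x"] norm_power_int_diff[of z x v]
            by (simp add: norm_minus_commute)
        qed
        then show ?thesis using that by (auto simp: Z_nbhd_def)
      qed
      then have "Z_nbhd K \<epsilon> x \<subseteq> {x \<in> topspace Z_top. - x \<in> U}"
        using K(3) by (auto simp: topspace_Z_top)
      then show "\<exists>K \<epsilon>'. compactin X K \<and> 0 < \<epsilon>' \<and> Z_nbhd K \<epsilon>' x \<subseteq> {x \<in> topspace Z_top. - x \<in> U}"
        using K(1,2) by blast
    qed
  qed (simp add: topspace_Z_top)
  then show "continuous_map Z_top Z_top (\<lambda>x. inv\<^bsub>integer_group\<^esub> x)" by simp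
qed

lemma Z_top_Hausdorff: "Hausdorff_space Z_top"
  unfolding Hausdorff_space_def
proof (intro allI impI)
  fix x y assume "x \<in> topspace Z_top \<and> y \<in> topspace Z_top \<and> x \<noteq> y"
  then obtain z where z: "z \<in> Q" "z powi x \<noteq> z powi y" using powi_inj_on_Q by blast
  have K: "compactin X {z}" using z Q_subset by auto
  define \<epsilon> where "\<epsilon> = dist (z powi x) (z powi y) / 2"
  have \<epsilon>: "\<epsilon> > 0" using z by (simp add: \<epsilon>_def)
  obtain U V where U: "openin Z_top U" "x \<in> U" "U \<subseteq> Z_nbhd {z} \<epsilon> x"
    and V: "openin Z_top V" "y \<in> V" "V \<subseteq> Z_nbhd {z} \<epsilon> y"
    using Z_nbhd_contains_open[OF K \<epsilon>] by meson
  have "disjnt U V"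
    unfolding disjnt_iff
  proof (intro allI notI)
    fix k assume "k \<in> U \<and> k \<in> V"
    then have "dist (z powi k) (z powi x) < \<epsilon>" "dist (z powi k) (z powi y) < \<epsilon>"
      using U(3) V(3) by (auto simp: Z_nbhd_def dist_norm)
    then have "dist (z powi x) (z powi y) < \<epsilon> + \<epsilon>" by metric
    then show False by (simp add: \<epsilon>_def)
  qed
  then show "\<exists>U V. openin Z_top U \<and> openin Z_top V \<and> x \<in> U \<and> y \<in> V \<and> disjnt U V"
    using U V by blast
qed

lemma Z_top_limit: "limitin Z_top \<gamma> 0 sequentially"
proof (rule limitin_sequentially_offset_rev[where k = 1])
  show "limitin Z_top (\<lambda>i. \<gamma> (i + 1)) 0 sequentially"
    unfolding limitin_def
  proof (intro conjI allI impI)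
    fix U assume "openin Z_top U \<and> 0 \<in> U"
    then obtain K \<epsilon> where K: "compactin X K" "0 < \<epsilon>" "Z_nbhd K \<epsilon> 0 \<subseteq> U"
      unfolding openin_Z_top by blast
    have "eventually (\<lambda>n. \<forall>z\<in>K. norm (1 - z powi g n) < \<epsilon>) sequentially"
      by (rule powi_g_uniform_limit[OF K(1,2)])
    then show "eventually (\<lambda>n. \<gamma> (n + 1) \<in> U) sequentially"
    proof eventually_elim
      case (elim n)
      then show ?case using K(3) by (auto simp: Z_nbhd_def norm_minus_commute)
    qed
  qed (simp add: topspace_Z_top)
qed

lemma null_group_topology_Z_top: "null_group_topology \<gamma> Z_top"
  by (simp add: null_group_topology_def Z_top_group Z_top_Hausdorff Z_top_limit)

text \<open>The bijection onto the dual carries \<open>Z_nbhd\<close> exactly to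
  \<open>uniform_nbhd\<close>, so open sets correspond; surjectivity is
  \<open>characters_G\<close>.\<close>

lemma power_character_iso:
  "topological_group_iso integer_group Z_top (dual_group G X) (dual_topology G X) (power_character M)"
proof -
  have inj: "inj (power_character M)" by (rule injI) (rule power_character_inj)
  have top: "topspace X = carrier G" by (simp add: carrier_G)
  have nbhd: "uniform_nbhd G X K \<epsilon> (power_character M m) = power_character M ` Z_nbhd K \<epsilon> m"
    if "compactin X K" for K \<epsilon> m
  proof -
    have "K \<subseteq> M" using compactin_subset_topspace[OF that] by simp
    then have "(\<forall>z\<in>K. norm (power_character M k z - power_character M m z) < \<epsilon>) \<longleftrightarrow> k \<in> Z_nbhd K \<epsilon> m" for k
      by (auto simp: power_character_def Z_nbhd_def subset_iff)
    then show ?thesis unfolding uniform_nbhd_def characters_G by auto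
  qed
  have open_image: "openin (dual_topology G X) (power_character M ` U) \<longleftrightarrow> openin Z_top U" for U
  proof -
    have "uniform_nbhd G X K \<epsilon> (power_character M m) \<subseteq> power_character M ` U \<longleftrightarrow> Z_nbhd K \<epsilon> m \<subseteq> U"
      if "compactin X K" for K \<epsilon> m
      unfolding nbhd[OF that] using inj by (simp add: inj_image_subset_iff)
    then show ?thesis
      unfolding openin_dual_topology_iff[OF top] openin_Z_top ball_simps
      using power_character_in_characters by (metis (no_types, lifting) image_subsetI)
  qed
  have "homeomorphic_map Z_top (dual_topology G X) (power_character M)"
  proof (rule bijective_open_imp_homeomorphic_map)
    show "continuous_map Z_top (dual_topology G X) (power_character M)"
      unfolding continuous_map_def
    proof (intro conjI allI impI)
      fix W assume W: "openin (dual_topology G X) W"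
      then have "W \<subseteq> range (power_character M)"
        using openin_subset characters_G by fastforce
      then have "power_character M ` {x \<in> topspace Z_top. power_character M x \<in> W} = W"
        by (auto simp: topspace_Z_top)
      then show "openin Z_top {x \<in> topspace Z_top. power_character M x \<in> W}"
        using open_image W by metis
    qed (simp add: power_character_in_characters)
    show "open_map Z_top (dual_topology G X) (power_character M)"
      using open_image by (simp add: open_map_def)
  qed (use inj in \<open>auto simp: topspace_Z_top characters_G\<close>)
  moreover have "power_character M (m + k) = power_character M m \<otimes>\<^bsub>dual_group G X\<^esub> power_character M k" for m k
    using M_nonzero by (auto simp: mult_dual_group power_character_def fun_eq_iff power_int_add carrier_G)
  ultimately show ?thesis
    using inj by (auto simp: topological_group_iso_def iso_def hom_def bij_betw_def characters_G)
qed

section \<open>Polars of balls and the finest group topology\<close>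

definition ball_polar :: "nat \<Rightarrow> int set" where
  "ball_polar n = {m. \<forall>z\<in>Q. N z < 1 / real (Suc n) \<longrightarrow> 0 \<le> Re (z powi m)}"

text \<open>By \<open>N_small\<close> the ball contains a q-ball of Q, so its polar lies in the
  polar of that q-ball, to which \<open>polar_bound\<close> applies.\<close>

lemma ball_polar_bounded: "\<exists>B. ball_polar n \<subseteq> bounded_sums \<gamma> B"
proof -
  obtain \<delta> where \<delta>: "\<delta> > 0" "\<forall>z\<in>Q. psum q z < \<delta> \<longrightarrow> N z < 1 / real (Suc n)"
    using N_small[of "1 / real (Suc n)"] by auto
  obtain B where "\<And>m. (\<forall>z\<in>Q. psum q z < \<delta> \<longrightarrow> 0 \<le> Re (z powi m)) \<Longrightarrow> m \<in> bounded_sums \<gamma> B"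
    using polar_bound[OF q \<delta>(1)] by blast
  then show ?thesis using \<delta>(2) unfolding ball_polar_def by blast
qed

lemma ball_polar_exhausts: "\<exists>n. m \<in> ball_polar n"
proof -
  have "0 \<le> Re (z powi m)" if "z \<in> Q" "N z < 1 / real (Suc (nat \<bar>m\<bar>))" for z
  proof (rule Re_nonneg_if_norm_1_minus_le)
    have z: "z \<in> M" using that Q_subset by blast
    have "norm (1 - z powi m) \<le> \<bar>of_int m\<bar> * norm (1 - z)"
      by (rule norm_1_minus_power_int_le[OF M_norm[OF z]])
    also have "\<dots> \<le> real (Suc (nat \<bar>m\<bar>)) * (1 / real (Suc (nat \<bar>m\<bar>)))"
      using that norm_1_minus_le_N[OF z] by (intro mult_mono) auto
    also have "\<dots> = 1" by (simp del: of_nat_Suc)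
    finally show "norm (1 - z powi m) \<le> 1" .
  qed
  then show ?thesis unfolding ball_polar_def by blast
qed

text \<open>Compactness of the polar by sequences: exhaust the countable B by finite sets and
  suppose each leaves a point outside U. These points lie in one set of bounded sums, so a
  subsequence converges; the limit satisfies all conditions from H and B and stays outside the open
  U, a contradiction.\<close>

lemma finite_polar_subset:
  assumes S: "abelian_topological_group integer_group S" "limitin S \<gamma> 0 sequentially" "openin S U"
    and B: "B \<subseteq> Q" "H \<subseteq> Q" "{m \<in> ball_polar n. \<forall>z\<in>H \<union> B. 0 \<le> Re (z powi m)} \<subseteq> U"
  shows "\<exists>F. finite F \<and> F \<subseteq> B \<and> {m \<in> ball_polar n. \<forall>z\<in>H \<union> F. 0 \<le> Re (z powi m)} \<subseteq> U"
proof (cases "B = {}")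
  case False
  have cB: "countable B" using countable_Q B(1) countable_subset by blast
  define F where "F i = from_nat_into B ` {..i}" for i :: nat
  have F: "finite (F i)" "F i \<subseteq> B" for i using from_nat_into[OF False] by (auto simp: F_def)
  have F_mono: "F i \<subseteq> F k" if "i \<le> k" for i k using that by (auto simp: F_def)
  have F_exh: "\<exists>i. z \<in> F i" if "z \<in> B" for z
    using from_nat_into_surj[OF cB that] by (auto simp: F_def)
  show ?thesis
  proof (rule ccontr)
    assume neg: "\<not> ?thesis"
    have "\<exists>m. m \<in> ball_polar n \<and> (\<forall>z\<in>H \<union> F i. 0 \<le> Re (z powi m)) \<and> m \<notin> U" for i
    proof -
      have "\<not> (finite (F i) \<and> F i \<subseteq> B \<and> {m \<in> ball_polar n. \<forall>z\<in>H \<union> F i. 0 \<le> Re (z powi m)} \<subseteq> U)"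
        using neg by (rule contrapos_nn) (rule exI)
      then have "\<not> {m \<in> ball_polar n. \<forall>z\<in>H \<union> F i. 0 \<le> Re (z powi m)} \<subseteq> U" using F by simp
      then show ?thesis by (simp add: subset_iff)
    qed
    then obtain x where x: "\<And>i. x i \<in> ball_polar n" "\<And>i z. z \<in> H \<union> F i \<Longrightarrow> 0 \<le> Re (z powi x i)"
      "\<And>i. x i \<notin> U" by metis
    obtain C where "ball_polar n \<subseteq> bounded_sums \<gamma> C" using ball_polar_bounded by blast
    then obtain r l where r: "strict_mono (r :: nat \<Rightarrow> nat)" "universal_limit \<gamma> (x \<circ> r) l"
      using bounded_sums_subseq[of x \<gamma> C] x(1) by blast
    have lim: "(\<lambda>i. Re (z powi x (r i))) \<longlonglongrightarrow> Re (z powi l)" if "z \<in> Q" for z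
      using r(2) that Q_subset M_norm M_limit unfolding universal_limit_def
      by (intro tendsto_Re) (auto simp: o_def)
    have "l \<notin> U"
    proof
      assume "l \<in> U"
      moreover have "limitin S (x \<circ> r) l sequentially"
        using r(2) S(1,2) by (auto simp: universal_limit_def)
      ultimately have "eventually (\<lambda>i. (x \<circ> r) i \<in> U) sequentially"
        using S(3) by (simp add: limitin_def)
      then show False using x(3) by (simp add: eventually_sequentially)
    qed
    moreover have "l \<in> ball_polar n"
      unfolding ball_polar_def
    proof (intro CollectI ballI impI)
      fix z assume z: "z \<in> Q" "N z < 1 / real (Suc n)"
      show "0 \<le> Re (z powi l)"
        by (rule LIMSEQ_le_const[OF lim[OF z(1)]]) (use x(1) z in \<open>auto simp: ball_polar_def\<close>)
    qed
    moreover have "0 \<le> Re (z powi l)" if z: "z \<in> H \<union> B" for z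
    proof -
      obtain i where i: "z \<in> H \<union> F i" using z F_exh by blast
      have "0 \<le> Re (z powi x (r k))" if "k \<ge> i" for k
      proof (rule x(2))
        have "i \<le> r k" using that seq_suble[OF r(1), of k] by simp
        then show "z \<in> H \<union> F (r k)" using i F_mono by blast
      qed
      then show ?thesis using z B by (intro LIMSEQ_le_const[OF lim]) auto
    qed
    ultimately show False using B(3) by blast
  qed
qed (use B in auto)

text \<open>Everything outside the finite set H n is added later and has norm below 1 / (n + 1). One
  open set around 1 therefore covers all but finitely many points.\<close>

lemma compactin_null_sequence:
  assumes "\<And>n. finite (H n)" "\<And>n. H n \<subseteq> M" "\<And>n. H (Suc n) - H n \<subseteq> {z. N z < 1 / real (Suc n)}"
    and "\<And>n. H n \<subseteq> H (Suc n)"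
  shows "compactin X (insert 1 (\<Union>n. H n))"
  unfolding compactin_def
proof (intro conjI allI impI)
  have small: "N z < 1 / real (Suc n)" if "z \<in> H k" "z \<notin> H n" "n \<le> k" for z n k
    using that(3,1,2)
  proof (induction rule: dec_induct)
    case (step k)
    show ?case
    proof (cases "z \<in> H k")
      case False
      then have "N z < 1 / real (Suc k)" using assms(3)[of k] step by blast
      also have "\<dots> \<le> 1 / real (Suc n)" using step by (simp add: frac_le)
      finally show ?thesis .
    qed (use step in auto)
  qed auto
  show "insert 1 (\<Union>n. H n) \<subseteq> topspace X" using assms(2) one_in_M by auto
  fix \<U> assume \<U>: "Ball \<U> (openin X) \<and> insert 1 (\<Union>n. H n) \<subseteq> \<Union>\<U>"
  then obtain U where U: "U \<in> \<U>" "1 \<in> U" "openin X U" by blast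
  then obtain \<epsilon> where \<epsilon>: "\<epsilon> > 0" "met.mball 1 \<epsilon> \<subseteq> U" unfolding met.openin_mtopology by blast
  obtain n where n: "1 / real (Suc n) < \<epsilon>" using \<epsilon>(1) by (metis inverse_eq_divide reals_Archimedean)
  define f where "f z = (SOME V. V \<in> \<U> \<and> z \<in> V)" for z
  have f: "f z \<in> \<U> \<and> z \<in> f z" if "z \<in> H n" for z
    unfolding f_def by (rule someI_ex) (use \<U> that in blast)
  have rest: "z \<in> U" if "z \<in> H k" "z \<notin> H n" for z k
  proof -
    have z: "z \<in> M" using that assms(2) by blast
    have "\<not> k \<le> n" using that lift_Suc_mono_le[of H k n] assms(4) by blast
    then have "N z < 1 / real (Suc n)" using small that by simp
    then have "invariant_dist M N 1 z < \<epsilon>"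
      using n z one_in_M N_inverse by (simp add: invariant_dist_def)
    then show ?thesis using \<epsilon>(2) z one_in_M by (auto simp: met.in_mball)
  qed
  show "\<exists>\<F>. finite \<F> \<and> \<F> \<subseteq> \<U> \<and> insert 1 (\<Union>n. H n) \<subseteq> \<Union>\<F>"
  proof (intro exI[of _ "insert U (f ` H n)"] conjI)
    show "insert 1 (\<Union>n. H n) \<subseteq> \<Union>(insert U (f ` H n))"
    proof
      fix z assume z: "z \<in> insert 1 (\<Union>n. H n)"
      show "z \<in> \<Union>(insert U (f ` H n))"
      proof (cases "z \<in> H n")
        case True
        then show ?thesis using f[OF True] by auto
      next
        case False
        then have "z \<in> U" using z U(2) rest by auto
        then show ?thesis by simp
      qed
    qed
  qed (use assms(1) U(1) f in auto)
qed

text \<open>A Banach--Dieudonne argument: every neighbourhood of \<open>0\<close> in a group topology making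
  the sequence null contains the polar of the range of a null sequence. The null sequence is
  built in finite blocks, each in a smaller ball, using that polars of balls are compact.\<close>

theorem neighbourhood_contains_compact_polar:
  assumes S: "abelian_topological_group integer_group S" "limitin S \<gamma> 0 sequentially"
    and U: "openin S U" "0 \<in> U"
  shows "\<exists>K. compactin X K \<and> {m. \<forall>z\<in>K. 0 \<le> Re (z powi m)} \<subseteq> U"
proof -
  define P where "P n H \<longleftrightarrow> finite H \<and> H \<subseteq> Q \<and> {m \<in> ball_polar n. \<forall>z\<in>H. 0 \<le> Re (z powi m)} \<subseteq> U" for n H
  have base: "\<exists>H. P 0 H"
  proof -
    have "m \<in> U" if "\<forall>z\<in>{} \<union> Q. 0 \<le> Re (z powi m)" for m
    proof -
      \<comment> \<open>Powers of z stay in Q, so all powers of \<open>z powi m\<close> lie in the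
        right half plane and it equals 1; Q separates exponents, hence m = 0.\<close>
      have "z powi m = z powi 0" if z: "z \<in> Q" for z
      proof -
        have "0 \<le> Re ((z powi m) ^ j)" for j
        proof -
          have "z powi int j \<in> Q" by (rule Q_powi[OF z])
          then have "0 \<le> Re ((z powi int j) powi m)" using \<open>\<forall>z\<in>{} \<union> Q. _ z\<close> by blast
          moreover have "(z powi int j) powi m = (z powi m) powi int j"
            unfolding power_int_mult[symmetric] by (simp add: mult.commute)
          ultimately show ?thesis by simp
        qed
        then show ?thesis using eq_1_if_Re_powers_nonneg norm_power_int_1[OF norm_Q[OF z]] by simp
      qed
      then have "m = 0" using powi_inj_on_Q by blast
      then show ?thesis using U by simp
    qed
    then have "{m \<in> ball_polar 0. \<forall>z\<in>{} \<union> Q. 0 \<le> Re (z powi m)} \<subseteq> U" by blast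
    then obtain F where "finite F" "F \<subseteq> Q" "{m \<in> ball_polar 0. \<forall>z\<in>{} \<union> F. 0 \<le> Re (z powi m)} \<subseteq> U"
      using finite_polar_subset[OF S U(1), of Q "{}" 0] by blast
    then show ?thesis unfolding P_def by auto
  qed
  have step: "\<exists>H'. P (Suc n) H' \<and> (H \<subseteq> H' \<and> H' - H \<subseteq> {z. N z < 1 / real (Suc n)})" if H: "P n H" for n H
  proof -
    let ?B = "{z \<in> Q. N z < 1 / real (Suc n)}"
    \<comment> \<open>Nonnegativity on \<open>?B\<close> is membership in
      \<open>ball_polar n\<close>, so the hypothesis on H applies; by compactness finitely many of
      these conditions can replace the whole of \<open>?B\<close>.\<close>
    have "{m \<in> ball_polar (Suc n). \<forall>z\<in>H \<union> ?B. 0 \<le> Re (z powi m)} \<subseteq>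
        {m \<in> ball_polar n. \<forall>z\<in>H. 0 \<le> Re (z powi m)}"
      by (auto simp: ball_polar_def)
    then have *: "{m \<in> ball_polar (Suc n). \<forall>z\<in>H \<union> ?B. 0 \<le> Re (z powi m)} \<subseteq> U"
      using H unfolding P_def by blast
    obtain F where "finite F" "F \<subseteq> ?B" "{m \<in> ball_polar (Suc n). \<forall>z\<in>H \<union> F. 0 \<le> Re (z powi m)} \<subseteq> U"
      using finite_polar_subset[OF S U(1) _ _ *] H unfolding P_def by blast
    then show ?thesis using H unfolding P_def by (intro exI[of _ "H \<union> F"]) auto
  qed
  obtain H where H: "\<And>n. P n (H n)" "\<And>n. H n \<subseteq> H (Suc n)"
      "\<And>n. H (Suc n) - H n \<subseteq> {z. N z < 1 / real (Suc n)}"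
    using dependent_nat_choice[of P "\<lambda>n H H'. H \<subseteq> H' \<and> H' - H \<subseteq> {z. N z < 1 / real (Suc n)}", OF base step]
    by metis
  have "compactin X (insert 1 (\<Union>n. H n))"
  proof (rule compactin_null_sequence)
    show "finite (H n)" "H n \<subseteq> M" for n using H(1)[of n] Q_subset by (auto simp: P_def)
  qed (use H in auto)
  moreover have "{m. \<forall>z\<in>insert 1 (\<Union>n. H n). 0 \<le> Re (z powi m)} \<subseteq> U"
  proof
    fix m assume m: "m \<in> {m. \<forall>z\<in>insert 1 (\<Union>n. H n). 0 \<le> Re (z powi m)}"
    obtain n where "m \<in> ball_polar n" using ball_polar_exhausts by blast
    then show "m \<in> U" using H(1)[of n] m unfolding P_def by blast
  qed
  ultimately show ?thesis by blast
qed

text \<open>After translation to 0 the polar of a compact K fits into U. Since |z^k - z^m| < 1 on K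
  already gives Re z^(k - m) \<ge> 0 there, the radius 1 works.\<close>

lemma finest_Z_top: "finest_null_group_topology \<gamma> Z_top"
  unfolding finest_null_group_topology_def
proof (intro conjI allI impI null_group_topology_Z_top)
  fix S U assume "null_group_topology \<gamma> S" and U: "openin S U"
  then have S: "abelian_topological_group integer_group S" "limitin S \<gamma> 0 sequentially"
    by (auto simp: null_group_topology_def)
  have top: "topspace S = UNIV" by (rule topspace_integer_topological_group[OF S(1)])
  show "openin Z_top U"
    unfolding openin_Z_top
  proof
    fix m assume m: "m \<in> U"
    have "continuous_map S S (\<lambda>k. k + m)"
      by (rule continuous_map_add_integer_topological_group[OF S(1)]) (simp_all add: top)
    from openin_continuous_map_preimage[OF this U]
    have V: "openin S {k. k + m \<in> U}" "0 \<in> {k. k + m \<in> U}" using m top by simp_all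
    obtain K where K: "compactin X K" "{k. \<forall>z\<in>K. 0 \<le> Re (z powi k)} \<subseteq> {k. k + m \<in> U}"
      using neighbourhood_contains_compact_polar[OF S V] by blast
    have "Z_nbhd K 1 m \<subseteq> U"
    proof
      fix k assume k: "k \<in> Z_nbhd K 1 m"
      have "0 \<le> Re (z powi (k - m))" if z: "z \<in> K" for z
      proof (rule Re_nonneg_if_norm_1_minus_le)
        have "norm (z powi k - z powi m) < 1" using k z by (auto simp: Z_nbhd_def)
        then show "norm (1 - z powi (k - m)) \<le> 1"
          using norm_power_int_diff[OF compactin_norm[OF K(1) z], of k m] by simp
      qed
      then have "(k - m) + m \<in> U" using K(2) by blast
      then show "k \<in> U" by simp
    qed
    then show "\<exists>K \<epsilon>. compactin X K \<and> 0 < \<epsilon> \<and> Z_nbhd K \<epsilon> m \<subseteq> U"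
      using K(1) zero_less_one by blast
  qed
qed

end

section \<open>Minkowski's inequality for series\<close>

text \<open>For positive arguments this is convexity of the power function. If one argument is 0, it
  reduces to (s u)^p \<le> s u^p, which holds because s^p \<le> s on [0, 1].\<close>

lemma powr_convex_nonneg:
  fixes x y t p :: real
  assumes "1 \<le> p" "0 \<le> x" "0 \<le> y" "0 \<le> t" "t \<le> 1"
  shows "(t * x + (1 - t) * y) powr p \<le> t * x powr p + (1 - t) * y powr p"
proof -
  have scale: "(s * u) powr p \<le> s * u powr p" if "0 \<le> s" "s \<le> 1" "0 \<le> u" for s u :: real
  proof -
    have "s powr p \<le> s powr 1" using that assms(1) by (intro powr_mono') auto
    then have "s powr p * u powr p \<le> s * u powr p" using that by (intro mult_right_mono) auto
    then show ?thesis by (simp add: powr_mult)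
  qed
  consider "x = 0" | "y = 0" | "0 < x" "0 < y" using assms by fastforce
  then show ?thesis
  proof cases
    case 1
    then show ?thesis using scale[of "1 - t" y] assms by simp
  next
    case 2
    then show ?thesis using scale[of t x] assms by simp
  next
    case 3
    then show ?thesis using convex_onD[OF powr_convex[OF assms(1)], of t y x] assms
      by (simp add: add.commute)
  qed
qed

text \<open>(x n + y n) / (A + B) is the convex combination of x n / A and y n / B with weight A /
  (A + B); convexity is applied termwise and summed.\<close>

lemma Minkowski_suminf_aux:
  fixes x y :: "nat \<Rightarrow> real"
  assumes p: "1 \<le> p" and nonneg: "\<And>n. 0 \<le> x n" "\<And>n. 0 \<le> y n"
    and sx: "summable (\<lambda>n. x n powr p)" and sy: "summable (\<lambda>n. y n powr p)"
    and A: "0 < A" "(\<Sum>n. x n powr p) \<le> A powr p" and B: "0 < B" "(\<Sum>n. y n powr p) \<le> B powr p"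
  shows "summable (\<lambda>n. (x n + y n) powr p) \<and> (\<Sum>n. (x n + y n) powr p) \<le> (A + B) powr p"
proof -
  define t where "t = A / (A + B)"
  define u where "u n = (A + B) powr p * (t / A powr p * x n powr p + (1 - t) / B powr p * y n powr p)" for n
  have t: "0 \<le> t" "t \<le> 1" using A(1) B(1) by (auto simp: t_def)
  have le: "(x n + y n) powr p \<le> u n" for n
  proof -
    have "A + B \<noteq> 0" using A(1) B(1) by simp
    then have "1 - t = B / (A + B)" by (simp add: t_def diff_divide_eq_iff)
    then have "t * (x n / A) = x n / (A + B)" "(1 - t) * (y n / B) = y n / (A + B)"
      using A(1) B(1) by (simp_all add: t_def)
    then have "x n + y n = (A + B) * (t * (x n / A) + (1 - t) * (y n / B))"
      using \<open>A + B \<noteq> 0\<close> by (simp add: distrib_left)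
    then have "(x n + y n) powr p = (A + B) powr p * (t * (x n / A) + (1 - t) * (y n / B)) powr p"
      by (simp add: powr_mult)
    also have "\<dots> \<le> (A + B) powr p * (t * (x n / A) powr p + (1 - t) * (y n / B) powr p)"
      using p nonneg A B t by (intro mult_left_mono powr_convex_nonneg) auto
    also have "\<dots> = u n" using nonneg A B by (simp add: u_def powr_divide)
    finally show ?thesis .
  qed
  have su: "summable u" unfolding u_def by (intro summable_mult summable_add sx sy)
  have s: "summable (\<lambda>n. (x n + y n) powr p)"
    by (rule summable_comparison_test'[OF su, of 0]) (use le in auto)
  have "(\<Sum>n. (x n + y n) powr p) \<le> suminf u" by (rule suminf_le[OF le s su])
  also have "suminf u = (A + B) powr p * (t / A powr p * (\<Sum>n. x n powr p) + (1 - t) / B powr p * (\<Sum>n. y n powr p))"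
    unfolding u_def by (rule sums_unique[symmetric]) (intro sums_mult sums_add summable_sums sx sy)
  also have "\<dots> \<le> (A + B) powr p * (t / A powr p * A powr p + (1 - t) / B powr p * B powr p)"
    using A B t by (intro mult_left_mono add_mono) auto
  also have "\<dots> = (A + B) powr p" using A B by simp
  finally show ?thesis using s by blast
qed

lemma Minkowski_suminf:
  fixes x y :: "nat \<Rightarrow> real"
  assumes p: "1 \<le> p" and nonneg: "\<And>n. 0 \<le> x n" "\<And>n. 0 \<le> y n"
    and sx: "summable (\<lambda>n. x n powr p)" and sy: "summable (\<lambda>n. y n powr p)"
  shows "summable (\<lambda>n. (x n + y n) powr p)"
    and "(\<Sum>n. (x n + y n) powr p) powr (1 / p) \<le>
      (\<Sum>n. x n powr p) powr (1 / p) + (\<Sum>n. y n powr p) powr (1 / p)"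
proof -
  let ?A = "(\<Sum>n. x n powr p) powr (1 / p)" and ?B = "(\<Sum>n. y n powr p) powr (1 / p)"
  \<comment> \<open>The norms may vanish, so both are enlarged by \<epsilon> to get the positive A
    and B of the auxiliary lemma; \<epsilon> is arbitrary in the end.\<close>
  have *: "summable (\<lambda>n. (x n + y n) powr p) \<and>
      (\<Sum>n. (x n + y n) powr p) \<le> ((?A + \<epsilon>) + (?B + \<epsilon>)) powr p" if "0 < \<epsilon>" for \<epsilon>
  proof (rule Minkowski_suminf_aux[OF p nonneg sx sy])
    have root: "S \<le> (S powr (1 / p) + \<epsilon>) powr p" if "0 \<le> S" for S :: real
    proof -
      have "S = (S powr (1 / p)) powr p" using that p by (simp add: powr_powr)
      also have "\<dots> \<le> (S powr (1 / p) + \<epsilon>) powr p" using p \<open>0 < \<epsilon>\<close> by (intro powr_mono2) auto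
      finally show ?thesis .
    qed
    show "(\<Sum>n. x n powr p) \<le> (?A + \<epsilon>) powr p" "(\<Sum>n. y n powr p) \<le> (?B + \<epsilon>) powr p"
      using sx sy by (auto intro!: root suminf_nonneg)
  qed (use that in \<open>auto intro: add_nonneg_pos\<close>)
  show s: "summable (\<lambda>n. (x n + y n) powr p)" using *[of 1] by simp
  show "(\<Sum>n. (x n + y n) powr p) powr (1 / p) \<le> ?A + ?B"
  proof (rule field_le_epsilon)
    fix \<epsilon> :: real assume "0 < \<epsilon>"
    then have "(\<Sum>n. (x n + y n) powr p) \<le> (?A + ?B + \<epsilon>) powr p"
      using *[of "\<epsilon> / 2"] by (simp add: algebra_simps)
    then have "(\<Sum>n. (x n + y n) powr p) powr (1 / p) \<le> ((?A + ?B + \<epsilon>) powr p) powr (1 / p)"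
      using s p by (intro powr_mono2 suminf_nonneg) auto
    also have "\<dots> = ?A + ?B + \<epsilon>" using p \<open>0 < \<epsilon>\<close> by (simp add: powr_powr)
    finally show "(\<Sum>n. (x n + y n) powr p) powr (1 / p) \<le> ?A + ?B + \<epsilon>" .
  qed
qed

section \<open>The groups \<open>G\<^sub>p\<close> and \<open>G\<^sub>0\<close>\<close>

context divisibility_chain
begin

lemma root_of_unity_in_Q:
  assumes "norm w = 1" "w powi g K = 1"
  shows "w \<in> Q"
proof -
  have "cis (of_int (g K) * Arg w) = cis (Arg w) powi g K" by (simp only: cis_power_int)
  also have "\<dots> = cis 0" using circle_eq_cis_Arg[OF assms(1)] assms(2) by simp
  finally have "\<exists>i::int. of_int (g K) * Arg w = 0 + 2 * pi * i" by (rule cis_eq_imp)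
  then obtain i :: int where "of_int (g K) * Arg w = 2 * pi * i" by auto
  then have "Arg w = 2 * pi * i / g K" using g_pos[of K] by (simp add: field_simps)
  then have "w = e K powi i" using circle_eq_cis_Arg[OF assms(1)] by (simp add: e_powi)
  then show ?thesis by simp
qed

text \<open>With s the argument of z^(g K), the point u = exp(i s / g K) has the same g K-th power
  as z, so w = z / u is a g K-th root of unity. From K on, u and z have the same g n-th powers;
  below K the angle s g n / g K decays geometrically as n decreases.\<close>

lemma Q_approximation:
  assumes z: "norm z = 1"
  obtains w where "w \<in> Q" "\<And>n. K \<le> n \<Longrightarrow> (z * inverse w) powi g n = z powi g n"
    "\<And>n. n \<le> K \<Longrightarrow> norm (1 - (z * inverse w) powi g n) \<le> 2 * norm (1 - z powi g K) * (1 / 2) ^ (K - n)"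
proof -
  define s where "s = Arg (z powi g K)"
  define u where "u = cis (s / g K)"
  define w where "w = z * inverse u"
  have zs: "z powi g K = cis s" unfolding s_def by (rule circle_eq_cis_Arg[OF norm_power_int_1[OF z]])
  have u: "norm u = 1" "u powi g K = cis s" by (simp_all add: u_def cis_power_int)
  have nz: "z \<noteq> 0" "u \<noteq> 0" using z u by auto
  have w1: "norm w = 1" by (simp add: w_def norm_mult norm_inverse z u)
  have wK: "w powi g K = 1"
    by (simp add: w_def power_int_mult_distrib power_int_inverse zs u cis_mult)
  have zw: "z * inverse w = u" using nz by (simp add: w_def)
  show thesis
  proof
    show "w \<in> Q" by (rule root_of_unity_in_Q[OF w1 wK])
    fix n
    { assume "K \<le> n"
      then obtain q where q: "g n = g K * q" using g_dvd by (blast elim: dvdE)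
      have "w powi g n = 1" by (simp add: q power_int_mult wK)
      then show "(z * inverse w) powi g n = z powi g n"
        by (simp add: power_int_mult_distrib power_int_inverse) }
    { assume n: "n \<le> K"
      have "u powi g n = cis (s * (g n / g K))" by (simp add: u_def cis_power_int mult.commute)
      then have "norm (1 - u powi g n) \<le> \<bar>s\<bar> * (g n / g K)"
        using norm_1_minus_cis_le[of "s * (g n / g K)"] g_pos[of n] g_pos[of K] by (simp add: abs_mult)
      also have "\<dots> \<le> (2 * norm (1 - z powi g K)) * (1 / 2) ^ (K - n)"
      proof (intro mult_mono g_quotient_le n)
        show "\<bar>s\<bar> \<le> 2 * norm (1 - z powi g K)"
          unfolding zs by (rule abs_le_norm_1_minus_cis) (use Arg_bounded[of "z powi g K"] in \<open>auto simp: s_def\<close>)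
      qed (use g_pos[of n] g_pos[of K] in auto)
      finally show "norm (1 - (z * inverse w) powi g n) \<le> 2 * norm (1 - z powi g K) * (1 / 2) ^ (K - n)"
        by (simp only: zw) }
  qed
qed

lemma norm_1_minus_powi_mult_le:
  fixes z w :: complex
  assumes "norm z = 1" "norm w = 1"
  shows "norm (1 - (z * w) powi m) \<le> norm (1 - z powi m) + norm (1 - w powi m)"
  using norm_1_minus_mult_le[OF norm_power_int_1[OF assms(1)], of m "w powi m"]
  by (simp add: power_int_mult_distrib)

lemma norm_1_minus_powi_inverse:
  fixes z :: complex
  assumes "norm z = 1"
  shows "norm (1 - inverse z powi m) = norm (1 - z powi m)"
  using norm_1_minus_inverse[OF norm_power_int_1[OF assms]] by (simp add: power_int_inverse)

lemma Gp_norm_psum: "Gp_norm \<gamma> p z = psum p z powr (1 / p)"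
  by (simp add: Gp_norm_def psum_def)

lemma psum_nonneg:
  assumes "summable (\<lambda>n. norm (1 - z powi g n) powr p)"
  shows "0 \<le> psum p z"
  unfolding psum_def by (rule suminf_nonneg[OF assms]) simp

lemma term_le_psum:
  assumes "summable (\<lambda>n. norm (1 - z powi g n) powr p)"
  shows "norm (1 - z powi g n) powr p \<le> psum p z"
  unfolding psum_def using sum_le_suminf[OF assms, of "{n}"] by simp

lemma norm_le_Gp_norm:
  assumes "summable (\<lambda>n. norm (1 - z powi g n) powr p)" "1 < p"
  shows "norm (1 - z powi g n) \<le> Gp_norm \<gamma> p z"
proof -
  have "norm (1 - z powi g n) = (norm (1 - z powi g n) powr p) powr (1 / p)"
    using assms(2) by (simp add: powr_powr)
  also have "\<dots> \<le> psum p z powr (1 / p)"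
    using assms(2) term_le_psum[OF assms(1)] by (intro powr_mono2) auto
  finally show ?thesis by (simp add: Gp_norm_psum)
qed

lemma Gp_norm_less:
  assumes "psum p z < \<eta> powr p" "0 < \<eta>" "1 < p" "summable (\<lambda>n. norm (1 - z powi g n) powr p)"
  shows "Gp_norm \<gamma> p z < \<eta>"
proof -
  have "psum p z powr (1 / p) < (\<eta> powr p) powr (1 / p)"
    using assms psum_nonneg[OF assms(4)] by (intro powr_less_mono2) auto
  then show ?thesis using assms by (simp add: Gp_norm_psum powr_powr)
qed

lemma circle_norm_group_Gp:
  assumes p: "1 < p"
  shows "circle_norm_group \<gamma> b (Gp_set \<gamma> p) (Gp_norm \<gamma> p) p"
proof unfold_locales
  note mem = Gp_set_def[of \<gamma> p]
  show "norm z = 1" if "z \<in> Gp_set \<gamma> p" for z using that by (simp add: mem)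
  show "Q \<subseteq> Gp_set \<gamma> p" using norm_Q summable_Q by (auto simp: mem)
  show "Gp_norm \<gamma> p 1 = 0" by (simp add: Gp_norm_def)
  show "inverse z \<in> Gp_set \<gamma> p" "Gp_norm \<gamma> p (inverse z) = Gp_norm \<gamma> p z" if "z \<in> Gp_set \<gamma> p" for z
    using that norm_1_minus_powi_inverse[of z] by (auto simp: mem Gp_norm_def norm_inverse)
  show "norm (1 - z powi g n) \<le> Gp_norm \<gamma> p z" if "z \<in> Gp_set \<gamma> p" for z n
    using that norm_le_Gp_norm p by (simp add: mem)
  show "1 < p" by fact
  show "\<exists>\<delta>>0. \<forall>z\<in>Q. psum p z < \<delta> \<longrightarrow> Gp_norm \<gamma> p z < \<eta>" if "0 < \<eta>" for \<eta>
    using that Gp_norm_less p summable_Q by (intro exI[of _ "\<eta> powr p"]) auto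
  show "(\<lambda>n. z powi g n) \<longlonglongrightarrow> 1" if "z \<in> Gp_set \<gamma> p" for z
  proof -
    have "(\<lambda>n. norm (1 - z powi g n) powr p) \<longlonglongrightarrow> 0"
      using that by (intro summable_LIMSEQ_zero) (simp add: mem)
    then have "(\<lambda>n. (norm (1 - z powi g n) powr p) powr (1 / p)) \<longlonglongrightarrow> 0"
      by (rule tendsto_zero_powrI[where g = "\<lambda>_. 1 / p" and b = "1 / p"]) (use p in auto)
    then have "(\<lambda>n. norm (1 - z powi g n)) \<longlonglongrightarrow> 0" using p by (simp add: powr_powr)
    then have "(\<lambda>n. 1 - z powi g n) \<longlonglongrightarrow> 0" by (rule tendsto_norm_zero_cancel)
    from tendsto_diff[OF tendsto_const[of 1] this] show ?thesis by simp
  qed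
  show "z * w \<in> Gp_set \<gamma> p" "Gp_norm \<gamma> p (z * w) \<le> Gp_norm \<gamma> p z + Gp_norm \<gamma> p w"
    if "z \<in> Gp_set \<gamma> p" "w \<in> Gp_set \<gamma> p" for z w
  proof -
    have zw: "norm z = 1" "norm w = 1" using that by (auto simp: mem)
    let ?x = "\<lambda>n. norm (1 - z powi g n)" and ?y = "\<lambda>n. norm (1 - w powi g n)"
    have M: "summable (\<lambda>n. (?x n + ?y n) powr p)"
      "(\<Sum>n. (?x n + ?y n) powr p) powr (1 / p) \<le>
        (\<Sum>n. ?x n powr p) powr (1 / p) + (\<Sum>n. ?y n powr p) powr (1 / p)"
      using Minkowski_suminf[of p ?x ?y] that p by (auto simp: mem)
    have le: "norm (1 - (z * w) powi g n) powr p \<le> (?x n + ?y n) powr p" for n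
      using p norm_1_minus_powi_mult_le[OF zw] by (intro powr_mono2) auto
    have s: "summable (\<lambda>n. norm (1 - (z * w) powi g n) powr p)"
      by (rule summable_comparison_test'[OF M(1), of 0]) (use le in auto)
    then show "z * w \<in> Gp_set \<gamma> p" using zw by (simp add: mem norm_mult)
    have "psum p (z * w) \<le> (\<Sum>n. (?x n + ?y n) powr p)"
      unfolding psum_def by (rule suminf_le[OF le s M(1)])
    then have "Gp_norm \<gamma> p (z * w) \<le> (\<Sum>n. (?x n + ?y n) powr p) powr (1 / p)"
      unfolding Gp_norm_psum using p psum_nonneg[OF s] by (intro powr_mono2) auto
    then show "Gp_norm \<gamma> p (z * w) \<le> Gp_norm \<gamma> p z + Gp_norm \<gamma> p w"
      using M(2) by (simp add: Gp_norm_def)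
  qed
  show "\<exists>w\<in>Q. Gp_norm \<gamma> p (z * inverse w) < \<eta>" if z: "z \<in> Gp_set \<gamma> p" and \<eta>: "0 < \<eta>" for z \<eta>
  proof -
    let ?f = "\<lambda>n. norm (1 - z powi g n) powr p"
    have sum: "summable ?f" and z1: "norm z = 1" using z by (auto simp: mem)
    define \<epsilon> where "\<epsilon> = \<eta> powr p / 2"
    have \<epsilon>: "0 < \<epsilon>" using \<eta> by (simp add: \<epsilon>_def)
    obtain K1 where K1: "\<And>n. K1 \<le> n \<Longrightarrow> norm (\<Sum>i. ?f (i + n)) < \<epsilon>"
      using suminf_exist_split[OF \<epsilon> sum] by blast
    \<comment> \<open>The part of the sum below K will be at most 2 D^p = 2 * 2^p *
      \<open>?f K\<close>, and this threshold keeps it below \<epsilon>.\<close>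
    have "eventually (\<lambda>n. ?f n < \<epsilon> / (2 * 2 powr p)) sequentially"
      using \<epsilon> by (intro order_tendstoD(2)[OF summable_LIMSEQ_zero[OF sum]]) auto
    then obtain K2 where K2: "\<And>n. K2 \<le> n \<Longrightarrow> ?f n < \<epsilon> / (2 * 2 powr p)"
      by (auto simp: eventually_sequentially)
    define K where "K = max K1 K2"
    define D where "D = 2 * norm (1 - z powi g K)"
    obtain w where w: "w \<in> Q" "\<And>n. K \<le> n \<Longrightarrow> (z * inverse w) powi g n = z powi g n"
      "\<And>n. n \<le> K \<Longrightarrow> norm (1 - (z * inverse w) powi g n) \<le> D * (1 / 2) ^ (K - n)"
      using Q_approximation[OF z1, of K] unfolding D_def by metis
    let ?h = "\<lambda>n. norm (1 - (z * inverse w) powi g n) powr p"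
    have shift: "?h (n + K) = ?f (n + K)" for n using w(2)[of "n + K"] by simp
    have "summable (\<lambda>n. ?h (n + K))"
      unfolding shift by (rule summable_ignore_initial_segment[OF sum])
    then have sh: "summable ?h" using summable_iff_shift[of ?h K] by simp
    have "(\<Sum>n<K. ?h n) \<le> (\<Sum>n<K. D powr p * (1 / 2) ^ (K - n))"
    proof (rule sum_mono)
      fix n assume "n \<in> {..<K}"
      then have "?h n \<le> (D * (1 / 2) ^ (K - n)) powr p"
        using p w(3)[of n] by (intro powr_mono2) auto
      also have "\<dots> = D powr p * ((1 / 2) ^ (K - n)) powr p" by (rule powr_mult)
      also have "((1 / 2) ^ (K - n)) powr p \<le> ((1 / 2 :: real) ^ (K - n)) powr 1"
        using p by (intro powr_mono') (auto simp: power_le_one)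
      finally show "?h n \<le> D powr p * (1 / 2) ^ (K - n)" by (simp add: mult_left_mono)
    qed
    also have "\<dots> = D powr p * (\<Sum>k\<in>(\<lambda>n. K - n) ` {..<K}. (1 / 2) ^ k)"
      by (subst sum.reindex) (auto simp: inj_on_def sum_distrib_left)
    also have "\<dots> \<le> D powr p * 2" by (intro mult_left_mono sum_half_power_le) auto
    also have "\<dots> < \<epsilon>"
      using K2[of K] by (simp add: D_def powr_mult K_def field_simps)
    finally have "(\<Sum>n<K. ?h n) < \<epsilon>" .
    moreover have "(\<Sum>n. ?h (n + K)) < \<epsilon>" unfolding shift using K1[of K] by (simp add: K_def)
    ultimately have "psum p (z * inverse w) < \<eta> powr p"
      unfolding psum_def suminf_split_initial_segment[OF sh, of K] by (simp add: \<epsilon>_def)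
    then show ?thesis using Gp_norm_less[OF _ \<eta> p sh] w(1) by blast
  qed
qed

lemma bdd_above_G0:
  fixes z :: complex
  assumes "norm z = 1" shows "bdd_above (range (\<lambda>n. norm (1 - z powi g n)))"
proof (rule bdd_aboveI2)
  show "norm (1 - z powi g n) \<le> 2" for n
    using norm_triangle_ineq4[of 1 "z powi g n"] norm_power_int_1[OF assms] by simp
qed

lemma norm_le_G0_norm: "norm z = 1 \<Longrightarrow> norm (1 - z powi g n) \<le> G0_norm \<gamma> z"
  unfolding G0_norm_def by (rule cSUP_upper[OF UNIV_I bdd_above_G0])

lemma G0_norm_le: "(\<And>n. norm (1 - z powi g n) \<le> C) \<Longrightarrow> G0_norm \<gamma> z \<le> C"
  unfolding G0_norm_def by (rule cSUP_least) auto

text \<open>The sup norm is dominated by every p-norm, so it is small where the sum of squares is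
  small. The exponent 2 is one choice of q > 1.\<close>

lemma circle_norm_group_G0: "circle_norm_group \<gamma> b (G0_set \<gamma>) (G0_norm \<gamma>) 2"
proof unfold_locales
  note mem = G0_set_def[of \<gamma>]
  show "norm z = 1" "(\<lambda>n. z powi g n) \<longlonglongrightarrow> 1" if "z \<in> G0_set \<gamma>" for z using that by (auto simp: mem)
  show "Q \<subseteq> G0_set \<gamma>"
  proof
    fix z assume z: "z \<in> Q"
    obtain K where "\<forall>n\<ge>K. z powi g n = 1" using Q_powi_g_eventually[OF z] by blast
    then have "(\<lambda>n. z powi g n) \<longlonglongrightarrow> 1"
      by (intro tendsto_eventually) (auto simp: eventually_sequentially)
    then show "z \<in> G0_set \<gamma>" using norm_Q[OF z] by (simp add: mem)
  qed
  show "G0_norm \<gamma> 1 = 0" by (simp add: G0_norm_def)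
  show "inverse z \<in> G0_set \<gamma>" if z: "z \<in> G0_set \<gamma>" for z
  proof -
    have "(\<lambda>n. inverse (z powi g n)) \<longlonglongrightarrow> inverse 1"
      using z by (intro tendsto_inverse) (auto simp: mem)
    then show ?thesis using z by (simp add: mem norm_inverse power_int_inverse)
  qed
  show "G0_norm \<gamma> (inverse z) = G0_norm \<gamma> z" if "z \<in> G0_set \<gamma>" for z
    using that norm_1_minus_powi_inverse[of z] by (simp add: mem G0_norm_def)
  show "norm (1 - z powi g n) \<le> G0_norm \<gamma> z" if "z \<in> G0_set \<gamma>" for z n
    using that norm_le_G0_norm by (simp add: mem)
  show "z * w \<in> G0_set \<gamma>" if "z \<in> G0_set \<gamma>" "w \<in> G0_set \<gamma>" for z w
  proof -
    have "(\<lambda>n. z powi g n * w powi g n) \<longlonglongrightarrow> 1 * 1"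
      using that by (intro tendsto_mult) (auto simp: mem)
    then show ?thesis using that by (simp add: mem norm_mult power_int_mult_distrib)
  qed
  show "G0_norm \<gamma> (z * w) \<le> G0_norm \<gamma> z + G0_norm \<gamma> w" if "z \<in> G0_set \<gamma>" "w \<in> G0_set \<gamma>" for z w
  proof (rule G0_norm_le)
    fix n
    have zw: "norm z = 1" "norm w = 1" using that by (auto simp: mem)
    show "norm (1 - (z * w) powi g n) \<le> G0_norm \<gamma> z + G0_norm \<gamma> w"
      using norm_1_minus_powi_mult_le[OF zw, of "g n"] norm_le_G0_norm[OF zw(1), of n]
        norm_le_G0_norm[OF zw(2), of n] by linarith
  qed
  show "\<exists>\<delta>>0. \<forall>z\<in>Q. psum 2 z < \<delta> \<longrightarrow> G0_norm \<gamma> z < \<eta>" if "0 < \<eta>" for \<eta>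
  proof (intro exI[of _ "(\<eta> / 2) powr 2"] conjI ballI impI)
    fix z assume z: "z \<in> Q" "psum 2 z < (\<eta> / 2) powr 2"
    have "G0_norm \<gamma> z \<le> Gp_norm \<gamma> 2 z"
      using norm_le_Gp_norm[OF summable_Q[OF z(1)], of 2] by (intro G0_norm_le) auto
    also have "\<dots> < \<eta> / 2" using Gp_norm_less[OF z(2) _ _ summable_Q[OF z(1)]] that by simp
    finally show "G0_norm \<gamma> z < \<eta>" using that by simp
  qed (use that in auto)
  show "\<exists>w\<in>Q. G0_norm \<gamma> (z * inverse w) < \<eta>" if z: "z \<in> G0_set \<gamma>" and \<eta>: "0 < \<eta>" for z \<eta>
  proof -
    have z1: "norm z = 1" using z by (simp add: mem)
    have "(\<lambda>n. norm (1 - z powi g n)) \<longlonglongrightarrow> norm (1 - 1 :: complex)"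
      using z by (intro tendsto_intros) (simp add: mem)
    then have "eventually (\<lambda>n. norm (1 - z powi g n) < \<eta> / 4) sequentially"
      using \<eta> by (intro order_tendstoD(2)) auto
    then obtain K where K: "\<And>n. K \<le> n \<Longrightarrow> norm (1 - z powi g n) < \<eta> / 4"
      by (auto simp: eventually_sequentially)
    obtain w where w: "w \<in> Q" "\<And>n. K \<le> n \<Longrightarrow> (z * inverse w) powi g n = z powi g n"
      "\<And>n. n \<le> K \<Longrightarrow> norm (1 - (z * inverse w) powi g n) \<le> 2 * norm (1 - z powi g K) * (1 / 2) ^ (K - n)"
      using Q_approximation[OF z1, of K] by metis
    have "G0_norm \<gamma> (z * inverse w) \<le> \<eta> / 2"
    proof (rule G0_norm_le)
      fix n
      show "norm (1 - (z * inverse w) powi g n) \<le> \<eta> / 2"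
      proof (cases "K \<le> n")
        case True
        then show ?thesis using w(2) K[of n] \<eta> by simp
      next
        case False
        then have "norm (1 - (z * inverse w) powi g n) \<le> 2 * norm (1 - z powi g K) * (1 / 2) ^ (K - n)"
          using w(3) by simp
        also have "\<dots> \<le> 2 * norm (1 - z powi g K) * 1"
          by (intro mult_left_mono power_le_one) auto
        finally show ?thesis using K[of K] by simp
      qed
    qed
    then show ?thesis using w(1) \<eta> by (intro bexI[of _ w]) auto
  qed
qed simp

text \<open>Elements with uniformly small but many nonzero digits separate the sup norm from the
  \<open>p\<close>-norm.\<close>

lemma sup_small_psum_large:
  assumes c: "0 < c" "c \<le> 1 / 4" and p: "1 < p"
  shows "\<exists>z\<in>Q. (\<forall>n. norm (1 - z powi g n) \<le> 4 * pi * c) \<and> 1 \<le> psum p z"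
proof -
  \<comment> \<open>Beyond k0 one has c * b k \<ge> 2, so rounding down loses at most half.\<close>
  obtain k0 where k0: "\<And>k. k0 \<le> k \<Longrightarrow> 2 / c \<le> b k" using b_ge_eventually[of "2 / c"] by blast
  obtain L :: nat where L: "1 / (pi * c / 2) powr p < L" using reals_Archimedean2 by blast
  define F where "F = {k0..<k0 + L}"
  define \<epsilon> where "\<epsilon> k = \<lfloor>c * b k\<rfloor>" for k
  define z where "z = test_element F \<epsilon>"
  have F: "finite F" by (simp add: F_def)
  have b0: "0 < b k" for k using b_ge_2[of k] by simp
  have \<epsilon>0: "0 \<le> \<epsilon> k" for k using c(1) b0[of k] by (simp add: \<epsilon>_def)
  have \<epsilon>_le: "\<bar>real_of_int (\<epsilon> k)\<bar> \<le> c * b k" for k using \<epsilon>0[of k] by (simp add: \<epsilon>_def)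
  have \<epsilon>_ge: "c / 2 * b k \<le> \<epsilon> k" if "k \<in> F" for k
  proof -
    have "2 \<le> c * b k" using k0[of k] that c(1) by (simp add: F_def field_simps)
    then show ?thesis unfolding \<epsilon>_def by linarith
  qed
  have lower: "pi * c / 2 \<le> norm (1 - z powi g n)" if n: "n \<in> F" for n
  proof -
    let ?f = "\<lambda>k. 2 * pi * \<epsilon> k * g n / g (Suc k)"
    have "pi * c = 2 * pi * (c / 2 * b n) / b n" using b0[of n] by simp
    also have "\<dots> \<le> 2 * pi * \<epsilon> n / b n"
      using \<epsilon>_ge[OF n] b0[of n] by (intro divide_right_mono mult_left_mono) auto
    also have "\<dots> = ?f n" using g_pos[of n] by (simp add: gamma_Suc)
    also have "\<dots> \<le> tail_angle F \<epsilon> n"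
      unfolding tail_angle_def using n F \<epsilon>0 g_pos[THEN less_imp_le]
      by (intro member_le_sum) (auto intro!: divide_nonneg_nonneg mult_nonneg_nonneg)
    finally have ge: "pi * c \<le> tail_angle F \<epsilon> n" .
    have "\<bar>tail_angle F \<epsilon> n\<bar> \<le> 2 * pi * c * tail_weight F n"
      using tail_angle_le[OF F \<epsilon>_le] c by simp
    \<comment> \<open>As c \<le> 1/4, the angle is at most \<pi> and does not wrap around, so it is
      at most twice the chord.\<close>
    also have "\<dots> \<le> 2 * pi * (1 / 4) * 2"
      using tail_weight_le[OF F] tail_weight_nonneg c by (intro mult_mono) auto
    finally have "\<bar>tail_angle F \<epsilon> n\<bar> \<le> 2 * norm (1 - z powi g n)"
      unfolding z_def test_element_powi_g[OF F] by (intro abs_le_norm_1_minus_cis) simp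
    then show ?thesis using ge by linarith
  qed
  have "1 \<le> L * (pi * c / 2) powr p" using L c(1) by (simp add: divide_less_eq less_imp_le)
  also have "\<dots> = (\<Sum>n\<in>F. (pi * c / 2) powr p)" by (simp add: F_def)
  also have "\<dots> \<le> (\<Sum>n\<in>F. norm (1 - z powi g n) powr p)"
    using lower c p by (intro sum_mono powr_mono2) auto
  also have "\<dots> \<le> psum p z"
    unfolding psum_def z_def by (intro sum_le_suminf summable_Q test_element_in_Q F) auto
  finally have "1 \<le> psum p z" .
  moreover have "norm (1 - z powi g n) \<le> 4 * pi * c" for n
    unfolding z_def using norm_test_element_le[OF F \<epsilon>_le] c(1) by simp
  ultimately show ?thesis using test_element_in_Q z_def by blast
qed

end

section \<open>The dual of the integers\<close>

context circle_norm_group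
begin

text \<open>A failing sequence in \<open>M\<close> is a null sequence, hence compact up to its limit; compactness
  of \<open>K\<close> in the topology of uniform convergence on it then gives the contradiction.\<close>

lemma compactin_Z_top_equicontinuous:
  assumes K: "compactin Z_top K" and \<epsilon>: "0 < \<epsilon>"
  shows "\<exists>\<eta>>0. \<forall>u\<in>M. N u < \<eta> \<longrightarrow> (\<forall>m\<in>K. norm (1 - u powi m) < \<epsilon>)"
proof (rule ccontr)
  assume neg: "\<not> ?thesis"
  have "\<exists>u m. u \<in> M \<and> N u < 1 / real (Suc n) \<and> m \<in> K \<and> \<epsilon> \<le> norm (1 - u powi m)" for n
  proof (rule ccontr)
    assume "\<nexists>u m. u \<in> M \<and> N u < 1 / real (Suc n) \<and> m \<in> K \<and> \<epsilon> \<le> norm (1 - u powi m)"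
    then have "\<forall>u\<in>M. N u < 1 / real (Suc n) \<longrightarrow> (\<forall>m\<in>K. norm (1 - u powi m) < \<epsilon>)"
      by (simp add: not_le)
    moreover have "0 < 1 / real (Suc n)" by simp
    ultimately show False using neg by blast
  qed
  then obtain u m where u: "\<And>n. u n \<in> M" "\<And>n. N (u n) < 1 / real (Suc n)"
    and m: "\<And>n. m n \<in> K" "\<And>n. \<epsilon> \<le> norm (1 - u n powi m n)" by metis
  define C where "C = insert 1 (\<Union>n. u ` {..<n})"
  have C: "compactin X C"
    unfolding C_def by (rule compactin_null_sequence) (use u in \<open>auto simp: less_Suc_eq\<close>)
  have uC: "u n \<in> C" for n unfolding C_def by (auto intro!: exI[of _ "Suc n"])
  have "\<forall>k. \<exists>W. openin Z_top W \<and> k \<in> W \<and> W \<subseteq> Z_nbhd C (\<epsilon> / 2) k"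
    using Z_nbhd_contains_open[OF C] \<epsilon> by simp
  then obtain W where W: "\<And>k. openin Z_top (W k)" "\<And>k. k \<in> W k" "\<And>k. W k \<subseteq> Z_nbhd C (\<epsilon> / 2) k"
    by metis
  have "\<exists>\<F>. finite \<F> \<and> \<F> \<subseteq> W ` K \<and> K \<subseteq> \<Union>\<F>"
    using W(1,2) by (intro compactinD[OF K]) auto
  then obtain F where F: "finite F" "F \<subseteq> K" "K \<subseteq> \<Union>(W ` F)"
    by (metis finite_subset_image)
  \<comment> \<open>R bounds the finitely many exponents in F, so for large n all of them give
    powers of \<open>u n\<close> near 1. The exponent \<open>m n\<close> lies in some
    \<open>W k\<close> and its power differs by less than \<epsilon> / 2 from that of k on C, which
    contains \<open>u n\<close>.\<close>
  define R where "R = (\<Sum>k\<in>F. \<bar>k\<bar>)"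
  have R: "\<bar>k\<bar> \<le> R" if "k \<in> F" for k
    unfolding R_def using F(1) that by (intro member_le_sum) auto
  have R0: "0 \<le> R" unfolding R_def by (intro sum_nonneg) auto
  obtain n where n: "2 * R / \<epsilon> < real n" using reals_Archimedean2 by blast
  obtain k where k: "k \<in> F" "m n \<in> W k" using m(1)[of n] F(3) by blast
  have "norm (1 - u n powi k) \<le> \<bar>of_int k\<bar> * norm (1 - u n)"
    by (rule norm_1_minus_power_int_le[OF M_norm[OF u(1)]])
  also have "\<dots> \<le> R * (1 / real (Suc n))"
    using R[OF k(1)] R0 norm_1_minus_le_N[OF u(1)[of n]] u(2)[of n] by (intro mult_mono) auto
  also have "\<dots> < \<epsilon> / 2" using n \<epsilon> R0 by (simp add: field_simps)
  finally have "norm (1 - u n powi k) < \<epsilon> / 2" .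
  moreover have "norm (u n powi m n - u n powi k) < \<epsilon> / 2"
    using W(3)[of k] k(2) uC[of n] by (auto simp: Z_nbhd_def)
  ultimately have "norm (1 - u n powi m n) < \<epsilon>"
    using norm_triangle_ineq4[of "1 - u n powi k" "u n powi m n - u n powi k"] by simp
  then show False using m(2)[of n] by simp
qed

text \<open>Uniform closeness on this single compact set is closeness in the sup norm, which later
  yields openness of the evaluation map.\<close>

lemma compactin_range_g: "compactin Z_top (insert 0 (range g))"
  using limitin_sequentially_offset[OF Z_top_limit, of 1]
  by (intro compactin_sequence_with_limit) (auto simp: topspace_Z_top)

lemma polar_ball_bounded:
  assumes "0 < \<eta>"
  shows "\<exists>B. \<forall>m. (\<forall>z\<in>M. N z < \<eta> \<longrightarrow> 0 \<le> Re (z powi m)) \<longrightarrow> m \<in> bounded_sums \<gamma> B"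
proof -
  obtain \<delta> where \<delta>: "\<delta> > 0" "\<forall>z\<in>Q. psum q z < \<delta> \<longrightarrow> N z < \<eta>" using N_small[OF assms] by blast
  obtain B where "\<And>m. (\<forall>z\<in>Q. psum q z < \<delta> \<longrightarrow> 0 \<le> Re (z powi m)) \<Longrightarrow> m \<in> bounded_sums \<gamma> B"
    using polar_bound[OF q \<delta>(1)] by blast
  then show ?thesis using \<delta>(2) Q_subset by blast
qed

end

text \<open>Together with \<open>M_limit\<close> and \<open>norm_le_N\<close>, the new assumptions
  say that M is G_0 and N is the sup norm.\<close>

locale circle_sup_group = circle_norm_group +
  assumes M_I: "\<And>z. norm z = 1 \<Longrightarrow> (\<lambda>n. z powi g n) \<longlonglongrightarrow> 1 \<Longrightarrow> z \<in> M"
    and N_le: "\<And>z C. z \<in> M \<Longrightarrow> (\<And>n. norm (1 - z powi g n) \<le> C) \<Longrightarrow> N z \<le> C"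
begin

lemma powi_in_characters:
  assumes "z \<in> M"
  shows "(powi) z \<in> characters integer_group Z_top"
proof -
  have z1: "norm z = 1" by (rule M_norm[OF assms])
  have K: "compactin X {z}" using assms by simp
  have "continuous_map Z_top Met_TC.mtopology ((powi) z)"
    unfolding Met_TC.continuous_map_to_metric
  proof (intro ballI allI impI)
    fix m and \<epsilon> :: real assume "0 < \<epsilon>"
    then obtain W where "openin Z_top W" "m \<in> W" "W \<subseteq> Z_nbhd {z} \<epsilon> m"
      using Z_nbhd_contains_open[OF K] by meson
    then show "\<exists>U. openin Z_top U \<and> m \<in> U \<and> (\<forall>k\<in>U. z powi k \<in> Met_TC.mball (z powi m) \<epsilon>)"
      by (intro exI[of _ W]) (auto simp: Z_nbhd_def dist_norm norm_minus_commute)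
  qed
  then have "continuous_map Z_top (top_of_set (sphere 0 1)) ((powi) z)"
    by (auto simp: continuous_map_in_subtopology norm_power_int_1[OF z1])
  moreover have "(powi) z \<in> hom integer_group circle_group"
    using M_nonzero[OF assms] by (intro hom_circle_groupI) (auto simp: norm_power_int_1[OF z1] power_int_add)
  ultimately show ?thesis by (simp add: characters_def)
qed

text \<open>A character is determined by its value z at 1. Continuity and the convergence of
  \<gamma> to 0 force z^(\<gamma> n) to tend to 1, which is membership in G_0.\<close>

lemma characters_integer_group: "characters integer_group Z_top = (powi) ` M"
proof
  show "(powi) ` M \<subseteq> characters integer_group Z_top" using powi_in_characters by blast
  show "characters integer_group Z_top \<subseteq> (powi) ` M"
  proof
    fix \<phi> assume \<phi>: "\<phi> \<in> characters integer_group Z_top"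
    note \<phi>D = charactersD[OF \<phi>]
    have add: "\<phi> (m + k) = \<phi> m * \<phi> k" for m k using \<phi>D(3)[of m k] by simp
    have zero: "\<phi> 0 = 1" using character_one[OF \<phi>] group.is_monoid[OF group_integer_group] by simp
    define z where "z = \<phi> 1"
    have z: "norm z = 1" using \<phi>D(2)[of 1] by (simp add: z_def)
    then have z0: "z \<noteq> 0" by auto
    have nat: "\<phi> (int n) = z ^ n" for n
      by (induction n) (simp_all add: zero add z_def)
    have eq: "\<phi> m = z powi m" for m
    proof (cases "0 \<le> m")
      case True
      then show ?thesis using nat[of "nat m"] by (simp add: power_int_def)
    next
      case False
      have "\<phi> m * \<phi> (- m) = 1" using add[of m "- m"] zero by simp
      moreover have "\<phi> (- m) = z ^ nat (- m)" using nat[of "nat (- m)"] False by simp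
      ultimately have "\<phi> m = inverse (z ^ nat (- m))" by (metis inverse_unique mult.commute inverse_inverse_eq)
      then show ?thesis using False by (simp add: power_int_def power_inverse)
    qed
    have "limitin (top_of_set (sphere 0 1)) (\<phi> \<circ> \<gamma>) (\<phi> 0) sequentially"
      by (rule continuous_map_limit[OF \<phi>D(4) Z_top_limit])
    then have "(\<phi> \<circ> \<gamma>) \<longlonglongrightarrow> 1" by (simp add: limitin_subtopology zero)
    then have "(\<lambda>n. z powi g n) \<longlonglongrightarrow> 1"
      using LIMSEQ_Suc by (force simp: o_def eq)
    then have "z \<in> M" by (rule M_I[OF z])
    then show "\<phi> \<in> (powi) ` M" using eq by (intro image_eqI[of _ _ z]) auto
  qed
qed

text \<open>Continuity is the equicontinuity of a compact set of exponents. Openness uses the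
  compact set formed by 0 and the g n: characters uniformly close on it come from points close in
  the sup norm.\<close>

lemma evaluation_iso:
  "topological_group_iso G X (dual_group integer_group Z_top) (dual_topology integer_group Z_top) (powi)"
proof -
  let ?D = "dual_topology integer_group Z_top"
  have top: "topspace Z_top = carrier integer_group" by (simp add: topspace_Z_top)
  have inj: "inj_on (powi) M"
    by (rule inj_onI) (metis power_int_1_right)
  have "continuous_map X ?D (powi)"
    unfolding met.continuous_map_from_metric
  proof (intro conjI ballI allI impI)
    fix z W assume z: "z \<in> M" and "openin ?D W \<and> (powi) z \<in> W"
    then obtain K \<epsilon> where K: "compactin Z_top K" "0 < \<epsilon>" "uniform_nbhd integer_group Z_top K \<epsilon> ((powi) z) \<subseteq> W"
      using openin_dual_topology_iff[OF top, of W] by blast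
    obtain \<eta> where \<eta>: "\<eta> > 0" "\<And>u m. u \<in> M \<Longrightarrow> N u < \<eta> \<Longrightarrow> m \<in> K \<Longrightarrow> norm (1 - u powi m) < \<epsilon>"
      using compactin_Z_top_equicontinuous[OF K(1,2)] by blast
    have "(powi) w \<in> W" if w: "w \<in> M" "invariant_dist M N z w < \<eta>" for w
    proof -
      let ?u = "z * inverse w"
      have u: "?u \<in> M" "N ?u < \<eta>" using z w by (auto simp: invariant_dist_def M_mult M_inverse)
      have "norm (w powi m - z powi m) < \<epsilon>" if "m \<in> K" for m
      proof -
        have "norm (1 - z powi m / w powi m) = norm (z powi m - w powi m)"
          by (rule norm_1_minus_divide[OF norm_power_int_1[OF M_norm[OF w(1)]]])
        moreover have "z powi m / w powi m = ?u powi m"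
          by (simp add: power_int_divide_distrib divide_inverse[symmetric])
        ultimately show ?thesis using \<eta>(2)[OF u that] by (simp add: norm_minus_commute)
      qed
      then have "(powi) w \<in> uniform_nbhd integer_group Z_top K \<epsilon> ((powi) z)"
        using powi_in_characters[OF w(1)] by (simp add: uniform_nbhd_def)
      then show ?thesis using K(3) by blast
    qed
    then show "\<exists>r>0. \<forall>w. w \<in> M \<and> invariant_dist M N z w < r \<longrightarrow> (powi) w \<in> W"
      using \<eta>(1) by blast
  qed (use powi_in_characters in auto)
  moreover have "open_map X ?D (powi)"
    unfolding open_map_def
  proof (intro allI impI)
    fix U assume U: "openin X U"
    then have UM: "U \<subseteq> M" using openin_subset by fastforce
    show "openin ?D ((powi) ` U)"
      unfolding openin_dual_topology_iff[OF top]
    proof (intro conjI ballI)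
      show "(powi) ` U \<subseteq> characters integer_group Z_top" using UM powi_in_characters by blast
      fix \<phi> assume "\<phi> \<in> (powi) ` U"
      then obtain z where z: "z \<in> U" "\<phi> = (powi) z" by blast
      obtain r where r: "r > 0" "met.mball z r \<subseteq> U" using U z(1) unfolding met.openin_mtopology by blast
      have "uniform_nbhd integer_group Z_top (insert 0 (range g)) (r / 2) \<phi> \<subseteq> (powi) ` U"
      proof
        fix \<psi> assume \<psi>: "\<psi> \<in> uniform_nbhd integer_group Z_top (insert 0 (range g)) (r / 2) \<phi>"
        then obtain w where w: "w \<in> M" "\<psi> = (powi) w"
          by (auto simp: uniform_nbhd_def characters_integer_group)
        have "N (z * inverse w) \<le> r / 2"
        proof (rule N_le)
          show "z * inverse w \<in> M" using z(1) UM w(1) M_mult M_inverse by blast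
          fix n
          have "norm (1 - z powi g n / w powi g n) = norm (z powi g n - w powi g n)"
            by (rule norm_1_minus_divide[OF norm_power_int_1[OF M_norm[OF w(1)]]])
          moreover have "z powi g n / w powi g n = (z * inverse w) powi g n"
            by (simp add: power_int_divide_distrib divide_inverse[symmetric])
          moreover have "norm (w powi g n - z powi g n) < r / 2"
            using \<psi> by (auto simp: uniform_nbhd_def w(2) z(2))
          ultimately show "norm (1 - (z * inverse w) powi g n) \<le> r / 2"
            by (simp add: norm_minus_commute)
        qed
        then have "w \<in> met.mball z r"
          using z(1) UM w(1) r(1) by (auto simp: met.in_mball invariant_dist_def)
        then show "\<psi> \<in> (powi) ` U" using r(2) w(2) by blast
      qed
      then show "\<exists>K \<epsilon>. compactin Z_top K \<and> 0 < \<epsilon> \<and>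
          uniform_nbhd integer_group Z_top K \<epsilon> \<phi> \<subseteq> (powi) ` U"
        using compactin_range_g r(1) half_gt_zero by blast
    qed
  qed
  ultimately have "homeomorphic_map X ?D (powi)"
    using inj by (intro bijective_open_imp_homeomorphic_map) (auto simp: characters_integer_group)
  moreover have "(powi) (z * w) = (powi) z \<otimes>\<^bsub>dual_group integer_group Z_top\<^esub> (powi) w" for z w :: complex
    by (auto simp: mult_dual_group power_int_mult_distrib fun_eq_iff)
  ultimately show ?thesis
    using inj by (auto simp: topological_group_iso_def iso_def hom_def bij_betw_def carrier_G circle_group_def
        characters_integer_group)
qed

text \<open>Evaluation at z and the power characters are the two halves of one pairing z^m, so each
  is an isomorphism onto a dual and the dual pair criterion applies, here and for the
  integers.\<close>

lemma reflexive_G: "reflexive_group G X"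
proof (rule reflexive_group_if_dual_pair[OF group_G _ group_integer_group _ evaluation_iso power_character_iso])
  show "(z powi m) = power_character M m z" if "z \<in> carrier G" for z m
    using that by (simp add: power_character_def carrier_G)
qed (simp_all add: carrier_G topspace_Z_top)

lemma reflexive_integer_group: "reflexive_group integer_group Z_top"
proof (rule reflexive_group_if_dual_pair[OF group_integer_group _ group_G _ power_character_iso evaluation_iso])
  show "power_character M m z = z powi m" if "z \<in> carrier G" for z m
    using that by (simp add: power_character_def carrier_G)
qed (simp_all add: carrier_G topspace_Z_top)

end

context divisibility_chain
begin

text \<open>The bipolar of any neighbourhood contains a ball of the sup norm, which is unbounded in the
  \<open>p\<close>-norm.\<close>

lemma not_locally_quasi_convex_Gp:
  assumes p: "1 < p"
  shows "\<not> locally_quasi_convex (Gp \<gamma> p) (Gp_topology \<gamma> p)"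
proof
  interpret circle_norm_group \<gamma> b "Gp_set \<gamma> p" "Gp_norm \<gamma> p" p by (rule circle_norm_group_Gp[OF p])
  have G: "Gp \<gamma> p = G" and X: "Gp_topology \<gamma> p = X" by (simp_all add: Gp_def Gp_topology_def)
  let ?M = "Gp_set \<gamma> p" and ?N = "Gp_norm \<gamma> p"
  have dist1: "invariant_dist ?M ?N 1 z = ?N z" if "z \<in> ?M" for z
    using that one_in_M N_inverse by (simp add: invariant_dist_def)
  assume "locally_quasi_convex (Gp \<gamma> p) (Gp_topology \<gamma> p)"
  then obtain V W where VW: "openin X W" "1 \<in> W" "W \<subseteq> V" "V \<subseteq> met.mball 1 1" "quasi_convex G X V"
    unfolding locally_quasi_convex_def G X using one_in_M one_G
    by (metis met.centre_in_mball_iff met.openin_mball zero_less_one)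
  obtain \<eta> where \<eta>: "\<eta> > 0" "met.mball 1 \<eta> \<subseteq> W" using VW(1,2) unfolding met.openin_mtopology by blast
  obtain B where B: "\<And>m. (\<forall>z\<in>?M. ?N z < \<eta> \<longrightarrow> 0 \<le> Re (z powi m)) \<Longrightarrow> m \<in> bounded_sums \<gamma> B"
    using polar_ball_bounded[OF \<eta>(1)] by blast
  \<comment> \<open>Chosen so that a sum of B terms, each moving z by at most 4 \<pi> c, moves it by
    at most B / (B + 1) \<le> 1.\<close>
  define c where "c = 1 / (4 * pi * (real B + 1))"
  have "1 \<le> pi * (real B + 1)" using pi_ge_two mult_mono[of 1 pi 1 "real B + 1"] by simp
  then have c: "0 < c" "c \<le> 1 / 4" by (auto simp: c_def field_simps)
  obtain z where z: "z \<in> Q" "\<And>n. norm (1 - z powi g n) \<le> 4 * pi * c" "1 \<le> psum p z"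
    using sup_small_psum_large[OF c p] by blast
  have zM: "z \<in> ?M" using z(1) Q_subset by blast
  have "z \<in> V"
  proof (rule ccontr)
    assume "z \<notin> V"
    then obtain \<phi> where \<phi>: "\<phi> \<in> polar G X V" "Re (\<phi> z) < 0"
      using VW(5) zM unfolding quasi_convex_def carrier_G by blast
    then obtain m where m: "\<phi> = power_character ?M m" unfolding polar_def characters_G by auto
    have "m \<in> bounded_sums \<gamma> B"
    proof (intro B ballI impI)
      fix w assume w: "w \<in> ?M" "?N w < \<eta>"
      then have "w \<in> met.mball 1 \<eta>" using dist1[OF w(1)] one_in_M by simp
      then have "w \<in> V" using \<eta>(2) VW(3) by blast
      then show "0 \<le> Re (w powi m)" using \<phi>(1) w(1) by (force simp: polar_def m power_character_def)
    qed
    then have "norm (1 - z powi m) \<le> real B * (4 * pi * c)"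
      by (rule norm_1_minus_bounded_sum_le[where \<gamma> = \<gamma>, OF norm_Q[OF z(1)] z(2)])
    also have "4 * pi * c = 1 / (real B + 1)" by (simp add: c_def)
    also have "real B * (1 / (real B + 1)) \<le> 1" by simp
    finally have "0 \<le> Re (z powi m)" by (rule Re_nonneg_if_norm_1_minus_le)
    then show False using \<phi>(2) zM by (simp add: m power_character_def)
  qed
  then have "?N z < 1" using VW(4) dist1[OF zM] by (auto simp: met.in_mball)
  moreover have "1 \<le> ?N z" unfolding Gp_norm_psum using z(3) p by (intro ge_one_powr_ge_zero) auto
  ultimately show False by simp
qed

lemma circle_sup_group_G0: "circle_sup_group \<gamma> b (G0_set \<gamma>) (G0_norm \<gamma>) 2"
proof -
  interpret circle_norm_group \<gamma> b "G0_set \<gamma>" "G0_norm \<gamma>" 2 by (rule circle_norm_group_G0)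
  show ?thesis by unfold_locales (auto simp: G0_set_def intro: G0_norm_le)
qed

end

theorem theorem2:
  fixes a \<gamma> :: "nat \<Rightarrow> int" and p :: real
  assumes a_ge_2: "\<And>n. n \<ge> 1 \<Longrightarrow> a n \<ge> 2"
    and a_sum: "summable (\<lambda>n. 1 / real_of_int (a (Suc n)))"
    and gamma_1: "\<gamma> 1 = 1"
    and gamma_Suc: "\<And>n. n \<ge> 1 \<Longrightarrow> \<gamma> (n + 1) = (\<Prod>k=1..n. a k)"
    and p: "1 < p"
  shows
    "(\<not> locally_quasi_convex (Gp \<gamma> p) (Gp_topology \<gamma> p) \<and>
      \<not> reflexive_group (Gp \<gamma> p) (Gp_topology \<gamma> p)) \<and>
     (reflexive_group (G0 \<gamma>) (G0_topology \<gamma>) \<and>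
      locally_quasi_convex (G0 \<gamma>) (G0_topology \<gamma>)) \<and>
     (\<exists>T. finest_null_group_topology \<gamma> T \<and>
        topological_group_iso integer_group T
          (dual_group (Gp \<gamma> p) (Gp_topology \<gamma> p)) (dual_topology (Gp \<gamma> p) (Gp_topology \<gamma> p))
          (power_character (Gp_set \<gamma> p)) \<and>
        topological_group_iso integer_group T
          (dual_group (G0 \<gamma>) (G0_topology \<gamma>)) (dual_topology (G0 \<gamma>) (G0_topology \<gamma>))
          (power_character (G0_set \<gamma>)) \<and>
        reflexive_group integer_group T)"
proof -
  define b where "b n = a (Suc n)" for n
  have prod: "\<gamma> (Suc n) = (\<Prod>k=1..n. a k)" for n
    using gamma_1 gamma_Suc[of n] by (cases "n = 0") auto
  interpret divisibility_chain \<gamma> b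
    by unfold_locales (use a_ge_2 a_sum gamma_1 prod in \<open>auto simp: b_def\<close>)
  interpret P: circle_norm_group \<gamma> b "Gp_set \<gamma> p" "Gp_norm \<gamma> p" p by (rule circle_norm_group_Gp[OF p])
  interpret S: circle_sup_group \<gamma> b "G0_set \<gamma>" "G0_norm \<gamma>" 2 by (rule circle_sup_group_G0)
  have GP: "Gp \<gamma> p = P.G" "Gp_topology \<gamma> p = P.X" by (simp_all add: Gp_def Gp_topology_def)
  have GS: "G0 \<gamma> = S.G" "G0_topology \<gamma> = S.X" by (simp_all add: G0_def G0_topology_def)
  \<comment> \<open>Both compact-open topologies are finest, hence equal, so one topology on the
    integers serves both duals and inherits reflexivity from the G_0 side.\<close>
  have T: "P.Z_top = S.Z_top"
    using finest_null_group_topology_unique[OF P.finest_Z_top S.finest_Z_top] .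
  have nlqc: "\<not> locally_quasi_convex P.G P.X"
    using not_locally_quasi_convex_Gp[OF p] unfolding GP .
  then have "\<not> reflexive_group P.G P.X"
    using reflexive_imp_locally_quasi_convex[OF P.group_G] by (auto simp: P.carrier_G)
  moreover have "locally_quasi_convex S.G S.X"
    by (rule reflexive_imp_locally_quasi_convex[OF S.group_G _ S.reflexive_G]) (simp add: S.carrier_G)
  ultimately show ?thesis
    unfolding GP GS
    using nlqc S.reflexive_G S.finest_Z_top P.power_character_iso[unfolded T] S.power_character_iso
      S.reflexive_integer_group
    by blast
qed

end
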